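(* Let $\rho\in(1,2)$, let $b$ be an admissible kernel with exponent $\rho$ (as defined in the context), let $A$ be an unbounded, densely defined, linear, self-adjoint, positive definite operator on the separable Hilbert space $H$ with compact inverse, and let $\{S(t)\}_{t\ge0}$ be the associated resolvent family. Then there is $C>0$ such that $$\|A^sS(t)\|_{\mathcal L(H)}\le Ct^{-s\rho},\quad t>0,\ s\in[0,1/\rho],$$ $$\|A^s\dot S(t)\|_{\mathcal L(H)}\le Ct^{-s\rho-1},\quad t>0,\ s\in[0,1/\rho],$$ $$\|A^{-s}\dot S(t)\|_{\mathcal L(H)}\le C\|b\|_{L^1(0,t)}^s\,t^{s-1},\quad t>0,\ s\in[0,1].$$ In particular, if moreover $b$ is 4-monotone, $\lim_{t\to\infty}b(t)=0$, $$\limsup_{t\to0,\infty}\frac{\frac1t\int_0^tsb(s)\,\mathrm ds}{\int_0^t-s\dot b(s)\,\mathrm ds}<+\infty,\qquad \rho=1+\frac2\pi\sup\{|\arg\hat b(\lambda)|:\operatorname{Re}\lambda>0\},$$ and $\hat b(\lambda)\sim\lambda^{1-\rho}$ as $\lambda\to\infty$, then there is $C>0$ such that $$\|A^{-s}\dot S(t)\|_{\mathcal L(H)}\le Ct^{\rho s-1},\quad t>0,\ s\in[0,1].$$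
   Context: Kernels. For $b\in L^1_{\mathrm{loc}}(\mathbb R_+)$ real-valued and of subexponential growth (i.e. $\int_0^\infty e^{-\varepsilon t}|b(t)|\,\mathrm dt<\infty$ for all $\varepsilon>0$), let $\hat b(\lambda)=\int_0^\infty e^{-\lambda t}b(t)\,\mathrm dt$, $\operatorname{Re}\lambda>0$. $b$ is 2-regular if there is $C>0$ with $|\lambda|^j|\hat b^{(j)}(\lambda)|\le C|\hat b(\lambda)|$ for all $\operatorname{Re}\lambda>0$ and $0\le j\le2$. $b$ is sectorial of angle less than $\pi/2$ if $\sup\{|\arg\hat b(\lambda)|:\operatorname{Re}\lambda>0\}<\pi/2$. We call $b$ an admissible kernel with exponent $\rho\in(1,2)$ if $0\ne b\in L^1_{\mathrm{loc}}(\mathbb R_+)$ is of subexponential growth, 2-regular, sectorial of angle less than $\pi/2$, and its boundary function $g(k)=\lim_{\varepsilon\to0+}\hat b(\varepsilon+ik)$ ($k\in\mathbb R\setminus\{0\}$) satisfies: (1) $k\mapsto g(k)/(|k|+|g(k)|)\in L^q(\mathbb R)$ for some $1\le q<\infty$; (2) there is $C>0$ such that for all $\mu>0$ $$\int_0^\infty\frac{|g(k)|}{(|k|+\mu|g(k)|)^2}\,\mathrm dk\le\frac C\mu,\qquad \int_0^\infty\frac{|k^2g'''(k)|+|kg''(k)|+|g'(k)|+1/\mu}{(|k|+\mu|g(k)|)^2}\,\mathrm dk\le \frac{C}{\mu^{1+1/\rho}}.$$ $b$ is 4-monotone if $b$ is twice continuously differentiable on $(0,\infty)$, $(-1)^nb^{(n)}(t)\ge0$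 for $t>0$ and $0\le n\le2$, and $b''$ is nonincreasing and convex. The notation $\hat b(\lambda)\sim\lambda^{1-\rho}$ as $\lambda\to\infty$ means that there are $0<c\le C$ with $c\lambda^{1-\rho}\le\hat b(\lambda)\le C\lambda^{1-\rho}$ for real $\lambda>1$. Operator and resolvent family. $A$ has eigenpairs $Ae_k=\lambda_ke_k$ with $\{e_k\}$ an orthonormal basis of $H$ and $0<\lambda_1\le\lambda_2\le\dots\to\infty$; $A^sv=\sum_k\lambda_k^s(v,e_k)e_k$ for $s\in\mathbb R$. $S(t)v=\sum_ks_k(t)(v,e_k)e_k$, $v\in H$, where $\dot s_k(t)+\lambda_k\int_0^tb(t-s)s_k(s)\,\mathrm ds=0$, $s_k(0)=1$; i.e. $u(t)=S(t)u_0$ is the solution of $\dot u(t)+A\int_0^tb(t-s)u(s)\,\mathrm ds=0$, $t>0$, $u(0)=u_0$. $\dot S$ is the derivative of $t\mapsto S(t)$ for $t>0$. $\mathcal L(H)$ is the space of bounded linear operators on $H$. *)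

theory Defs
  imports "HOL-Analysis.Analysis"
begin

subsection \<open>Kernels\<close>

text \<open>A kernel on the half-line is a function on all reals of which only the values on the positive
  half-line are ever used.\<close>

definition laplace :: "(real \<Rightarrow> real) \<Rightarrow> complex \<Rightarrow> complex" where
  "laplace b z = (LINT t:{0<..}|lebesgue. exp (- z * of_real t) * of_real (b t))"

definition locally_L1 :: "(real \<Rightarrow> real) \<Rightarrow> bool" where
  "locally_L1 b \<longleftrightarrow> (\<forall>T>0. set_integrable lebesgue {0<..T} b)"

definition subexponential :: "(real \<Rightarrow> real) \<Rightarrow> bool" where
  "subexponential b \<longleftrightarrow> (\<forall>\<epsilon>>0. set_integrable lebesgue {0<..} (\<lambda>t. exp (- \<epsilon> * t) * \<bar>b t\<bar>))"

definition two_regular :: "(real \<Rightarrow> real) \<Rightarrow> bool" where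
  "two_regular b \<longleftrightarrow> (\<exists>C>0. \<forall>z. Re z > 0 \<longrightarrow> (\<forall>j\<le>2.
     cmod z ^ j * cmod ((deriv ^^ j) (laplace b) z) \<le> C * cmod (laplace b z)))"

definition sector_angle :: "(real \<Rightarrow> real) \<Rightarrow> real" where
  "sector_angle b = (SUP z\<in>{z. Re z > 0}. \<bar>Arg (laplace b z)\<bar>)"

text \<open>The value of \<open>g\<close> at 0 is left open.\<close>

definition boundary_function :: "(real \<Rightarrow> real) \<Rightarrow> (real \<Rightarrow> complex) \<Rightarrow> bool" where
  "boundary_function b g \<longleftrightarrow>
     (\<forall>k. k \<noteq> 0 \<longrightarrow> ((\<lambda>\<epsilon>. laplace b (Complex \<epsilon> k)) \<longlongrightarrow> g k) (at_right 0))"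

text \<open>The third derivative of the boundary function only enters under an integral, so it is taken in
  the a.e. (Sobolev) sense: the second derivative is locally absolutely continuous on the positive
  half-line with density \<open>g3\<close>.\<close>

definition three_derivs :: "(real \<Rightarrow> complex) \<Rightarrow> (real \<Rightarrow> complex) \<Rightarrow> (real \<Rightarrow> complex) \<Rightarrow> (real \<Rightarrow> complex) \<Rightarrow> bool"
  where "three_derivs g g1 g2 g3 \<longleftrightarrow>
    (\<forall>k>0. (g has_vector_derivative g1 k) (at k) \<and> (g1 has_vector_derivative g2 k) (at k)) \<and>
    (\<forall>x y. 0 < x \<and> x \<le> y \<longrightarrow> set_integrable lebesgue {x..y} g3 \<and>
       g2 y - g2 x = (LINT k:{x..y}|lebesgue. g3 k))"

definition in_Lq :: "real \<Rightarrow> (real \<Rightarrow> complex) \<Rightarrow> bool" where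
  "in_Lq q f \<longleftrightarrow> f \<in> borel_measurable lebesgue \<and> integrable lebesgue (\<lambda>k. norm (f k) powr q)"

definition admissible_kernel :: "real \<Rightarrow> (real \<Rightarrow> real) \<Rightarrow> bool" where
  "admissible_kernel \<rho> b \<longleftrightarrow>
     1 < \<rho> \<and> \<rho> < 2 \<and>
     locally_L1 b \<and> \<not> (AE t in lebesgue. 0 < t \<longrightarrow> b t = 0) \<and>
     subexponential b \<and> two_regular b \<and> sector_angle b < pi / 2 \<and>
     (\<exists>g g1 g2 g3. boundary_function b g \<and> three_derivs g g1 g2 g3 \<and>
        (\<exists>q\<ge>1. in_Lq q (\<lambda>k. g k / of_real (\<bar>k\<bar> + cmod (g k)))) \<and>
        (\<exists>C>0. \<forall>\<mu>>0.
           (\<integral>\<^sup>+k\<in>{0<..}. ennreal (cmod (g k) / (\<bar>k\<bar> + \<mu> * cmod (g k))\<^sup>2) \<partial>lebesgue)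
             \<le> ennreal (C / \<mu>) \<and>
           (\<integral>\<^sup>+k\<in>{0<..}. ennreal
               ((cmod (of_real (k\<^sup>2) * g3 k) + cmod (of_real k * g2 k) + cmod (g1 k) + 1 / \<mu>)
                 / (\<bar>k\<bar> + \<mu> * cmod (g k))\<^sup>2) \<partial>lebesgue)
             \<le> ennreal (C / \<mu> powr (1 + 1 / \<rho>))))"

definition four_monotone :: "(real \<Rightarrow> real) \<Rightarrow> bool" where
  "four_monotone b \<longleftrightarrow>
     (\<forall>t>0. b differentiable at t \<and> deriv b differentiable at t) \<and>
     continuous_on {0<..} ((deriv ^^ 2) b) \<and>
     (\<forall>t>0. \<forall>n\<le>2. (-1) ^ n * (deriv ^^ n) b t \<ge> 0) \<and>
     antimono_on {0<..} ((deriv ^^ 2) b) \<and> convex_on {0<..} ((deriv ^^ 2) b)"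

definition moment_ratio :: "(real \<Rightarrow> real) \<Rightarrow> real \<Rightarrow> real" where
  "moment_ratio b t =
     (1 / t * (LINT r:{0<..t}|lebesgue. r * b r)) / (LINT r:{0<..t}|lebesgue. - r * deriv b r)"

text \<open>Since \<open>b\<close> is real, its Laplace transform is real at real arguments.\<close>

definition laplace_comparable :: "(real \<Rightarrow> real) \<Rightarrow> real \<Rightarrow> bool" where
  "laplace_comparable b \<alpha> \<longleftrightarrow> (\<exists>c C. 0 < c \<and> c \<le> C \<and> (\<forall>x>1.
     c * x powr \<alpha> \<le> Re (laplace b (of_real x)) \<and> Re (laplace b (of_real x)) \<le> C * x powr \<alpha>))"

definition L1_norm_upto :: "(real \<Rightarrow> real) \<Rightarrow> real \<Rightarrow> real" where
  "L1_norm_upto b t = (LINT r:{0<..<t}|lebesgue. \<bar>b r\<bar>)"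


subsection \<open>The operator\<close>

text \<open>An unbounded operator is a pair of a domain \<open>D\<close> and a function \<open>A\<close> whose values outside \<open>D\<close> are
  irrelevant.\<close>

definition linear_operator_on :: "'h::real_vector set \<Rightarrow> ('h \<Rightarrow> 'h) \<Rightarrow> bool" where
  "linear_operator_on D A \<longleftrightarrow> subspace D \<and>
     (\<forall>x\<in>D. \<forall>y\<in>D. A (x + y) = A x + A y) \<and> (\<forall>c. \<forall>x\<in>D. A (c *\<^sub>R x) = c *\<^sub>R A x)"

text \<open>For dense \<open>D\<close> the left-hand side says that \<open>y\<close> is in the domain of the adjoint, with value \<open>z\<close>.\<close>

definition self_adjoint_on :: "'h::real_inner set \<Rightarrow> ('h \<Rightarrow> 'h) \<Rightarrow> bool" where
  "self_adjoint_on D A \<longleftrightarrow>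
     (\<forall>y z. (\<forall>x\<in>D. inner (A x) y = inner x z) \<longleftrightarrow> (y \<in> D \<and> A y = z))"

definition compact_operator :: "('h::real_normed_vector \<Rightarrow> 'h) \<Rightarrow> bool" where
  "compact_operator K \<longleftrightarrow> bounded_linear K \<and> compact (closure (K ` cball 0 1))"

definition has_compact_inverse :: "'h::real_normed_vector set \<Rightarrow> ('h \<Rightarrow> 'h) \<Rightarrow> bool" where
  "has_compact_inverse D A \<longleftrightarrow> bij_betw A D UNIV \<and> compact_operator (inv_into D A)"

definition admissible_operator :: "'h::real_inner set \<Rightarrow> ('h \<Rightarrow> 'h) \<Rightarrow> bool" where
  "admissible_operator D A \<longleftrightarrow>
     linear_operator_on D A \<and> closure D = UNIV \<and>
     \<not> (\<exists>C. \<forall>x\<in>D. norm (A x) \<le> C * norm x) \<and>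
     self_adjoint_on D A \<and> (\<forall>x\<in>D. x \<noteq> 0 \<longrightarrow> inner (A x) x > 0) \<and>
     has_compact_inverse D A"

definition orthonormal_basis :: "(nat \<Rightarrow> 'h::real_inner) \<Rightarrow> bool" where
  "orthonormal_basis e \<longleftrightarrow> (\<forall>i j. inner (e i) (e j) = (if i = j then 1 else 0)) \<and>
     closure (span (range e)) = UNIV"

text \<open>Eigenpairs are indexed from 0.\<close>

definition eigenpairs ::
    "'h::real_inner set \<Rightarrow> ('h \<Rightarrow> 'h) \<Rightarrow> (nat \<Rightarrow> 'h) \<Rightarrow> (nat \<Rightarrow> real) \<Rightarrow> bool" where
  "eigenpairs D A e lam \<longleftrightarrow> orthonormal_basis e \<and>
     (\<forall>k. e k \<in> D \<and> A (e k) = lam k *\<^sub>R e k) \<and>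
     0 < lam 0 \<and> incseq lam \<and> filterlim lam at_top sequentially"

definition fpow :: "(nat \<Rightarrow> 'h::real_inner) \<Rightarrow> (nat \<Rightarrow> real) \<Rightarrow> real \<Rightarrow> 'h \<Rightarrow> 'h" where
  "fpow e lam s v = (\<Sum>k. (lam k powr s * inner v (e k)) *\<^sub>R e k)"

definition fpow_dom :: "(nat \<Rightarrow> 'h::real_inner) \<Rightarrow> (nat \<Rightarrow> real) \<Rightarrow> real \<Rightarrow> 'h set" where
  "fpow_dom e lam s = {v. summable (\<lambda>k. (lam k powr s * inner v (e k)) *\<^sub>R e k)}"

text \<open>The composition of the fractional power with \<open>T\<close> is an everywhere defined bounded operator of norm
  at most \<open>c\<close>. The conjuncts on the domain and on boundedness are needed because \<open>suminf\<close> and \<open>onorm\<close>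
  are total.\<close>

definition fpow_norm_le ::
    "(nat \<Rightarrow> 'h::real_inner) \<Rightarrow> (nat \<Rightarrow> real) \<Rightarrow> real \<Rightarrow> ('h \<Rightarrow> 'h) \<Rightarrow> real \<Rightarrow> bool" where
  "fpow_norm_le e lam s T c \<longleftrightarrow> range T \<subseteq> fpow_dom e lam s \<and>
     bounded_linear (\<lambda>v. fpow e lam s (T v)) \<and> onorm (\<lambda>v. fpow e lam s (T v)) \<le> c"


subsection \<open>The resolvent family\<close>

definition scalar_resolvent :: "(real \<Rightarrow> real) \<Rightarrow> real \<Rightarrow> (real \<Rightarrow> real) \<Rightarrow> bool" where
  "scalar_resolvent b \<mu> u \<longleftrightarrow> u 0 = 1 \<and> continuous_on {0..} u \<and>
     (\<forall>t>0. \<exists>u'. (u has_real_derivative u') (at t) \<and>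
        u' + \<mu> * (LINT r:{0<..<t}|lebesgue. b (t - r) * u r) = 0)"

definition resolvent_family ::
    "(real \<Rightarrow> real) \<Rightarrow> (nat \<Rightarrow> 'h::real_inner) \<Rightarrow> (nat \<Rightarrow> real) \<Rightarrow> (real \<Rightarrow> 'h \<Rightarrow> 'h) \<Rightarrow> bool" where
  "resolvent_family b e lam S \<longleftrightarrow> (\<exists>u. (\<forall>k. scalar_resolvent b (lam k) (u k)) \<and>
     (\<forall>t\<ge>0. \<forall>v. S t v = (\<Sum>k. (u k t * inner v (e k)) *\<^sub>R e k)))"

text \<open>The derivative of an operator-valued function is taken pointwise (strongly).\<close>

definition strong_deriv :: "(real \<Rightarrow> 'h \<Rightarrow> 'h::real_normed_vector) \<Rightarrow> real \<Rightarrow> 'h \<Rightarrow> 'h" where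
  "strong_deriv S t v = vector_derivative (\<lambda>r. S r v) (at t)"

end

(*
Each eigenvalue mu of the operator gives a scalar function u with Laplace transform
H(z) = 1 / (z + mu b^(z)). As b^ takes values in a sector of angle less than pi/2,
|z + mu b^(z)| is comparable to |z| + mu |b^(z)|, and 2-regularity makes H' and (z H)'' of order
1 / |z|^2. Hence t u(t) and t^2 u'(t) are absolutely convergent inverse Laplace integrals over any
line Re z = a > 0. The line a = 1/t bounds |u| and t |u'| uniformly in mu; the boundary line a = 0,
reached after an integration by parts, bounds t |u| and t^2 |u'| by the second integral condition on
the kernel, that is, by a multiple of mu^(-1/rho). The equation itself gives
|u'| <= C mu ||b||_L1(0,t). Interpolating between these bounds yields the three estimates, since the
operators are diagonal. For a nonnegative kernel ||b||_L1(0,t) <= e b^(1/t); for large t the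
b^(1/t) <= C t^(rho - 1) needed in the last estimate is the Schwarz lemma for the function
b^(z)^(1/(rho - 1)), which maps the half-plane to itself because rho - 1 is 2/pi times the angle.
*)

theory Submission
  imports Defs "HOL-Complex_Analysis.Complex_Analysis" "HOL-Probability.Sinc_Integral"
begin

section \<open>Sectors\<close>

text \<open>On vertical lines H decays only like 1 / |z|, which is not integrable, and z H is merely
  bounded; multiplying u by t and u' by t^2 supplies the derivatives that bring both down to 1 /
  |z|^2. A priori u is only known to grow at most exponentially, at a rate w depending on mu, so
  inversion is first available to the right of w. Uniformity in mu appears once the line has been
  moved to 1/t, where |exp (z t)| = e.

  Two obstacles arise on the imaginary axis. The bound 1 / |z|^2 is not integrable near 0, which is
  met by a multiplier with a double zero there. Moreover 2-regularity bounds b^'' without giving it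
  boundary limits, so (z H)'' has no known boundary values. Integration by parts moves the limit to
  (z H)', for which limits of b^ and b^' suffice; those of b^' are deduced from the
  differentiability of the boundary function. As b is real, conjugation reduces both half-axes to k
  > 0, where the integral conditions are stated.

  The interpolation parameter is s rho, which turns mu^(-1/rho) into mu^(-s).\<close>

lemma sector_norm_add_ge:
  fixes z w :: complex
  assumes "0 \<le> Re z" "0 \<le> Re w" "\<bar>Im w\<bar> \<le> s * cmod w" "0 \<le> s" "s < 1"
  shows "sqrt ((1 - s) / 2) * (cmod z + cmod w) \<le> cmod (z + w)"
proof -
  have eq: "(cmod (z + w))\<^sup>2 = (cmod z)\<^sup>2 + (cmod w)\<^sup>2 + 2 * (Re z * Re w + Im z * Im w)"
    unfolding cmod_power2 by (simp add: power2_eq_square algebra_simps)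
  \<comment> \<open>In the cross term Re (z * cnj w) the product of the real parts is nonnegative,
    so the whole term is at least - s |z| |w|. This is where the sector condition excludes
    cancellation.\<close>
  have "\<bar>Im z * Im w\<bar> \<le> cmod z * (s * cmod w)"
    unfolding abs_mult using assms by (intro mult_mono) (auto simp: abs_Im_le_cmod)
  then have "- (s * (cmod z * cmod w)) \<le> Im z * Im w" by (simp add: mult_ac)
  then have "(cmod z)\<^sup>2 + (cmod w)\<^sup>2 - 2 * (s * (cmod z * cmod w)) \<le> (cmod (z + w))\<^sup>2"
    unfolding eq using mult_nonneg_nonneg[OF assms(1,2)] by argo
  moreover have "s * (2 * (cmod z * cmod w)) \<le> s * ((cmod z)\<^sup>2 + (cmod w)\<^sup>2)"
    using assms sum_squares_bound[of "cmod z" "cmod w"] by (intro mult_left_mono) auto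
  moreover have "(1 - s) / 2 * (cmod z + cmod w)\<^sup>2 \<le> (1 - s) * ((cmod z)\<^sup>2 + (cmod w)\<^sup>2)"
  proof -
    have "(cmod z + cmod w)\<^sup>2 \<le> 2 * ((cmod z)\<^sup>2 + (cmod w)\<^sup>2)"
      using sum_squares_bound[of "cmod z" "cmod w"] by (simp add: power2_sum)
    then have "(1 - s) / 2 * (cmod z + cmod w)\<^sup>2 \<le> (1 - s) / 2 * (2 * ((cmod z)\<^sup>2 + (cmod w)\<^sup>2))"
      using assms by (intro mult_left_mono) auto
    then show ?thesis by argo
  qed
  moreover have "(1 - s) * ((cmod z)\<^sup>2 + (cmod w)\<^sup>2)
      = (cmod z)\<^sup>2 + (cmod w)\<^sup>2 - s * ((cmod z)\<^sup>2 + (cmod w)\<^sup>2)"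
    "s * (2 * (cmod z * cmod w)) = 2 * (s * (cmod z * cmod w))" by (simp_all add: left_diff_distrib)
  ultimately have "(1 - s) / 2 * (cmod z + cmod w)\<^sup>2 \<le> (cmod (z + w))\<^sup>2" by linarith
  then have "sqrt ((1 - s) / 2 * (cmod z + cmod w)\<^sup>2) \<le> cmod (z + w)"
    using real_le_lsqrt by force
  then show ?thesis unfolding real_sqrt_mult by simp
qed

text \<open>The supremum in \<open>sector_angle\<close> is conditionally complete; it is an upper
  bound because |Arg| never exceeds pi.\<close>

lemma Arg_laplace_le_sector_angle:
  assumes "Re z > 0" shows "\<bar>Arg (laplace b z)\<bar> \<le> sector_angle b"
  unfolding sector_angle_def
proof (rule cSUP_upper)
  show "bdd_above ((\<lambda>z. \<bar>Arg (laplace b z)\<bar>) ` {z. 0 < Re z})"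
    by (rule bdd_aboveI[of _ pi]) (auto simp: abs_le_iff Arg_le_pi mpi_less_Arg less_imp_le minus_le_iff)
qed (use assms in simp)

lemma sector_angle_nonneg: "0 \<le> sector_angle b"
  using Arg_laplace_le_sector_angle[of 1 b] by simp

text \<open>On [- pi/2, pi/2] the cosine is nonnegative and the sine increasing. The sine of the
  angle will be the constant \<open>s\<close> of \<open>sector_norm_add_ge\<close>.\<close>

lemma sector_Re_Im:
  assumes "\<bar>Arg w\<bar> \<le> \<theta>" "\<theta> < pi / 2"
  shows "0 \<le> Re w" "\<bar>Im w\<bar> \<le> sin \<theta> * cmod w"
proof -
  have w: "w = cmod w * exp (\<i> * Arg w)" using Arg_eq[of w] by (cases "w = 0") auto
  have "cos (Arg w) \<ge> 0" using assms by (intro cos_ge_zero) auto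
  then show "0 \<le> Re w" by (subst w) (simp add: Re_exp)
  have "\<bar>sin (Arg w)\<bar> \<le> sin \<theta>"
  proof -
    have "sin (Arg w) \<le> sin \<theta>" "sin (- \<theta>) \<le> sin (Arg w)"
      using assms by (intro sin_monotone_2pi_le; linarith)+
    then show ?thesis by simp
  qed
  then show "\<bar>Im w\<bar> \<le> sin \<theta> * cmod w"
    by (subst w) (simp add: Im_exp abs_mult mult.commute[of _ "cmod w"] mult_left_mono)
qed


section \<open>Laplace transforms\<close>

text \<open>Convergence is asked only strictly to the right of \<open>w\<close>. This leaves room to
  absorb powers of t, so that the same abscissa serves for all derivatives of the transform.\<close>

definition laplace_abs :: "(real \<Rightarrow> real) \<Rightarrow> real \<Rightarrow> bool" where
  "laplace_abs f w \<longleftrightarrow> (\<forall>x>w. set_integrable lebesgue {0<..} (\<lambda>t. exp (- x * t) * f t))"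

lemma laplace_absD:
  "laplace_abs f w \<Longrightarrow> x > w \<Longrightarrow> set_integrable lebesgue {0<..} (\<lambda>t. exp (- x * t) * f t)"
  by (simp add: laplace_abs_def)

lemma laplace_abs_times:
  assumes "laplace_abs f w" shows "laplace_abs (\<lambda>t. t * f t) w"
  unfolding laplace_abs_def
proof (intro allI impI)
  fix x assume x: "x > w"
  \<comment> \<open>At the midpoint the integral still converges, and t <= exp ((x - y) t) / (x - y)
    absorbs the factor t.\<close>
  define y where "y = (x + w) / 2"
  have y: "w < y" "y < x" using x by (auto simp: y_def)
  have I: "integrable lebesgue (\<lambda>t. indicator {0<..} t *\<^sub>R (exp (- y * t) * f t))"
    using laplace_absD[OF assms y(1)] by (simp add: set_integrable_def)
  show "set_integrable lebesgue {0<..} (\<lambda>t. exp (- x * t) * (t * f t))"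
    unfolding set_integrable_def
  proof (rule Bochner_Integration.integrable_bound)
    show "integrable lebesgue (\<lambda>t. 1 / (x - y) * (indicator {0<..} t *\<^sub>R (exp (- y * t) * f t)))"
      using I by (rule integrable_mult_right)
    \<comment> \<open>Measurability of \<open>f\<close> on the half-line is only implicit in the
      integrability at \<open>y\<close>; it is recovered by multiplying that integrand with a Borel
      function.\<close>
    have "(\<lambda>t. (t * exp (- (x - y) * t)) * (indicator {0<..} t *\<^sub>R (exp (- y * t) * f t)))
        \<in> borel_measurable lebesgue"
      by (intro borel_measurable_times borel_measurable_integrable[OF I])
         (auto intro!: borel_measurable_if_lebesgue_on measurable_completion)
    also have "(\<lambda>t. (t * exp (- (x - y) * t)) * (indicator {0<..} t *\<^sub>R (exp (- y * t) * f t)))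
       = (\<lambda>t. indicator {0<..} t *\<^sub>R (exp (- x * t) * (t * f t)))"
      by (auto simp: indicator_def exp_add[symmetric] algebra_simps)
    finally show "(\<lambda>t. indicator {0<..} t *\<^sub>R (exp (- x * t) * (t * f t))) \<in> borel_measurable lebesgue" .
    show "AE t in lebesgue. norm (indicator {0<..} t *\<^sub>R (exp (- x * t) * (t * f t)))
       \<le> norm (1 / (x - y) * (indicator {0<..} t *\<^sub>R (exp (- y * t) * f t)))"
    proof (intro AE_I2)
      fix t :: real
      show "norm (indicator {0<..} t *\<^sub>R (exp (- x * t) * (t * f t)))
       \<le> norm (1 / (x - y) * (indicator {0<..} t *\<^sub>R (exp (- y * t) * f t)))"
      proof (cases "t > 0")
        case True
        have "(x - y) * t \<le> exp ((x - y) * t)"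
          using exp_ge_add_one_self[of "(x - y) * t"] by linarith
        then have "exp (- x * t) * ((x - y) * t) \<le> exp (- x * t) * exp ((x - y) * t)" by simp
        then have "exp (- x * t) * ((x - y) * t) \<le> exp (- y * t)"
          by (simp add: exp_add[symmetric] algebra_simps)
        then have "exp (- x * t) * t * \<bar>f t\<bar> \<le> 1 / (x - y) * exp (- y * t) * \<bar>f t\<bar>"
          using y by (intro mult_right_mono) (auto simp: field_simps)
        then show ?thesis using True y by (simp add: abs_mult mult_ac)
      qed simp
    qed
  qed
qed

lemma laplace_abs_complex:
  assumes "laplace_abs f w" "Re z > w"
  shows "set_integrable lebesgue {0<..} (\<lambda>t. exp (- z * of_real t) * of_real (f t))"
  unfolding set_integrable_def
proof (rule Bochner_Integration.integrable_bound)
  have I: "integrable lebesgue (\<lambda>t. indicator {0<..} t *\<^sub>R (exp (- Re z * t) * f t))"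
    using laplace_absD[OF assms] by (simp add: set_integrable_def)
  then show "integrable lebesgue (\<lambda>t. indicator {0<..} t *\<^sub>R (exp (- Re z * t) * f t))" .
  have "(\<lambda>t. exp (- \<i> * Im z * of_real t) * complex_of_real (indicator {0<..} t *\<^sub>R (exp (- Re z * t) * f t)))
      \<in> borel_measurable lebesgue"
    by (rule borel_measurable_times[OF measurable_completion
          measurable_compose[OF borel_measurable_integrable[OF I] borel_measurable_of_real]])
       (auto intro!: borel_measurable_continuous_onI continuous_intros)
  also have "(\<lambda>t. exp (- \<i> * Im z * of_real t) * complex_of_real (indicator {0<..} t *\<^sub>R (exp (- Re z * t) * f t)))
     = (\<lambda>t. indicator {0<..} t *\<^sub>R (exp (- z * of_real t) * of_real (f t)))"
  proof
    fix t :: real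
    have "exp (- z * of_real t) = exp (- \<i> * Im z * of_real t) * complex_of_real (exp (- Re z * t))"
      by (subst complex_eq[of z]) (simp add: exp_of_real[symmetric] exp_add[symmetric] algebra_simps)
    then show "exp (- \<i> * Im z * of_real t) * complex_of_real (indicator {0<..} t *\<^sub>R (exp (- Re z * t) * f t))
       = indicator {0<..} t *\<^sub>R (exp (- z * of_real t) * of_real (f t))"
      by (simp add: indicator_def)
  qed
  finally show "(\<lambda>t. indicator {0<..} t *\<^sub>R (exp (- z * of_real t) * complex_of_real (f t))) \<in> borel_measurable lebesgue" .
  show "AE t in lebesgue. norm (indicator {0<..} t *\<^sub>R (exp (- z * of_real t) * complex_of_real (f t)))
      \<le> norm (indicator {0<..} t *\<^sub>R (exp (- Re z * t) * f t))"
    by (intro AE_I2) (auto simp: norm_mult abs_mult)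
qed

lemma laplace_abs_abs:
  assumes "laplace_abs f w" shows "laplace_abs (\<lambda>t. \<bar>f t\<bar>) w"
  unfolding laplace_abs_def
proof (intro allI impI)
  fix x assume "x > w"
  from set_integrable_abs[OF laplace_absD[OF assms this]]
  show "set_integrable lebesgue {0<..} (\<lambda>t. exp (- x * t) * \<bar>f t\<bar>)" by (simp add: abs_mult)
qed

text \<open>The second-order Taylor remainder of exp (- h t) is at most exp (r t) (|h| t)^2. Hence
  the difference quotient deviates from the claimed derivative by at most |h| M, where M is the
  transform of t^2 |f| at Re z - r, a point still to the right of \<open>w\<close>.\<close>

lemma laplace_has_field_derivative:
  assumes f: "laplace_abs f w" and z: "Re z > w"
  shows "(laplace f has_field_derivative - laplace (\<lambda>t. t * f t) z) (at z)"
proof -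
  define r where "r = (Re z - w) / 2"
  have r: "r > 0" "w < Re z - r" using z by (auto simp: r_def field_simps)
  note f1 = laplace_abs_times[OF f] and f2 = laplace_abs_times[OF laplace_abs_times[OF f]]
  define M where "M = (LINT t:{0<..}|lebesgue. exp (- (Re z - r) * t) * (t * (t * \<bar>f t\<bar>)))"
  note fa = laplace_absD[OF laplace_abs_times[OF laplace_abs_times[OF laplace_abs_abs[OF f]]] r(2)]
  have bound: "cmod (laplace f (z + h) - laplace f z + h * laplace (\<lambda>t. t * f t) z) \<le> (cmod h)\<^sup>2 * M"
    if h: "cmod h \<le> r" for h
  proof -
    have zh: "Re (z + h) > w" using h r abs_Re_le_cmod[of h] by simp
    note I = laplace_abs_complex[OF f z] laplace_abs_complex[OF f zh] laplace_abs_complex[OF f1 z]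
    have J: "set_integrable lebesgue {0<..} (\<lambda>t. exp (- (z + h) * of_real t) * of_real (f t)
         - exp (- z * of_real t) * of_real (f t) + h * (exp (- z * of_real t) * complex_of_real (t * f t)))"
      by (rule set_integral_add(1)[OF set_integral_diff(1)[OF I(2,1)] set_integrable_mult_right[OF I(3)]])
    have eq: "laplace f (z + h) - laplace f z + h * laplace (\<lambda>t. t * f t) z =
      (LINT t:{0<..}|lebesgue. exp (- (z + h) * of_real t) * of_real (f t)
         - exp (- z * of_real t) * of_real (f t) + h * (exp (- z * of_real t) * of_real (t * f t)))"
      unfolding laplace_def
      using set_integral_add(2)[OF set_integral_diff(1)[OF I(2,1)] set_integrable_mult_right[OF I(3)]]
        set_integral_diff(2)[OF I(2,1)] by simp
    have "cmod (laplace f (z + h) - laplace f z + h * laplace (\<lambda>t. t * f t) z)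
      \<le> (LINT t:{0<..}|lebesgue. norm (exp (- (z + h) * of_real t) * of_real (f t)
         - exp (- z * of_real t) * of_real (f t) + h * (exp (- z * of_real t) * complex_of_real (t * f t))))"
      unfolding eq by (rule set_integral_norm_bound[OF J])
    also have "\<dots> \<le> (LINT t:{0<..}|lebesgue. (cmod h)\<^sup>2 * (exp (- (Re z - r) * t) * (t * (t * \<bar>f t\<bar>))))"
    proof (rule set_integral_mono[OF set_integrable_norm[OF J] set_integrable_mult_right[OF fa]])
      fix t :: real assume "t \<in> {0<..}"
      then have t: "t > 0" by simp
      have "cmod (exp (- h * of_real t) - (\<Sum>k\<le>1. (- h * of_real t) ^ k / fact k))
          \<le> exp \<bar>Re (- h * of_real t)\<bar> * cmod (- h * of_real t) ^ Suc 1 / fact 1"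
        by (rule Taylor_exp)
      also have "\<dots> \<le> exp (r * t) * (cmod h * t)\<^sup>2"
        using h t abs_Re_le_cmod[of h]
        by (auto simp: norm_mult abs_mult power2_eq_square intro!: mult_right_mono)
      finally have T: "cmod (exp (- h * of_real t) - 1 + h * of_real t) \<le> exp (r * t) * (cmod h * t)\<^sup>2"
        by (simp add: algebra_simps)
      have "exp (- (z + h) * of_real t) * of_real (f t)
         - exp (- z * of_real t) * of_real (f t) + h * (exp (- z * of_real t) * complex_of_real (t * f t))
         = exp (- z * of_real t) * (exp (- h * of_real t) - 1 + h * of_real t) * of_real (f t)"
        by (simp add: algebra_simps exp_add exp_diff exp_minus divide_inverse)
      also have "norm \<dots> \<le> exp (- Re z * t) * (exp (r * t) * (cmod h * t)\<^sup>2) * \<bar>f t\<bar>"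
        unfolding norm_mult using T by (intro mult_mono) auto
      also have "\<dots> = (cmod h)\<^sup>2 * (exp (- (Re z - r) * t) * (t * (t * \<bar>f t\<bar>)))"
        by (simp add: power2_eq_square algebra_simps exp_add exp_diff exp_minus divide_inverse)
      finally show "norm (exp (- (z + h) * of_real t) * of_real (f t)
         - exp (- z * of_real t) * of_real (f t) + h * (exp (- z * of_real t) * complex_of_real (t * f t)))
         \<le> (cmod h)\<^sup>2 * (exp (- (Re z - r) * t) * (t * (t * \<bar>f t\<bar>)))" .
    qed
    also have "\<dots> = (cmod h)\<^sup>2 * M" unfolding M_def by simp
    finally show ?thesis .
  qed
  show ?thesis
    unfolding DERIV_def
  proof (rule Lim_null_comparison[where g="\<lambda>h. cmod h * M", THEN LIM_zero_cancel])
    show "((\<lambda>h. cmod h * M) \<longlongrightarrow> 0) (at 0)" by (auto intro!: tendsto_eq_intros)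
    have "\<forall>\<^sub>F h in at (0::complex). h \<noteq> 0 \<and> cmod h \<le> r"
      using r by (auto simp: eventually_at intro!: exI[of _ r])
    then show "\<forall>\<^sub>F h in at 0. norm ((laplace f (z + h) - laplace f z) / h - - laplace (\<lambda>t. t * f t) z) \<le> cmod h * M"
    proof eventually_elim
      case (elim h)
      have "(laplace f (z + h) - laplace f z) / h - - laplace (\<lambda>t. t * f t) z
          = (laplace f (z + h) - laplace f z + h * laplace (\<lambda>t. t * f t) z) / h"
        using elim by (simp add: field_simps)
      also have "norm \<dots> \<le> (cmod h)\<^sup>2 * M / cmod h"
        unfolding norm_divide using bound[of h] elim by (intro divide_right_mono) auto
      finally show ?case using elim by (simp add: power2_eq_square)
    qed
  qed
qed

lemma laplace_cnj: "laplace f (cnj z) = cnj (laplace f z)"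
proof -
  have "cnj (laplace f z) = (LINT t|lebesgue. cnj (indicator {0<..} t *\<^sub>R (exp (- z * of_real t) * of_real (f t))))"
    unfolding laplace_def set_lebesgue_integral_def by (rule Bochner_Integration.integral_cnj[symmetric])
  also have "\<dots> = laplace f (cnj z)"
    unfolding laplace_def set_lebesgue_integral_def by (simp add: exp_cnj)
  finally show ?thesis by simp
qed

lemma laplace_abs_of_bound:
  assumes m: "f \<in> borel_measurable (restrict_space lebesgue {0<..})"
    and b: "\<And>t. t > 0 \<Longrightarrow> \<bar>f t\<bar> \<le> M * exp (w * t)"
  shows "laplace_abs f w"
  unfolding laplace_abs_def
proof (intro allI impI)
  fix x assume x: "x > w"
  have "set_integrable lborel {0<..} (\<lambda>t. exp (- (t * (x - w))))"
    using integrable_I0i_exp_mscale[of "x - w"] x by simp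
  then have "set_integrable lebesgue {0<..} (\<lambda>t. exp (- (t * (x - w))))"
    unfolding set_integrable_def using integrable_completion by (metis borel_measurable_integrable)
  then have I: "set_integrable lebesgue {0<..} (\<lambda>t. M * exp (- (t * (x - w))))"
    by (intro set_integrable_mult_right) (auto elim: set_integrable_subset)
  show "set_integrable lebesgue {0<..} (\<lambda>t. exp (- x * t) * f t)"
  proof (rule set_integrable_bound[OF I])
    show "set_borel_measurable lebesgue {0<..} (\<lambda>t. exp (- x * t) * f t)"
    proof -
      have "(\<lambda>t. exp (- x * t) * f t) \<in> borel_measurable (restrict_space lebesgue {0<..})"
        by (intro borel_measurable_times m measurable_restrict_space1 measurable_completion) auto
      then show ?thesis
        unfolding set_borel_measurable_def by (subst (asm) borel_measurable_restrict_space_iff) auto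
    qed
    show "AE t in lebesgue. t \<in> {0<..} \<longrightarrow> norm (exp (- x * t) * f t) \<le> norm (M * exp (- (t * (x - w))))"
    proof (intro AE_I2 impI)
      fix t :: real assume "t \<in> {0<..}"
      then have "norm (exp (- x * t) * f t) \<le> exp (- x * t) * (M * exp (w * t))"
        using b[of t] by (simp add: abs_mult)
      also have "\<dots> = M * exp (- (t * (x - w)))" by (simp add: exp_add[symmetric] algebra_simps)
      also have "\<dots> \<le> norm (M * exp (- (t * (x - w))))" by simp
      finally show "norm (exp (- x * t) * f t) \<le> norm (M * exp (- (t * (x - w))))" .
    qed
  qed
qed

section \<open>Fourier and Laplace inversion\<close>

lemma has_bochner_integral_exp_Ioi:
  fixes z :: complex assumes z: "Re z > 0"
  shows "has_bochner_integral lborel (\<lambda>t. indicator {0<..} t *\<^sub>R exp (- z * of_real t)) (1 / z)"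
proof -
  have eq: "einterval 0 \<infinity> = {0<..}" by (auto simp: einterval_def)
  have "set_integrable lborel {0<..} (\<lambda>t. exp (- (t * Re z)))"
    using integrable_I0i_exp_mscale[OF z] .
  then have I: "set_integrable lborel (einterval 0 \<infinity>) (\<lambda>t. exp (- z * complex_of_real t))"
    unfolding eq
  proof (rule set_integrable_bound)
    show "set_borel_measurable lborel {0<..} (\<lambda>t. exp (- z * complex_of_real t))"
      unfolding set_borel_measurable_def by measurable
    show "AE t in lborel. t \<in> {0<..} \<longrightarrow> norm (exp (- z * complex_of_real t)) \<le> norm (exp (- (t * Re z)))"
      by (intro AE_I2) (simp add: mult.commute)
  qed
  have "(LBINT t=0..\<infinity>. exp (- z * of_real t)) = 0 - (- 1 / z)"
  proof (rule interval_integral_FTC_integrable[where F="\<lambda>t. - exp (- z * of_real t) / z"])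
    show "((\<lambda>t. - exp (- z * of_real t) / z) has_vector_derivative exp (- z * of_real x)) (at x)" for x
      using z by (auto intro!: derivative_eq_intros has_vector_derivative_real_field)
    show "isCont (\<lambda>t. exp (- z * of_real t)) x" for x by (intro continuous_intros)
    show "(((\<lambda>t. - exp (- z * of_real t) / z) \<circ> real_of_ereal) \<longlongrightarrow> - 1 / z) (at_right 0)"
      using z unfolding zero_ereal_def ereal_tendsto_simps by (auto intro!: tendsto_eq_intros)
    have "((\<lambda>t. exp (- Re z * t)) \<longlongrightarrow> 0) at_top"
      using z by real_asymp
    then have "((\<lambda>t. exp (- z * of_real t)) \<longlongrightarrow> 0) at_top"
      by (subst tendsto_norm_zero_iff[symmetric]) simp
    then have "((\<lambda>t. - exp (- z * of_real t) / z) \<longlongrightarrow> - 0 / z) at_top"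
      using z by (intro tendsto_intros) auto
    then show "(((\<lambda>t. - exp (- z * of_real t) / z) \<circ> real_of_ereal) \<longlongrightarrow> 0) (at_left \<infinity>)"
      unfolding ereal_tendsto_simps by simp
    show "set_integrable lborel (einterval 0 \<infinity>) (\<lambda>t. exp (- z * complex_of_real t))" by (rule I)
  qed simp
  then show ?thesis
    using I unfolding has_bochner_integral_iff eq
    by (simp add: interval_lebesgue_integral_def eq set_integrable_def set_lebesgue_integral_def)
qed

text \<open>The right-hand side is the Poisson kernel. The half-lines k > 0 and k < 0 contribute 1 /
  (\<epsilon> - i x) and 1 / (\<epsilon> + i x); the point k = 0 belongs to neither, which is why
  the integrands agree only almost everywhere.\<close>

lemma has_bochner_integral_exp_abs:
  assumes e: "\<epsilon> > 0"
  shows "has_bochner_integral lborel (\<lambda>k. exp (\<i> * of_real (k * x)) * of_real (exp (- \<epsilon> * \<bar>k\<bar>)))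
    (of_real (2 * \<epsilon> / (\<epsilon>\<^sup>2 + x\<^sup>2)))"
proof -
  have A: "has_bochner_integral lborel (\<lambda>k. indicator {0<..} k *\<^sub>R exp (- Complex \<epsilon> (- y) * of_real k))
      (1 / Complex \<epsilon> (- y))" for y
    using e by (intro has_bochner_integral_exp_Ioi) simp
  have B: "has_bochner_integral lborel (\<lambda>k. indicator {0<..} (0 + -1 * k) *\<^sub>R exp (- Complex \<epsilon> x * of_real (0 + -1 * k)))
      (1 / Complex \<epsilon> x)"
    using A[of "- x"] unfolding has_bochner_integral_iff
    by (subst lborel_integrable_real_affine_iff, simp, subst (asm) lborel_integral_real_affine[of "-1" _ 0]) auto
  have C: "1 / Complex \<epsilon> (- x) + 1 / Complex \<epsilon> x = of_real (2 * \<epsilon> / (\<epsilon>\<^sup>2 + x\<^sup>2))"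
    using e by (simp add: complex_eq_iff Re_divide Im_divide add_divide_distrib[symmetric] power2_eq_square)
  have D: "AE k in lborel. k \<noteq> (0::real)" by (rule AE_lborel_singleton)
  have "has_bochner_integral lborel (\<lambda>k. indicator {0<..} k *\<^sub>R exp (- Complex \<epsilon> (- x) * of_real k) +
      indicator {0<..} (0 + -1 * k) *\<^sub>R exp (- Complex \<epsilon> x * of_real (0 + -1 * k)))
      (of_real (2 * \<epsilon> / (\<epsilon>\<^sup>2 + x\<^sup>2)))"
    using has_bochner_integral_add[OF A[of x] B] unfolding C .
  then show ?thesis
  proof (rule has_bochner_integralI_AE)
    show "AE k in lborel. indicator {0<..} k *\<^sub>R exp (- Complex \<epsilon> (- x) * of_real k) +
      indicator {0<..} (0 + -1 * k) *\<^sub>R exp (- Complex \<epsilon> x * of_real (0 + -1 * k))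
      = exp (\<i> * of_real (k * x)) * of_real (exp (- \<epsilon> * \<bar>k\<bar>))"
      using D
    proof eventually_elim
      case (elim k)
      have "exp (\<i> * of_real (k * x)) * complex_of_real (exp (- \<epsilon> * \<bar>k\<bar>)) = exp (\<i> * of_real (k * x) - of_real (\<epsilon> * \<bar>k\<bar>))"
        by (simp add: exp_of_real[symmetric] exp_add[symmetric])
      moreover have "\<i> * of_real (k * x) - of_real (\<epsilon> * \<bar>k\<bar>)
          = (if k > 0 then - Complex \<epsilon> (- x) * of_real k else - Complex \<epsilon> x * of_real (0 + -1 * k))"
        by (simp add: complex_eq_iff)
      ultimately show ?case using elim by (auto simp: indicator_def)
    qed
    show "(\<lambda>k. exp (\<i> * of_real (k * x)) * of_real (exp (- \<epsilon> * \<bar>k\<bar>))) \<in> borel_measurable lborel"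
      by measurable
  qed
qed

lemma has_bochner_integral_inverse_1_plus_square:
  "has_bochner_integral lborel (\<lambda>x::real. inverse (1 + x\<^sup>2)) pi"
  using integrable_inverse_1_plus_square LBINT_inverse_1_plus_square
  by (simp add: has_bochner_integral_iff set_integrable_def interval_lebesgue_integral_def
      set_lebesgue_integral_def einterval_def)

text \<open>Abel summation: the factor \<open>exp (- \<epsilon> * \<bar>k\<bar>)\<close> turns the inversion integral into the Poisson
  integral of \<open>\<phi>\<close>.\<close>

lemma fourier_inversion:
  fixes \<phi> :: "real \<Rightarrow> complex"
  assumes I: "integrable lborel \<phi>" and M: "\<And>s. cmod (\<phi> s) \<le> M" and c: "isCont \<phi> t"
    and \<Phi>: "\<And>k. \<Phi> k = (LBINT s. exp (- (\<i> * of_real (k * s))) * \<phi> s)" and I\<Phi>: "integrable lborel \<Phi>"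
  shows "(LBINT k. exp (\<i> * of_real (k * t)) * \<Phi> k) = 2 * pi * \<phi> t"
proof -
  have [measurable]: "\<phi> \<in> borel_measurable borel" "\<Phi> \<in> borel_measurable borel"
    using I I\<Phi> by (auto dest: borel_measurable_integrable)
  have Abel: "(LBINT k. exp (\<i> * of_real (k * t)) * of_real (exp (- \<epsilon> * \<bar>k\<bar>)) * \<Phi> k)
      = (LBINT y. of_real (2 * inverse (1 + y\<^sup>2)) * \<phi> (t + \<epsilon> * y))" if e: "\<epsilon> > 0" for \<epsilon>
  proof -
    define F where "F k s = exp (\<i> * of_real (k * (t - s))) * of_real (exp (- \<epsilon> * \<bar>k\<bar>)) * \<phi> s" for k s
    have [measurable]: "case_prod F \<in> borel_measurable (borel \<Otimes>\<^sub>M borel)"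
      unfolding F_def by measurable
    \<comment> \<open>Without the damping factor the double integrand would not decay in k; with it,
      the order of integration can be exchanged.\<close>
    have IF: "integrable (lborel \<Otimes>\<^sub>M lborel) (case_prod F)"
    proof (rule lborel_pair.Fubini_integrable)
      have "integrable lborel (\<lambda>k. exp (- \<epsilon> * \<bar>k\<bar>) * (LBINT s. cmod (\<phi> s)))"
        using has_bochner_integral_exp_abs[OF e, of 0]
        by (intro integrable_mult_left, subst complex_of_real_integrable_eq[symmetric])
           (simp add: has_bochner_integral_iff)
      then show "integrable lborel (\<lambda>k. LBINT s. norm (case (k, s) of (k, s) \<Rightarrow> F k s))"
        by (simp add: F_def norm_mult)
      show "AE k in lborel. integrable lborel (\<lambda>s. case (k, s) of (k, s) \<Rightarrow> F k s)"
      proof (intro AE_I2)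
        fix k :: real
        show "integrable lborel (\<lambda>s. case (k, s) of (k, s) \<Rightarrow> F k s)"
          unfolding F_def prod.case
        proof (rule Bochner_Integration.integrable_bound[OF I])
          show "AE s in lborel. norm (exp (\<i> * of_real (k * (t - s))) * of_real (exp (- \<epsilon> * \<bar>k\<bar>)) * \<phi> s) \<le> norm (\<phi> s)"
            using e by (intro AE_I2) (simp add: norm_mult mult_left_le_one_le)
        qed measurable
      qed
    qed measurable
    have a1: "(LBINT k. exp (\<i> * of_real (k * t)) * of_real (exp (- \<epsilon> * \<bar>k\<bar>)) * \<Phi> k) = (LBINT k. LBINT s. F k s)"
    proof (rule Bochner_Integration.integral_cong[OF refl])
      fix k
      have "exp (\<i> * of_real (k * t)) * of_real (exp (- \<epsilon> * \<bar>k\<bar>)) * \<Phi> k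
        = (LBINT s. exp (\<i> * of_real (k * t)) * of_real (exp (- \<epsilon> * \<bar>k\<bar>)) * (exp (- (\<i> * of_real (k * s))) * \<phi> s))"
        unfolding \<Phi> by (rule integral_mult_right_zero[symmetric])
      also have "\<dots> = (LBINT s. F k s)"
        unfolding F_def by (intro Bochner_Integration.integral_cong refl)
          (simp add: algebra_simps exp_diff exp_minus divide_inverse)
      finally show "exp (\<i> * of_real (k * t)) * of_real (exp (- \<epsilon> * \<bar>k\<bar>)) * \<Phi> k = (LBINT s. F k s)" .
    qed
    have a2: "(LBINT k. LBINT s. F k s) = (LBINT s. LBINT k. F k s)"
      using lborel_pair.Fubini_integral[OF IF] by simp
    have a3: "(LBINT s. LBINT k. F k s) = (LBINT s. of_real (2 * \<epsilon> / (\<epsilon>\<^sup>2 + (t - s)\<^sup>2)) * \<phi> s)"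
    proof (rule Bochner_Integration.integral_cong[OF refl])
      fix s
      show "(LBINT k. F k s) = of_real (2 * \<epsilon> / (\<epsilon>\<^sup>2 + (t - s)\<^sup>2)) * \<phi> s"
        unfolding F_def using has_bochner_integral_exp_abs[OF e, of "t - s"]
        by (subst integral_mult_left_zero) (simp add: has_bochner_integral_iff)
    qed
    \<comment> \<open>The substitution s = t + \<epsilon> y moves the whole dependence on \<epsilon>
      from the Poisson kernel into the argument of \<open>\<phi>\<close>.\<close>
    have a4: "(LBINT s. of_real (2 * \<epsilon> / (\<epsilon>\<^sup>2 + (t - s)\<^sup>2)) * \<phi> s)
        = of_real \<epsilon> * (LBINT y. of_real (2 * \<epsilon> / (\<epsilon>\<^sup>2 + (t - (t + \<epsilon> * y))\<^sup>2)) * \<phi> (t + \<epsilon> * y))"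
      using e by (subst lborel_integral_real_affine[of \<epsilon> _ t]) (auto simp: scaleR_conv_of_real)
    have a5: "\<dots> = (LBINT y. of_real \<epsilon> * (of_real (2 * \<epsilon> / (\<epsilon>\<^sup>2 + (t - (t + \<epsilon> * y))\<^sup>2)) * \<phi> (t + \<epsilon> * y)))"
      by (rule integral_mult_right_zero[symmetric]) 
    have a6: "\<dots> = (LBINT y. of_real (2 * inverse (1 + y\<^sup>2)) * \<phi> (t + \<epsilon> * y))"
    proof (rule Bochner_Integration.integral_cong[OF refl])
      fix y
      have "\<epsilon> * (2 * \<epsilon> / (\<epsilon>\<^sup>2 + (t - (t + \<epsilon> * y))\<^sup>2)) = 2 * inverse (1 + y\<^sup>2)"
      proof -
        have "\<epsilon>\<^sup>2 + (t - (t + \<epsilon> * y))\<^sup>2 = \<epsilon>\<^sup>2 * (1 + y\<^sup>2)" by (simp add: algebra_simps power2_eq_square)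
        moreover have "\<epsilon> * (2 * \<epsilon> / (\<epsilon>\<^sup>2 * q)) = 2 * inverse q" if "q > 0" for q
          using e that by (simp add: field_simps power2_eq_square)
        moreover have "1 + y\<^sup>2 > 0" by (simp add: add_pos_nonneg)
        ultimately show ?thesis by metis
      qed
      from arg_cong[OF this, of "\<lambda>r. complex_of_real r * \<phi> (t + \<epsilon> * y)"] show "of_real \<epsilon> * (of_real (2 * \<epsilon> / (\<epsilon>\<^sup>2 + (t - (t + \<epsilon> * y))\<^sup>2)) * \<phi> (t + \<epsilon> * y))
        = of_real (2 * inverse (1 + y\<^sup>2)) * \<phi> (t + \<epsilon> * y)"
        by (simp only: of_real_mult mult.assoc)
    qed
    show ?thesis
      by (rule a1[THEN trans, OF a2[THEN trans, OF a3[THEN trans, OF a4[THEN trans, OF a5[THEN trans, OF a6]]]]])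
  qed
  \<comment> \<open>Both sides of \<open>Abel\<close> pass to the limit along a sequence: the left
    one dominated by |\<open>\<Phi>\<close>|, the right one by 2 M / (1 + y^2), with continuity of
    \<open>\<phi>\<close> used only at the point t.\<close>
  define \<epsilon> where "\<epsilon> n = 1 / real (Suc n)" for n
  have e: "\<epsilon> n > 0" for n by (simp add: \<epsilon>_def)
  have e0: "\<epsilon> \<longlonglongrightarrow> 0" unfolding \<epsilon>_def by real_asymp
  have "(\<lambda>n. LBINT k. exp (\<i> * of_real (k * t)) * of_real (exp (- \<epsilon> n * \<bar>k\<bar>)) * \<Phi> k)
      \<longlonglongrightarrow> (LBINT k. exp (\<i> * of_real (k * t)) * \<Phi> k)"
  proof (rule integral_dominated_convergence[where w="\<lambda>k. cmod (\<Phi> k)"])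
    show "integrable lborel (\<lambda>k. cmod (\<Phi> k))" using I\<Phi> by simp
    show "AE k in lborel. (\<lambda>n. exp (\<i> * of_real (k * t)) * of_real (exp (- \<epsilon> n * \<bar>k\<bar>)) * \<Phi> k)
        \<longlonglongrightarrow> exp (\<i> * of_real (k * t)) * \<Phi> k"
    proof (intro AE_I2)
      fix k :: real
      have "(\<lambda>n. exp (\<i> * of_real (k * t)) * of_real (exp (- \<epsilon> n * \<bar>k\<bar>)) * \<Phi> k)
        \<longlonglongrightarrow> exp (\<i> * of_real (k * t)) * of_real (exp (- 0 * \<bar>k\<bar>)) * \<Phi> k"
        by (intro tendsto_intros e0)
      then show "(\<lambda>n. exp (\<i> * of_real (k * t)) * of_real (exp (- \<epsilon> n * \<bar>k\<bar>)) * \<Phi> k)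
        \<longlonglongrightarrow> exp (\<i> * of_real (k * t)) * \<Phi> k" by simp
    qed
    show "AE k in lborel. norm (exp (\<i> * of_real (k * t)) * of_real (exp (- \<epsilon> n * \<bar>k\<bar>)) * \<Phi> k) \<le> cmod (\<Phi> k)" for n
      using e[of n] by (intro AE_I2) (simp add: norm_mult mult_left_le_one_le)
  qed measurable
  moreover have "(\<lambda>n. LBINT y. of_real (2 * inverse (1 + y\<^sup>2)) * \<phi> (t + \<epsilon> n * y))
      \<longlonglongrightarrow> (LBINT y. of_real (2 * inverse (1 + y\<^sup>2)) * \<phi> t)"
  proof (rule integral_dominated_convergence[where w="\<lambda>y. 2 * inverse (1 + y\<^sup>2) * M"])
    show "integrable lborel (\<lambda>y. 2 * inverse (1 + y\<^sup>2) * M)"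
      using has_bochner_integral_inverse_1_plus_square
      by (intro integrable_mult_left integrable_mult_right) (simp add: has_bochner_integral_iff)
    show "AE y in lborel. (\<lambda>n. of_real (2 * inverse (1 + y\<^sup>2)) * \<phi> (t + \<epsilon> n * y))
        \<longlonglongrightarrow> of_real (2 * inverse (1 + y\<^sup>2)) * \<phi> t"
    proof (intro AE_I2 tendsto_mult tendsto_const)
      fix y :: real
      have "(\<lambda>n. t + \<epsilon> n * y) \<longlonglongrightarrow> t + 0 * y" by (intro tendsto_intros e0)
      then show "(\<lambda>n. \<phi> (t + \<epsilon> n * y)) \<longlonglongrightarrow> \<phi> t" using isCont_tendsto_compose[OF c] by simp
    qed
    show "AE y in lborel. norm (of_real (2 * inverse (1 + y\<^sup>2)) * \<phi> (t + \<epsilon> n * y)) \<le> 2 * inverse (1 + y\<^sup>2) * M" for n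
    proof (intro AE_I2)
      fix y :: real
      have "norm (of_real (2 * inverse (1 + y\<^sup>2)) * \<phi> (t + \<epsilon> n * y)) = 2 * inverse (1 + y\<^sup>2) * cmod (\<phi> (t + \<epsilon> n * y))"
        unfolding norm_mult norm_of_real by (simp add: add_nonneg_nonneg)
      then show "norm (of_real (2 * inverse (1 + y\<^sup>2)) * \<phi> (t + \<epsilon> n * y)) \<le> 2 * inverse (1 + y\<^sup>2) * M"
        using M by (simp add: mult_left_mono)
    qed
  qed measurable
  moreover have "(LBINT y. of_real (2 * inverse (1 + y\<^sup>2)) * \<phi> t) = 2 * pi * \<phi> t"
  proof -
    have "(LBINT y. complex_of_real (2 * inverse (1 + y\<^sup>2))) = of_real (LBINT y. 2 * inverse (1 + y\<^sup>2))"
      by (rule integral_complex_of_real)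
    then show ?thesis
      using has_bochner_integral_inverse_1_plus_square by (simp add: has_bochner_integral_iff)
  qed
  ultimately show ?thesis
    unfolding Abel[OF e] by (metis (no_types, lifting) LIMSEQ_unique)
qed

text \<open>Fourier inversion for exp (- a s) f(s), extended by zero to s <= 0. Because a > w this
  function is integrable and bounded, and the jump at 0 is harmless since only the continuity point
  t > 0 is evaluated.\<close>

lemma laplace_inversion:
  assumes c: "continuous_on {0<..} f" and b: "\<And>t. t > 0 \<Longrightarrow> \<bar>f t\<bar> \<le> M * exp (w * t)"
    and a: "a > w" and I: "integrable lborel (\<lambda>k. laplace f (Complex a k))" and t: "t > 0"
  shows "(LBINT k. exp (Complex a k * of_real t) * laplace f (Complex a k)) = 2 * pi * of_real (f t)"
proof -
  define \<phi> where "\<phi> s = indicator {0<..} s *\<^sub>R (exp (- of_real a * of_real s) * complex_of_real (f s))" for s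
  have cont: "continuous_on {0<..} (\<lambda>s. exp (- of_real a * of_real s) * complex_of_real (f s))"
    by (intro continuous_intros c)
  then have "(\<lambda>s. indicator {0<..} s *\<^sub>R (exp (- of_real a * of_real s) * complex_of_real (f s))) \<in> borel_measurable borel"
    by (intro borel_measurable_continuous_on_indicator) auto
  then have [measurable]: "\<phi> \<in> borel_measurable borel"
    by (simp add: \<phi>_def[abs_def])
  have m: "f \<in> borel_measurable (restrict_space lebesgue {0<..})"
    by (rule continuous_imp_measurable_on_sets_lebesgue[OF c]) simp
  have "laplace_abs f w" using laplace_abs_of_bound[OF m b] .
  then have "integrable lebesgue \<phi>"
    using laplace_abs_complex[of f w "of_real a"] a unfolding \<phi>_def set_integrable_def by simp
  then have I\<phi>: "integrable lborel \<phi>" by (subst (asm) integrable_completion) auto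
  have "(LBINT k. exp (\<i> * of_real (k * t)) * laplace f (Complex a k)) = 2 * pi * \<phi> t"
  proof (rule fourier_inversion[OF I\<phi>])
    show "cmod (\<phi> s) \<le> \<bar>M\<bar>" for s
    proof (cases "s > 0")
      case True
      have "exp (- (a * s)) * \<bar>f s\<bar> \<le> exp (- (a * s)) * (M * exp (w * s))"
        using b[OF True] by simp
      also have "\<dots> = M * exp (- ((a - w) * s))" by (simp add: exp_add[symmetric] algebra_simps)
      also have "\<dots> \<le> \<bar>M\<bar> * 1" using True a by (intro mult_mono) auto
      finally show ?thesis using True by (simp add: \<phi>_def norm_mult)
    qed (simp add: \<phi>_def)
    have "isCont (\<lambda>s. exp (- of_real a * of_real s) * complex_of_real (f s)) t"
      using cont t by (simp add: continuous_on_eq_continuous_at)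
    moreover have "\<forall>\<^sub>F s in nhds t. \<phi> s = exp (- of_real a * of_real s) * complex_of_real (f s)"
      using t by (auto simp: eventually_nhds \<phi>_def intro!: exI[of _ "{0<..}"])
    ultimately show "isCont \<phi> t" by (simp only: isCont_cong)
    show "laplace f (Complex a k) = (LBINT s. exp (- (\<i> * of_real (k * s))) * \<phi> s)" for k
    proof -
      have "exp (- Complex a k * of_real s) = exp (- (\<i> * of_real (k * s))) * exp (- of_real a * of_real s)" for s
        by (simp add: Complex_eq exp_add[symmetric] algebra_simps)
      then have eq: "indicator {0<..} s *\<^sub>R (exp (- Complex a k * of_real s) * of_real (f s))
          = exp (- (\<i> * of_real (k * s))) * \<phi> s" for s
        by (simp add: \<phi>_def)
      have "(LINT s|lebesgue. exp (- (\<i> * of_real (k * s))) * \<phi> s) = (LBINT s. exp (- (\<i> * of_real (k * s))) * \<phi> s)"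
        by (rule integral_completion) measurable
      then show ?thesis unfolding laplace_def set_lebesgue_integral_def eq .
    qed
  qed (rule I)
  moreover have "exp (Complex a k * of_real t) = exp (of_real (a * t)) * exp (\<i> * of_real (k * t))" for k
    by (simp add: Complex_eq exp_add[symmetric] algebra_simps)
  ultimately have "(LBINT k. exp (Complex a k * of_real t) * laplace f (Complex a k)) =
     exp (of_real (a * t)) * (2 * pi * \<phi> t)"
    by (simp only: mult.assoc integral_mult_right_zero)
  then show ?thesis using t by (simp add: \<phi>_def exp_minus exp_of_real)
qed

lemma integral_convolution:
  fixes P Q :: "real \<Rightarrow> complex"
  assumes P: "integrable lborel P" and Q: "integrable lborel Q"
  shows "(LBINT t. LBINT r. P r * Q (t - r)) = (LBINT r. P r) * (LBINT s. Q s)"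
proof -
  have [measurable]: "P \<in> borel_measurable borel" "Q \<in> borel_measurable borel"
    using P Q by (auto dest: borel_measurable_integrable)
  have Qs: "integrable lborel (\<lambda>t. Q (t - r))" "(LBINT t. Q (t - r)) = (LBINT s. Q s)"
    "(LBINT t. cmod (Q (t - r))) = (LBINT s. cmod (Q s))" for r
    using lborel_integrable_real_affine[OF Q, of 1 "- r"] lborel_integral_real_affine[of 1 Q "- r"]
      lborel_integral_real_affine[of 1 "\<lambda>s. cmod (Q s)" "- r"] by (auto simp: add.commute)
  have I: "integrable (lborel \<Otimes>\<^sub>M lborel) (\<lambda>(r, t). P r * Q (t - r))"
  proof (rule lborel_pair.Fubini_integrable)
    have "integrable lborel (\<lambda>r. cmod (P r) * (LBINT s. cmod (Q s)))"
      using P by (intro integrable_mult_left) auto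
    then show "integrable lborel (\<lambda>r. LBINT t. norm (case (r, t) of (r, t) \<Rightarrow> P r * Q (t - r)))"
      by (simp add: norm_mult Qs)
    show "AE r in lborel. integrable lborel (\<lambda>t. case (r, t) of (r, t) \<Rightarrow> P r * Q (t - r))"
      using Qs by (auto intro!: AE_I2)
  qed measurable
  show ?thesis
    using lborel_pair.Fubini_integral[OF I] by (simp add: Qs)
qed

section \<open>The scalar equation\<close>

text \<open>Subexponential growth speaks of |b| only, so the measurability of b itself is taken from
  local integrability, as a pointwise limit of the truncations to (0, n + 1].\<close>

lemma kernel_laplace_abs:
  assumes "locally_L1 b" "subexponential b" shows "laplace_abs b 0"
  unfolding laplace_abs_def
proof (intro allI impI)
  fix x :: real assume x: "x > 0"
  have m: "(\<lambda>t. indicator {0<..} t * b t) \<in> borel_measurable lebesgue"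
  proof (rule borel_measurable_LIMSEQ_real)
    show "(\<lambda>t. indicator {0<..real (Suc n)} t * b t) \<in> borel_measurable lebesgue" for n
      using assms(1)[unfolded locally_L1_def, rule_format, of "real (Suc n)"]
      by (simp add: set_integrable_def borel_measurable_integrable)
    show "(\<lambda>n. indicator {0<..real (Suc n)} t * b t) \<longlonglongrightarrow> indicator {0<..} t * b t" for t
    proof (rule tendsto_eventually)
      obtain N where "t \<le> real N" using real_arch_simple by blast
      then show "\<forall>\<^sub>F n in sequentially. indicator {0<..real (Suc n)} t * b t = indicator {0<..} t * b t"
        by (intro eventually_sequentiallyI[of N]) (auto simp: indicator_def)
    qed
  qed
  show "set_integrable lebesgue {0<..} (\<lambda>t. exp (- x * t) * b t)"
  proof (rule set_integrable_bound)
    show "set_integrable lebesgue {0<..} (\<lambda>t. exp (- x * t) * \<bar>b t\<bar>)"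
      using assms(2) x by (simp add: subexponential_def)
    have "(\<lambda>t. exp (- x * t) * (indicator {0<..} t * b t)) \<in> borel_measurable lebesgue"
      by (intro borel_measurable_times m measurable_completion) measurable
    then show "set_borel_measurable lebesgue {0<..} (\<lambda>t. exp (- x * t) * b t)"
      unfolding set_borel_measurable_def by (simp add: mult_ac)
  qed (auto simp: abs_mult)
qed

text \<open>The kernel is merely Lebesgue measurable, which does not fit the Borel product measure
  in Fubini's theorem. \<open>B\<close> is a Borel modification supported on the positive half-line
  with the same transform.\<close>

lemma laplace_abs_borel_rep:
  assumes b: "laplace_abs b w"
  obtains B where "B \<in> borel_measurable borel" "\<And>r. r \<le> 0 \<Longrightarrow> B r = 0"
    "(\<lambda>r. indicator {0<..} r * b r) \<in> borel_measurable lebesgue"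
    "AE r in lebesgue. indicator {0<..} r * b r = B r"
    "\<And>x. x > w \<Longrightarrow> integrable lborel (\<lambda>r. exp (- x * r) * B r)"
    "\<And>z. laplace b z = (LBINT r. exp (- z * of_real r) * of_real (B r))"
proof -
  have I: "integrable lebesgue (\<lambda>t. indicator {0<..} t *\<^sub>R (exp (- (w + 1) * t) * b t))"
    using laplace_absD[OF b, of "w + 1"] by (simp add: set_integrable_def)
  have "(\<lambda>t. exp ((w + 1) * t) * (indicator {0<..} t *\<^sub>R (exp (- (w + 1) * t) * b t))) \<in> borel_measurable lebesgue"
    by (intro borel_measurable_times borel_measurable_integrable[OF I] measurable_completion) measurable
  moreover have "exp ((w + 1) * t) * (indicator {0<..} t *\<^sub>R (exp (- (w + 1) * t) * b t)) = indicator {0<..} t * b t" for t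
    by (simp add: indicator_def exp_add[symmetric] algebra_simps)
  ultimately have m: "(\<lambda>t. indicator {0<..} t * b t) \<in> borel_measurable lebesgue" by (simp only:)
  then obtain B' where B': "B' \<in> borel_measurable borel" "AE t in lborel. indicator {0<..} t * b t = B' t"
    using completion_ex_borel_measurable_real by fastforce
  define B where "B t = indicator {0<..} t * B' t" for t
  have B: "B \<in> borel_measurable borel" unfolding B_def[abs_def] using B'(1) by measurable
  have "AE t in lborel. indicator {0<..} t * b t = B t"
    using B'(2) by eventually_elim (auto simp: B_def indicator_def)
  then have ae: "AE t in lebesgue. indicator {0<..} t * b t = B t" by (rule AE_completion)
  show ?thesis
  proof (rule that[OF B _ m ae])
    show "B r = 0" if "r \<le> 0" for r using that by (simp add: B_def)
    show "integrable lborel (\<lambda>r. exp (- x * r) * B r)" if "x > w" for x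
    proof -
      have "integrable lebesgue (\<lambda>t. indicator {0<..} t *\<^sub>R (exp (- x * t) * b t))"
        using laplace_absD[OF b that] by (simp add: set_integrable_def)
      then have "integrable lebesgue (\<lambda>r. exp (- x * r) * B r)"
      proof (rule integrable_cong_AE_imp)
        show "(\<lambda>r. exp (- x * r) * B r) \<in> borel_measurable lebesgue"
          using B by (intro measurable_completion) measurable
        show "AE r in lebesgue. indicator {0<..} r *\<^sub>R (exp (- x * r) * b r) = exp (- x * r) * B r"
          using ae by eventually_elim (auto simp: mult_ac)
      qed
      then show ?thesis using B by (subst (asm) integrable_completion) auto
    qed
    show "laplace b z = (LBINT r. exp (- z * of_real r) * of_real (B r))" for z
    proof -
      have m2: "(\<lambda>r. exp (- z * complex_of_real r) * of_real (B r)) \<in> borel_measurable lborel"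
        using B by measurable
      have e: "indicator {0<..} r *\<^sub>R (exp (- z * of_real r) * of_real (b r))
          = exp (- z * of_real r) * complex_of_real (indicator {0<..} r * b r)" for r
        by (simp add: indicator_def)
      have "(LINT r|lebesgue. exp (- z * of_real r) * complex_of_real (indicator {0<..} r * b r))
          = (LINT r|lebesgue. exp (- z * of_real r) * of_real (B r))"
      proof (rule integral_cong_AE)
        show "(\<lambda>r. exp (- z * of_real r) * complex_of_real (indicator {0<..} r * b r)) \<in> borel_measurable lebesgue"
          by (intro borel_measurable_times measurable_compose[OF m borel_measurable_of_real] measurable_completion) measurable
        show "(\<lambda>r. exp (- z * of_real r) * complex_of_real (B r)) \<in> borel_measurable lebesgue"
          by (rule measurable_completion[OF m2])
        show "AE r in lebesgue. exp (- z * of_real r) * complex_of_real (indicator {0<..} r * b r)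
          = exp (- z * of_real r) * of_real (B r)"
          using ae by eventually_elim simp
      qed
      then show ?thesis
        unfolding laplace_def set_lebesgue_integral_def e using integral_completion[OF m2] by simp
    qed
  qed
qed

section \<open>Growth and transform of the scalar solution\<close>

definition conv :: "(real \<Rightarrow> real) \<Rightarrow> (real \<Rightarrow> real) \<Rightarrow> real \<Rightarrow> real" where
  "conv b u t = (LINT r:{0<..<t}|lebesgue. b (t - r) * u r)"

text \<open>Extending both factors by zero replaces the variable interval by the whole line, the
  form in which dominated convergence and the convolution theorem apply.\<close>

lemma conv_flip:
  "conv b u t = (LINT r|lebesgue. indicator {0<..} r * b r * (indicator {0<..} (t - r) * u (t - r)))"
proof -
  have "conv b u t = (LINT r|lebesgue. indicator {0<..<t} (t + -1 * r) *\<^sub>R (b (t - (t + -1 * r)) * u (t + -1 * r)))"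
    unfolding conv_def set_lebesgue_integral_def by (subst lebesgue_integral_real_affine[of "-1" _ t]) auto
  moreover have "indicator {0<..<t} (t + -1 * r) *\<^sub>R (b (t - (t + -1 * r)) * u (t + -1 * r))
    = indicator {0<..} r * b r * (indicator {0<..} (t - r) * u (t - r))" for r
    by (auto simp: indicator_def)
  ultimately show ?thesis by (simp only:)
qed

lemma conv_L1_bound:
  assumes b: "locally_L1 b" and u: "\<And>s. 0 < s \<Longrightarrow> s < t \<Longrightarrow> \<bar>u s\<bar> \<le> M" and t: "t > 0"
  shows "\<bar>conv b u t\<bar> \<le> M * L1_norm_upto b t"
proof -
  have "set_integrable lebesgue {0<..<t} b"
    using b t by (auto simp: locally_L1_def elim!: set_integrable_subset)
  from set_integrable_abs[OF this]
  have I: "integrable lebesgue (\<lambda>r. M * (indicator {0<..<t} r *\<^sub>R \<bar>b r\<bar>))"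
    unfolding set_integrable_def by (rule integrable_mult_right)
  have M: "0 \<le> M" using u[of "t / 2"] t by auto
  have "\<bar>conv b u t\<bar> \<le> (LINT r|lebesgue. norm (indicator {0<..} r * b r * (indicator {0<..} (t - r) * u (t - r))))"
    unfolding conv_flip using integral_norm_bound[of lebesgue "\<lambda>r. indicator {0<..} r * b r * (indicator {0<..} (t - r) * u (t - r))"]
    by simp
  also have "\<dots> \<le> (LINT r|lebesgue. M * (indicator {0<..<t} r *\<^sub>R \<bar>b r\<bar>))"
  proof (rule integral_mono'[OF I])
    fix r
    show "norm (indicator {0<..} r * b r * (indicator {0<..} (t - r) * u (t - r))) \<le> M * (indicator {0<..<t} r *\<^sub>R \<bar>b r\<bar>)"
      using u[of "t - r"] mult_left_mono[of "\<bar>u (t - r)\<bar>" M "\<bar>b r\<bar>"]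
      by (auto simp: indicator_def abs_mult mult.commute)
    show "0 \<le> M * (indicator {0<..<t} r *\<^sub>R \<bar>b r\<bar>)" using M by simp
  qed
  also have "\<dots> = M * L1_norm_upto b t"
    unfolding L1_norm_upto_def set_lebesgue_integral_def by (rule integral_mult_right_zero)
  finally show ?thesis .
qed

text \<open>The equation holds pointwise for t > 0 and says nothing about growth, so an exponential
  bound has to precede any transform. Afterwards the transform of u' is computed twice, by the
  convolution theorem and by parts, and equating the results gives the symbol. The rate
  \<open>w\<close> depends on \<mu>.\<close>

lemma scalar_resolvent_transform:
  assumes b: "laplace_abs b 0" and u: "scalar_resolvent b \<mu> u" and \<mu>: "\<mu> > 0"
  obtains w M where "w > 0" "M > 0"
    "\<And>t. t > 0 \<Longrightarrow> (u has_real_derivative - \<mu> * conv b u t) (at t)"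
    "continuous_on {0<..} u" "continuous_on {0<..} (\<lambda>t. - \<mu> * conv b u t)"
    "\<And>t. t > 0 \<Longrightarrow> \<bar>u t\<bar> \<le> M * exp (w * t)" "\<And>t. t > 0 \<Longrightarrow> \<bar>- \<mu> * conv b u t\<bar> \<le> M * exp (w * t)"
    "\<And>z. Re z > w \<Longrightarrow> laplace u z * (z + \<mu> * laplace b z) = 1"
    "\<And>z. Re z > w \<Longrightarrow> laplace (\<lambda>t. - \<mu> * conv b u t) z = z * laplace u z - 1"
proof -
  obtain B where B[measurable]: "B \<in> borel_measurable borel" and B0: "\<And>r. r \<le> 0 \<Longrightarrow> B r = 0"
    and ae: "AE r in lebesgue. indicator {0<..} r * b r = B r"
    and bm: "(\<lambda>r. indicator {0<..} r * b r) \<in> borel_measurable lebesgue"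
    and IB: "\<And>x. x > 0 \<Longrightarrow> integrable lborel (\<lambda>r. exp (- x * r) * B r)"
    and LB: "\<And>z. laplace b z = (LBINT r. exp (- z * of_real r) * of_real (B r))"
    by (rule laplace_abs_borel_rep[OF b]) blast
  define U where "U s = indicator {0<..} s * u s" for s
  define v where "v t = - \<mu> * conv b u t" for t
  have u0: "u 0 = 1" and cu: "continuous_on {0..} u" using u by (auto simp: scalar_resolvent_def)
  have du: "(u has_real_derivative v t) (at t)" if "t > 0" for t
  proof -
    from u that have "\<exists>u'. (u has_real_derivative u') (at t) \<and> u' + \<mu> * conv b u t = 0"
      unfolding scalar_resolvent_def conv_def by blast
    then obtain u' where "(u has_real_derivative u') (at t)" "u' + \<mu> * conv b u t = 0" by blast
    moreover from this(2) have "u' = v t" by (simp add: v_def)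
    ultimately show ?thesis by simp
  qed
  have cu': "continuous_on {0<..} u" using cu by (rule continuous_on_subset) auto
  have "(\<lambda>s. indicator {0<..} s *\<^sub>R u s) \<in> borel_measurable borel"
    by (intro borel_measurable_continuous_on_indicator cu') auto
  then have U[measurable]: "U \<in> borel_measurable borel" by (simp add: U_def[abs_def])
  have conv: "conv b u t = (LBINT r. B r * U (t - r))" for t
  proof -
    have "conv b u t = (LINT r|lebesgue. B r * U (t - r))"
      unfolding conv_flip U_def[symmetric]
    proof (rule integral_cong_AE)
      show "(\<lambda>r. B r * U (t - r)) \<in> borel_measurable lebesgue" by (intro measurable_completion) measurable
      show "(\<lambda>r. indicator {0<..} r * b r * U (t - r)) \<in> borel_measurable lebesgue"
        by (intro borel_measurable_times bm measurable_completion) measurable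
      show "AE r in lebesgue. indicator {0<..} r * b r * U (t - r) = B r * U (t - r)"
        using ae by eventually_elim simp
    qed
    then show ?thesis by (simp add: integral_completion)
  qed
  define \<beta> where "\<beta> = (LBINT r. exp (- 1 * r) * \<bar>B r\<bar>)"
  have IBabs: "integrable lborel (\<lambda>r. exp (- x * r) * \<bar>B r\<bar>)" if "x > 0" for x
    using integrable_abs[OF IB[OF that]] by (simp add: abs_mult)
  have \<beta>0: "\<beta> \<ge> 0" unfolding \<beta>_def by simp
  \<comment> \<open>For w >= 1 the weight exp (- w r) is below exp (- r), so convolution with b
    multiplies a bound m exp (w s) by at most \<open>\<beta>\<close>, whatever w is.\<close>
  have cb: "\<bar>conv b u t\<bar> \<le> m * exp (w * t) * \<beta>"
    if w: "w \<ge> 1" and m: "m \<ge> 0" "\<And>s. 0 < s \<Longrightarrow> s < t \<Longrightarrow> \<bar>u s\<bar> \<le> m * exp (w * s)" for m w t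
  proof -
    have I: "integrable lborel (\<lambda>r. m * exp (w * t) * (exp (- 1 * r) * \<bar>B r\<bar>))"
      using IBabs[of 1] by (intro integrable_mult_right) auto
    have "\<bar>conv b u t\<bar> \<le> (LBINT r. norm (B r * U (t - r)))"
      unfolding conv using integral_norm_bound[of lborel "\<lambda>r. B r * U (t - r)"] by simp
    also have "\<dots> \<le> (LBINT r. m * exp (w * t) * (exp (- 1 * r) * \<bar>B r\<bar>))"
    proof (rule integral_mono'[OF I])
      fix r :: real
      show "norm (B r * U (t - r)) \<le> m * exp (w * t) * (exp (- 1 * r) * \<bar>B r\<bar>)"
      proof (cases "0 < r \<and> r < t")
        case True
        then have "\<bar>U (t - r)\<bar> \<le> m * exp (w * (t - r))" using m(2)[of "t - r"] by (simp add: U_def)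
        also have "\<dots> \<le> m * (exp (w * t) * exp (- 1 * r))"
          unfolding exp_add[symmetric] using True w m(1) mult_right_mono[of 1 w r]
          by (intro mult_left_mono) (auto simp: algebra_simps)
        finally have "\<bar>B r\<bar> * \<bar>U (t - r)\<bar> \<le> \<bar>B r\<bar> * (m * (exp (w * t) * exp (- 1 * r)))"
          by (rule mult_left_mono) simp
        then show ?thesis by (simp add: abs_mult mult_ac)
      next
        case False
        then have "B r * U (t - r) = 0" using B0[of r] by (auto simp: U_def indicator_def)
        then show ?thesis using m(1) by (simp only: norm_zero) simp
      qed
      show "0 \<le> m * exp (w * t) * (exp (- 1 * r) * \<bar>B r\<bar>)" using m(1) by simp
    qed
    also have "\<dots> = m * exp (w * t) * \<beta>" unfolding \<beta>_def by (rule integral_mult_right_zero)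
    finally show ?thesis .
  qed
  \<comment> \<open>With this \<open>w\<close> the maximum \<open>m\<close> of \<open>exp (- w * s) * \<bar>u s\<bar>\<close> satisfies \<open>m \<le> 1 + m / 2\<close>.\<close>
  define w where "w = 2 * \<mu> * \<beta> + 1"
  have w: "w \<ge> 1" "\<mu> * \<beta> / w \<le> 1 / 2" using mult_nonneg_nonneg[of \<mu> \<beta>] \<mu> \<beta>0 by (auto simp: w_def divide_le_eq not_less)
  have ub: "\<bar>u T\<bar> \<le> 2 * exp (w * T)" if T: "T \<ge> 0" for T
  proof -
    have "continuous_on {0..T} (\<lambda>s. exp (- w * s) * \<bar>u s\<bar>)"
      by (intro continuous_intros continuous_on_subset[OF cu]) auto
    then obtain t where t: "t \<in> {0..T}" and max: "\<And>s. s \<in> {0..T} \<Longrightarrow> exp (- w * s) * \<bar>u s\<bar> \<le> exp (- w * t) * \<bar>u t\<bar>"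
      using continuous_attains_sup[of "{0..T}" "\<lambda>s. exp (- w * s) * \<bar>u s\<bar>"] T by auto
    define m where "m = exp (- w * t) * \<bar>u t\<bar>"
    have m0: "m \<ge> 0" by (simp add: m_def)
    have m: "\<bar>u s\<bar> \<le> m * exp (w * s)" if "0 \<le> s" "s \<le> T" for s
      using max[of s] that by (simp add: m_def exp_minus field_simps)
    have v: "\<bar>v s\<bar> \<le> \<mu> * (m * exp (w * s) * \<beta>)" if "0 < s" "s < t" for s
      unfolding v_def abs_mult using \<mu> that t cb[OF w(1) m0, of s] m by auto
    \<comment> \<open>With c = 1 and c = - 1 this integrates the bound on u' into one on |u t| by
      monotonicity, without forming an integral of u'.\<close>
    have mono: "(\<lambda>s. \<mu> * m * \<beta> / w * exp (w * s) - c * u s) 0 \<le> (\<lambda>s. \<mu> * m * \<beta> / w * exp (w * s) - c * u s) t"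
      if c: "\<bar>c\<bar> = 1" for c
    proof (rule DERIV_nonneg_imp_increasing_open[where f="\<lambda>s. \<mu> * m * \<beta> / w * exp (w * s) - c * u s"])
      show "0 \<le> t" using t by simp
      show "continuous_on {0..t} (\<lambda>s. \<mu> * m * \<beta> / w * exp (w * s) - c * u s)"
        by (intro continuous_intros continuous_on_subset[OF cu]) auto
      fix s assume s: "0 < s" "s < t"
      have "c * v s \<le> \<bar>c * v s\<bar>" by simp
      also have "\<dots> \<le> \<mu> * (m * exp (w * s) * \<beta>)" using v[OF s] c by (simp add: abs_mult)
      finally have "0 \<le> \<mu> * m * \<beta> * exp (w * s) - c * v s" by (simp add: mult_ac)
      moreover have "((\<lambda>s. \<mu> * m * \<beta> / w * exp (w * s) - c * u s) has_real_derivative (\<mu> * m * \<beta> * exp (w * s) - c * v s)) (at s)"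
        using w(1) by (auto intro!: derivative_eq_intros du s)
      ultimately show "\<exists>y. ((\<lambda>s. \<mu> * m * \<beta> / w * exp (w * s) - c * u s) has_real_derivative y) (at s) \<and> 0 \<le> y"
        by blast
    qed
    have "\<mu> * m * \<beta> / w \<ge> 0" using \<mu> m0 \<beta>0 w by simp
    then have "\<bar>u t\<bar> \<le> 1 + \<mu> * m * \<beta> / w * exp (w * t)"
      using mono[of 1] mono[of "-1"] u0 by simp
    also have "\<dots> \<le> 1 + m / 2 * exp (w * t)"
    proof -
      have "\<mu> * m * \<beta> / w = m * (\<mu> * \<beta> / w)" by simp
      also have "\<dots> \<le> m * (1 / 2)" using w m0 by (intro mult_left_mono) auto
      finally have "\<mu> * m * \<beta> / w \<le> m / 2" by simp
      then have "\<mu> * m * \<beta> / w * exp (w * t) \<le> m / 2 * exp (w * t)" by (rule mult_right_mono) simp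
      then show ?thesis by linarith
    qed
    finally have "exp (- w * t) * \<bar>u t\<bar> \<le> exp (- w * t) * (1 + m / 2 * exp (w * t))"
      by (rule mult_left_mono) simp
    then have "m \<le> exp (- w * t) + m / 2"
      unfolding m_def[symmetric] by (simp add: algebra_simps exp_minus)
    moreover have "exp (- w * t) \<le> 1" using t w by simp
    ultimately have "m \<le> 2" by linarith
    then have "m * exp (w * T) \<le> 2 * exp (w * T)" by (rule mult_right_mono) simp
    then show ?thesis using m[of T] T by linarith
  qed
  have vb: "\<bar>v t\<bar> \<le> 2 * \<mu> * \<beta> * exp (w * t)" if "t > 0" for t
    using \<mu> mult_left_mono[OF cb[OF w(1), of 2 t], of \<mu>] ub by (simp add: v_def abs_mult mult_ac)
  have cv: "continuous_on {0<..} v"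
    unfolding continuous_on_sequentially
  proof (intro allI ballI impI)
    fix x and t :: real assume t: "t \<in> {0<..}" and x: "(\<forall>n. x n \<in> {0<..}) \<and> x \<longlonglongrightarrow> t"
    then have "Bseq x" by (intro convergent_imp_Bseq) (auto simp: convergent_def)
    then obtain K where K: "K > 0" "\<And>n. \<bar>x n\<bar> \<le> K" by (auto simp: Bseq_def)
    have "(\<lambda>n. LBINT r. B r * U (x n - r)) \<longlonglongrightarrow> (LBINT r. B r * U (t - r))"
    proof (rule integral_dominated_convergence[where w="\<lambda>r. 2 * exp (w * K) * (exp (- 1 * r) * \<bar>B r\<bar>)"])
      show "integrable lborel (\<lambda>r. 2 * exp (w * K) * (exp (- 1 * r) * \<bar>B r\<bar>))"
        using IBabs[of 1] by (intro integrable_mult_right) auto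
      \<comment> \<open>\<open>U\<close> can jump only at 0, so convergence may fail for the single
        value r = t.\<close>
      show "AE r in lborel. (\<lambda>n. B r * U (x n - r)) \<longlonglongrightarrow> B r * U (t - r)"
        using AE_lborel_singleton[of t]
      proof eventually_elim
        case (elim r)
        have "isCont U (t - r)"
        proof (cases "t - r > 0")
          case True
          have "isCont u (t - r)" using cu' True by (simp add: continuous_on_eq_continuous_at)
          moreover have "\<forall>\<^sub>F s in nhds (t - r). U s = u s"
            using True by (auto simp: eventually_nhds U_def intro!: exI[of _ "{0<..}"])
          ultimately show ?thesis by (simp only: isCont_cong)
        next
          case False
          have "\<forall>\<^sub>F s in nhds (t - r). U s = 0"
            using False elim by (auto simp: eventually_nhds U_def intro!: exI[of _ "{..<0}"])
          then show ?thesis by (simp only: isCont_cong continuous_const)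
        qed
        moreover have "(\<lambda>n. x n - r) \<longlonglongrightarrow> t - r" using x by (intro tendsto_intros) auto
        ultimately have "(\<lambda>n. U (x n - r)) \<longlonglongrightarrow> U (t - r)" by (rule isCont_tendsto_compose)
        then show ?case by (rule tendsto_mult[OF tendsto_const])
      qed
      show "AE r in lborel. norm (B r * U (x n - r)) \<le> 2 * exp (w * K) * (exp (- 1 * r) * \<bar>B r\<bar>)" for n
      proof (intro AE_I2)
        fix r :: real
        show "norm (B r * U (x n - r)) \<le> 2 * exp (w * K) * (exp (- 1 * r) * \<bar>B r\<bar>)"
        proof (cases "0 < r \<and> r < x n")
          case True
          then have U1: "\<bar>U (x n - r)\<bar> \<le> 2 * exp (w * (x n - r))" using ub[of "x n - r"] by (simp add: U_def)
          have "w * (x n - r) \<le> w * K + - 1 * r"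
          proof -
            have "w * (x n) \<le> w * K" using K(2)[of n] w(1) by (intro mult_left_mono) auto
            moreover have "1 * r \<le> w * r" using True w(1) by (intro mult_right_mono) auto
            ultimately show ?thesis by (simp add: right_diff_distrib)
          qed
          then have "2 * exp (w * (x n - r)) \<le> 2 * (exp (w * K) * exp (- 1 * r))"
            unfolding exp_add[symmetric] by simp
          with U1 have "\<bar>U (x n - r)\<bar> \<le> 2 * (exp (w * K) * exp (- 1 * r))" by (rule order_trans)
          then have "\<bar>B r\<bar> * \<bar>U (x n - r)\<bar> \<le> \<bar>B r\<bar> * (2 * (exp (w * K) * exp (- 1 * r)))"
            by (rule mult_left_mono) simp
          then show ?thesis by (simp add: abs_mult mult_ac)
        next
          case False
          then have "B r * U (x n - r) = 0" using B0[of r] by (auto simp: U_def indicator_def)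
          then show ?thesis by (simp only: norm_zero) simp
        qed
      qed
    qed measurable
    then have "(\<lambda>n. - \<mu> * (LBINT r. B r * U (x n - r))) \<longlonglongrightarrow> - \<mu> * (LBINT r. B r * U (t - r))"
      by (intro tendsto_intros)
    then show "(v \<circ> x) \<longlonglongrightarrow> v t" by (simp add: v_def conv o_def)
  qed
  define M where "M = 2 + 2 * \<mu> * \<beta>"
  have M: "M > 0" using \<mu> \<beta>0 by (simp add: M_def add_pos_nonneg)
  have ub': "\<bar>u t\<bar> \<le> M * exp (w * t)" "\<bar>v t\<bar> \<le> M * exp (w * t)" if "t > 0" for t
    using ub[of t] vb[of t] that \<mu> \<beta>0 mult_nonneg_nonneg[OF mult_nonneg_nonneg[of \<mu> \<beta>], of "exp (w * t)"]
    by (auto simp: M_def algebra_simps intro: order_trans)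
  have mes: "f \<in> borel_measurable (restrict_space lebesgue {0<..})" if "continuous_on {0<..} f" for f :: "real \<Rightarrow> real"
    by (rule continuous_imp_measurable_on_sets_lebesgue[OF that]) simp
  have La: "laplace_abs u w" "laplace_abs v w"
    using laplace_abs_of_bound[OF mes[OF cu'] ub'(1)] laplace_abs_of_bound[OF mes[OF cv] ub'(2)] by auto
  have eq1: "laplace v z = - \<mu> * (laplace b z * laplace u z)" if z: "Re z > w" for z
  proof -
    define P where "P r = exp (- z * of_real r) * complex_of_real (B r)" for r
    define Q where "Q r = exp (- z * of_real r) * complex_of_real (U r)" for r
    have [measurable]: "P \<in> borel_measurable borel" "Q \<in> borel_measurable borel"
      unfolding P_def[abs_def] Q_def[abs_def] by measurable
    have P: "integrable lborel P"
    proof (rule Bochner_Integration.integrable_bound[OF IB[of "Re z"]])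
      show "Re z > 0" using z w by simp
      show "AE r in lborel. norm (P r) \<le> norm (exp (- Re z * r) * B r)"
        by (simp add: P_def norm_mult abs_mult)
    qed measurable
    have Qeq: "Q r = indicator {0<..} r *\<^sub>R (exp (- z * of_real r) * complex_of_real (u r))" for r
      by (simp add: Q_def U_def indicator_def)
    have "integrable lebesgue Q"
      using laplace_abs_complex[OF La(1) z] unfolding set_integrable_def Qeq[abs_def] .
    then have Q: "integrable lborel Q" by (subst (asm) integrable_completion) auto
    have LQ: "laplace u z = (LBINT r. Q r)"
      unfolding laplace_def set_lebesgue_integral_def Qeq[symmetric] by (rule integral_completion) measurable
    have PQ: "(LBINT r. P r * Q (t - r)) = indicator {0<..} t *\<^sub>R (exp (- z * of_real t) * complex_of_real (conv b u t))" for t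
    proof -
      have "P r * Q (t - r) = exp (- z * of_real t) * complex_of_real (B r * U (t - r))" for r
        by (simp add: P_def Q_def exp_add[symmetric] algebra_simps)
      then have "(LBINT r. P r * Q (t - r)) = exp (- z * of_real t) * complex_of_real (conv b u t)"
        unfolding conv by (simp only: integral_mult_right_zero integral_complex_of_real)
      moreover have "conv b u t = 0" if "t \<le> 0" using that by (simp add: conv_def set_lebesgue_integral_def)
      ultimately show ?thesis by (auto simp: indicator_def)
    qed
    have "laplace (conv b u) z = (LINT t|lebesgue. (LBINT r. P r * Q (t - r)))"
      unfolding laplace_def set_lebesgue_integral_def PQ by (rule refl)
    also have "\<dots> = (LBINT t. LBINT r. P r * Q (t - r))"
      by (rule integral_completion) measurable
    also have "\<dots> = laplace b z * laplace u z"
      unfolding integral_convolution[OF P Q] LQ LB P_def[symmetric] by (rule refl)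
    finally have L: "laplace (conv b u) z = laplace b z * laplace u z" .
    have "indicator {0<..} t *\<^sub>R (exp (- z * of_real t) * complex_of_real (v t))
        = complex_of_real (- \<mu>) * (indicator {0<..} t *\<^sub>R (exp (- z * of_real t) * complex_of_real (conv b u t)))" for t
      by (simp add: v_def)
    then have "laplace v z = complex_of_real (- \<mu>) * laplace (conv b u) z"
      unfolding laplace_def set_lebesgue_integral_def by (simp only: integral_mult_right_zero)
    then show ?thesis using L by simp
  qed
  \<comment> \<open>The second computation of the transform of u'; the constant is the boundary
    value u 0 = 1, while the exponential bound removes the term at infinity.\<close>
  have eq2: "laplace v z = z * laplace u z - 1" if z: "Re z > w" for z
  proof -
    have eq: "einterval 0 \<infinity> = {0<..}" by (auto simp: einterval_def)
    note Iuv = laplace_abs_complex[OF La(1) z] laplace_abs_complex[OF La(2) z]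
    define f where "f t = exp (- z * of_real t) * complex_of_real (v t) - z * (exp (- z * of_real t) * complex_of_real (u t))" for t
    have If: "set_integrable lebesgue {0<..} f"
      unfolding f_def by (intro set_integral_diff(1) set_integrable_mult_right Iuv)
    have Lf: "(LINT t:{0<..}|lebesgue. f t) = laplace v z - z * laplace u z"
      unfolding f_def laplace_def using set_integral_diff(2)[OF Iuv(2) set_integrable_mult_right[OF Iuv(1)]] by simp
    have cf: "continuous_on {0<..} f" unfolding f_def by (intro continuous_intros cv cu')
    have mf: "(\<lambda>t. indicator {0<..} t *\<^sub>R f t) \<in> borel_measurable borel"
      by (intro borel_measurable_continuous_on_indicator cf) auto
    have "(LBINT t=0..\<infinity>. f t) = 0 - 1"
    proof (rule interval_integral_FTC_integrable[where F="\<lambda>t. exp (- z * of_real t) * complex_of_real (u t)"])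
      fix t :: real assume "(0::ereal) < t"
      then have t: "t > 0" by simp
      show "((\<lambda>t. exp (- z * of_real t) * complex_of_real (u t)) has_vector_derivative f t) (at t)"
        unfolding f_def
        by (auto intro!: derivative_eq_intros has_vector_derivative_real_field has_vector_derivative_of_real du t simp: algebra_simps)
      show "isCont f t" using cf t by (simp add: continuous_on_eq_continuous_at)
    next
      show "set_integrable lborel (einterval 0 \<infinity>) f"
        using If mf unfolding set_integrable_def eq by (subst (asm) integrable_completion) auto
      have "((\<lambda>t. u t) \<longlongrightarrow> u 0) (at 0 within {0..})" using cu by (simp add: continuous_on_def)
      then have "(u \<longlongrightarrow> u 0) (at_right 0)" by (rule tendsto_within_subset) auto
      then have "((\<lambda>t. exp (- z * of_real t) * complex_of_real (u t)) \<longlongrightarrow> exp (- z * of_real 0) * complex_of_real (u 0)) (at_right 0)"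
        by (intro tendsto_intros)
      then show "(((\<lambda>t. exp (- z * of_real t) * complex_of_real (u t)) \<circ> real_of_ereal) \<longlongrightarrow> 1) (at_right 0)"
        unfolding zero_ereal_def ereal_tendsto_simps by (simp add: u0)
      have lim: "((\<lambda>t. M * exp (- (Re z - w) * t)) \<longlongrightarrow> 0) at_top"
      proof -
        define d where "d = Re z - w"
        have "d > 0" using z by (simp add: d_def)
        then have "((\<lambda>t. M * exp (- d * t)) \<longlongrightarrow> 0) at_top" by real_asymp
        then show ?thesis by (simp add: d_def)
      qed
      have "((\<lambda>t. exp (- z * of_real t) * complex_of_real (u t)) \<longlongrightarrow> 0) at_top"
      proof (rule Lim_null_comparison[OF _ lim])
        show "\<forall>\<^sub>F t in at_top. norm (exp (- z * of_real t) * complex_of_real (u t)) \<le> M * exp (- (Re z - w) * t)"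
          using eventually_gt_at_top[of 0]
        proof eventually_elim
          case (elim t)
          have "norm (exp (- z * of_real t) * complex_of_real (u t)) = exp (- Re z * t) * \<bar>u t\<bar>" by (simp add: norm_mult)
          also have "\<dots> \<le> exp (- Re z * t) * (M * exp (w * t))" using ub'(1)[OF elim] by simp
          also have "\<dots> = M * exp (- (Re z - w) * t)" by (simp add: exp_add[symmetric] algebra_simps)
          finally show ?case .
        qed
      qed
      then show "(((\<lambda>t. exp (- z * of_real t) * complex_of_real (u t)) \<circ> real_of_ereal) \<longlongrightarrow> 0) (at_left \<infinity>)"
        unfolding ereal_tendsto_simps .
    qed simp
    moreover have "(LBINT t=0..\<infinity>. f t) = (LINT t:{0<..}|lebesgue. f t)"
      unfolding interval_lebesgue_integral_def set_lebesgue_integral_def eq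
      using integral_completion[of "\<lambda>t. indicator {0<..} t *\<^sub>R f t" lborel] mf by simp
    ultimately show ?thesis unfolding Lf by (simp add: algebra_simps)
  qed
  have eq3: "laplace u z * (z + \<mu> * laplace b z) = 1" if "Re z > w" for z
    using eq1[OF that] eq2[OF that] by (simp add: algebra_simps)
  show ?thesis
    by (rule that[of w M]) (use w M du cu' cv ub' eq2 eq3 in \<open>auto simp: v_def[abs_def]\<close>)
qed

section \<open>Moving the line of integration\<close>

lemma has_bochner_integral_inverse_square_sum:
  assumes a: "(a::real) > 0"
  shows "has_bochner_integral lborel (\<lambda>k. 1 / (a\<^sup>2 + k\<^sup>2)) (pi / a)"
proof -
  have eq: "1 / (a\<^sup>2 + k\<^sup>2) = (1 / a\<^sup>2) * inverse (1 + (0 + (1 / a) * k)\<^sup>2)" for k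
    using a by (simp add: divide_simps power2_eq_square)
  have "integrable lborel (\<lambda>k. inverse (1 + (0 + (1 / a) * k)\<^sup>2))"
    "(LBINT k. inverse (1 + (0 + (1 / a) * k)\<^sup>2)) = a * pi"
    using a has_bochner_integral_inverse_1_plus_square
      lborel_integrable_real_affine[of "\<lambda>x. inverse (1 + x\<^sup>2)" "1 / a" 0]
      lborel_integral_real_affine[of "1 / a" "\<lambda>x. inverse (1 + x\<^sup>2)" 0]
    by (auto simp: has_bochner_integral_iff field_simps)
  then show ?thesis
    unfolding eq has_bochner_integral_iff using a by (auto simp: power2_eq_square)
qed

lemma cmod_Complex_sq: "(cmod (Complex a k))\<^sup>2 = a\<^sup>2 + k\<^sup>2"
  by (simp add: cmod_power2)

text \<open>The integral of 1 / (a^2 + k^2) is pi / a. With a = 1/t this is the origin of the factor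
  t in the first bound of \<open>inversion_bounds\<close>.\<close>

lemma vertical_line_integral:
  assumes f: "continuous_on {z. 0 < Re z} f" and a: "a > 0"
    and C: "\<And>k. cmod (f (Complex a k)) \<le> C / (a\<^sup>2 + k\<^sup>2)"
  shows "integrable lborel (\<lambda>k. f (Complex a k))" "cmod (LBINT k. f (Complex a k)) \<le> C * pi / a"
proof -
  note J = has_bochner_integral_mult_right[OF has_bochner_integral_inverse_square_sum[OF a], of C]
  have "continuous_on UNIV (\<lambda>k. f (Complex a k))"
    by (rule continuous_on_compose2[OF f]) (use a in \<open>auto intro!: continuous_intros\<close>)
  then have m: "(\<lambda>k. f (Complex a k)) \<in> borel_measurable lborel"
    by (simp add: borel_measurable_continuous_onI)
  have C': "cmod (f (Complex a k)) \<le> C * (1 / (a\<^sup>2 + k\<^sup>2))" for k using C[of k] by simp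
  show "integrable lborel (\<lambda>k. f (Complex a k))"
  proof (rule Bochner_Integration.integrable_bound[OF _ m])
    show "integrable lborel (\<lambda>k. C * (1 / (a\<^sup>2 + k\<^sup>2)))" using J by (simp only: has_bochner_integral_iff)
    show "AE k in lborel. cmod (f (Complex a k)) \<le> norm (C * (1 / (a\<^sup>2 + k\<^sup>2)))"
    proof (intro AE_I2)
      fix k
      show "cmod (f (Complex a k)) \<le> norm (C * (1 / (a\<^sup>2 + k\<^sup>2)))"
        using C'[of k] by (metis abs_ge_self order_trans real_norm_def)
    qed
  qed
  have "cmod (LBINT k. f (Complex a k)) \<le> (LBINT k. cmod (f (Complex a k)))"
    by (rule integral_norm_bound)
  also have "\<dots> \<le> (LBINT k. C * (1 / (a\<^sup>2 + k\<^sup>2)))"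
  proof (rule integral_mono')
    show "integrable lborel (\<lambda>k. C * (1 / (a\<^sup>2 + k\<^sup>2)))" using J by (simp only: has_bochner_integral_iff)
    show "cmod (f (Complex a k)) \<le> C * (1 / (a\<^sup>2 + k\<^sup>2))" for k by (rule C')
    show "0 \<le> C * (1 / (a\<^sup>2 + k\<^sup>2))" for k using C'[of k] norm_ge_zero order_trans by blast
  qed
  also have "\<dots> = C * pi / a" using J by (simp only: has_bochner_integral_iff) simp
  finally show "cmod (LBINT k. f (Complex a k)) \<le> C * pi / a" .
qed

lemma has_vector_derivative_vertical:
  assumes "(g has_field_derivative D) (at (Complex a k))"
  shows "((\<lambda>k. g (Complex a k)) has_vector_derivative \<i> * D) (at k within S)"
proof -
  have "((\<lambda>k. Complex a k) has_vector_derivative \<i>) (at k within S)"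
    unfolding Complex_eq by (auto intro!: derivative_eq_intros has_vector_derivative_of_real)
  from field_vector_diff_chain_within[OF this, of g D] assms
  show ?thesis by (simp add: o_def has_field_derivative_at_within)
qed

lemma integral_truncation_limit:
  fixes f :: "real \<Rightarrow> complex"
  assumes "integrable lborel f"
  shows "(\<lambda>n. LINT k:{- real n..real n}|lborel. f k) \<longlonglongrightarrow> (LBINT k. f k)"
  unfolding set_lebesgue_integral_def
proof (rule integral_dominated_convergence[where w="\<lambda>k. cmod (f k)"])
  have [measurable]: "f \<in> borel_measurable lborel" using assms by (rule borel_measurable_integrable)
  show "f \<in> borel_measurable lborel" "(\<lambda>k. indicator {- real n..real n} k *\<^sub>R f k) \<in> borel_measurable lborel" for n
    by measurable
  show "integrable lborel (\<lambda>k. cmod (f k))" using assms by simp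
  show "AE k in lborel. (\<lambda>n. indicator {- real n..real n} k *\<^sub>R f k) \<longlonglongrightarrow> f k"
  proof (intro AE_I2 tendsto_eventually)
    fix k :: real
    obtain N where "\<bar>k\<bar> \<le> real N" using real_arch_simple by blast
    then show "\<forall>\<^sub>F n in sequentially. indicator {- real n..real n} k *\<^sub>R f k = f k"
      by (intro eventually_sequentiallyI[of N]) (auto simp: indicator_def)
  qed
  show "AE k in lborel. norm (indicator {- real n..real n} k *\<^sub>R f k) \<le> cmod (f k)" for n
    by (intro AE_I2) (simp add: indicator_def)
qed

text \<open>Cauchy's theorem for rectangles, expressed through a primitive on the half-plane. The
  horizontal edges at height y are increments of the primitive of size at most C (a2 - a1) / y^2 and
  disappear as the rectangle grows.\<close>

lemma vertical_shift:
  assumes f: "f holomorphic_on {z. 0 < Re z}" and a: "0 < a1" "a1 \<le> a2"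
    and C: "\<And>z. a1 \<le> Re z \<Longrightarrow> Re z \<le> a2 \<Longrightarrow> cmod (f z) \<le> C / (cmod z)\<^sup>2"
  shows "(LBINT k. f (Complex a1 k)) = (LBINT k. f (Complex a2 k))"
proof -
  obtain g where g: "\<And>z. Re z > 0 \<Longrightarrow> (g has_field_derivative f z) (at z)"
    using holomorphic_convex_primitive'[OF convex_halfspace_Re_gt open_halfspace_Re_gt f]
    by (metis at_within_open mem_Collect_eq open_halfspace_Re_gt)
  have cf: "continuous_on {z. 0 < Re z} f" using f by (rule holomorphic_on_imp_continuous_on)
  have C0: "C \<ge> 0"
    using order_trans[OF norm_ge_zero C[of "of_real a1"]] a by (auto simp: zero_le_divide_iff)
  have I: "integrable lborel (\<lambda>k. f (Complex a k))" if "a1 \<le> a" "a \<le> a2" for a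
    using vertical_line_integral(1)[OF cf, of a C] C[of "Complex a k" for k] that a by (simp add: cmod_Complex_sq)
  have T: "(LINT k:{- real n..real n}|lborel. f (Complex a k)) = - \<i> * (g (Complex a n) - g (Complex a (- real n)))"
    if "a1 \<le> a" for a n
  proof -
    have cont: "continuous_on {- real n..real n} (\<lambda>k. f (Complex a k))"
      by (rule continuous_on_compose2[OF cf]) (use a that in \<open>auto intro!: continuous_intros\<close>)
    have "((\<lambda>k. \<i> * f (Complex a k)) has_integral g (Complex a n) - g (Complex a (- real n))) {- real n..real n}"
      by (rule fundamental_theorem_of_calculus) (use a that in \<open>auto intro!: has_vector_derivative_vertical g\<close>)
    then have "((\<lambda>k. - \<i> * (\<i> * f (Complex a k))) has_integral - \<i> * (g (Complex a n) - g (Complex a (- real n)))) {- real n..real n}"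
      by (rule has_integral_mult_right)
    then show ?thesis
      unfolding set_borel_integral_eq_integral(2)[OF borel_integrable_atLeastAtMost'[OF cont]]
      by (intro integral_unique) (simp add: mult.assoc[symmetric])
  qed
  have D: "cmod (g (Complex a2 y) - g (Complex a1 y)) \<le> C / y\<^sup>2 * (a2 - a1)" if "y \<noteq> 0" for y
  proof -
    have "cmod (g (Complex a2 y) - g (Complex a1 y)) \<le> C / y\<^sup>2 * cmod (Complex a2 y - Complex a1 y)"
    proof (rule field_differentiable_bound[where S="{z. a1 \<le> Re z \<and> Re z \<le> a2 \<and> Im z = y}" and f'=f])
      have "{z. a1 \<le> Re z \<and> Re z \<le> a2 \<and> Im z = y} = {z. a1 \<le> Re z} \<inter> {z. Re z \<le> a2} \<inter> {z. Im z \<le> y} \<inter> {z. Im z \<ge> y}" by auto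
      then show "convex {z. a1 \<le> Re z \<and> Re z \<le> a2 \<and> Im z = y}"
        by (simp only: convex_Int convex_halfspace_Re_ge convex_halfspace_Re_le convex_halfspace_Im_ge convex_halfspace_Im_le)
      fix z assume z: "z \<in> {z. a1 \<le> Re z \<and> Re z \<le> a2 \<and> Im z = y}"
      then show "(g has_field_derivative f z) (at z within {z. a1 \<le> Re z \<and> Re z \<le> a2 \<and> Im z = y})"
        using a by (intro has_field_derivative_at_within[OF g]) auto
      have "cmod (f z) \<le> C / (cmod z)\<^sup>2" using C z by auto
      also have "\<dots> \<le> C / y\<^sup>2"
      proof (rule divide_left_mono[OF _ C0])
        have "\<bar>y\<bar> \<le> cmod z" using z abs_Im_le_cmod[of z] by auto
        then show "y\<^sup>2 \<le> (cmod z)\<^sup>2" using abs_le_square_iff[of y "cmod z"] by simp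
        then show "0 < (cmod z)\<^sup>2 * y\<^sup>2" using that by (auto intro!: mult_pos_pos)
      qed
      finally show "cmod (f z) \<le> C / y\<^sup>2" .
    qed (use a in auto)
    also have "Complex a2 y - Complex a1 y = of_real (a2 - a1)" by (simp add: complex_eq_iff)
    finally show ?thesis unfolding norm_of_real using a by simp
  qed
  have "(\<lambda>n. (LINT k:{- real n..real n}|lborel. f (Complex a2 k)) - (LINT k:{- real n..real n}|lborel. f (Complex a1 k)))
      \<longlonglongrightarrow> 0"
  proof (rule Lim_null_comparison)
    show "(\<lambda>n. 2 * (C / (real n)\<^sup>2 * (a2 - a1))) \<longlonglongrightarrow> 0" by real_asymp
    show "\<forall>\<^sub>F n in sequentially. norm ((LINT k:{- real n..real n}|lborel. f (Complex a2 k)) -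
        (LINT k:{- real n..real n}|lborel. f (Complex a1 k))) \<le> 2 * (C / (real n)\<^sup>2 * (a2 - a1))"
      using eventually_gt_at_top[of 0]
    proof eventually_elim
      case (elim n)
      have "(LINT k:{- real n..real n}|lborel. f (Complex a2 k)) - (LINT k:{- real n..real n}|lborel. f (Complex a1 k))
        = - \<i> * ((g (Complex a2 n) - g (Complex a1 n)) - (g (Complex a2 (- real n)) - g (Complex a1 (- real n))))"
        using a by (simp add: T algebra_simps)
      then have "norm ((LINT k:{- real n..real n}|lborel. f (Complex a2 k)) - (LINT k:{- real n..real n}|lborel. f (Complex a1 k)))
        \<le> cmod (g (Complex a2 n) - g (Complex a1 n)) + cmod (g (Complex a2 (- real n)) - g (Complex a1 (- real n)))"
        by (simp add: norm_mult norm_triangle_ineq4)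
      then show ?case using D[of "real n"] D[of "- real n"] elim by simp
    qed
  qed
  moreover have "(\<lambda>n. (LINT k:{- real n..real n}|lborel. f (Complex a2 k)) - (LINT k:{- real n..real n}|lborel. f (Complex a1 k)))
      \<longlonglongrightarrow> (LBINT k. f (Complex a2 k)) - (LBINT k. f (Complex a1 k))"
    using a by (intro tendsto_diff integral_truncation_limit I) auto
  ultimately have "(LBINT k. f (Complex a2 k)) - (LBINT k. f (Complex a1 k)) = 0" by (rule LIMSEQ_unique[rotated])
  then show ?thesis by simp
qed


section \<open>Boundary values\<close>

text \<open>The boundary values of \<open>F\<close> itself need not exist; integrating by parts replaces them by those of its
  primitive \<open>G\<close>.\<close>

lemma boundary_integral_limit:
  assumes \<delta>: "0 < \<delta>" "\<delta> \<le> R"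
    and G: "\<And>z. Re z > 0 \<Longrightarrow> (G has_field_derivative F z) (at z)"
    and cF: "continuous_on {z. 0 < Re z} F"
    and P: "\<And>z. 0 \<le> Re z \<Longrightarrow> z \<noteq> 0 \<Longrightarrow> (P has_field_derivative P' z) (at z)"
    and cP': "continuous_on {z. 0 \<le> Re z \<and> z \<noteq> 0} P'"
    and bG: "\<And>z. Re z > 0 \<Longrightarrow> cmod (G z) \<le> C / cmod z"
    and \<gamma>: "\<And>k. k > 0 \<Longrightarrow> ((\<lambda>a. G (Complex a k)) \<longlongrightarrow> \<gamma> k) (at_right 0)"
    and d\<gamma>: "\<And>k. k > 0 \<Longrightarrow> (\<gamma> has_vector_derivative \<gamma>' k) (at k)"
    and a: "\<And>n. 0 < a n" "\<And>n. a n \<le> 1" "a \<longlonglongrightarrow> 0"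
  shows "(\<lambda>n. integral {\<delta>..R} (\<lambda>k. P (Complex (a n) k) * F (Complex (a n) k)))
    \<longlonglongrightarrow> - \<i> * integral {\<delta>..R} (\<lambda>k. P (Complex 0 k) * \<gamma>' k)"
    and "(\<lambda>k. P (Complex 0 k) * \<gamma>' k) integrable_on {\<delta>..R}"
proof -
  have C0: "C \<ge> 0" using order_trans[OF norm_ge_zero bG[of 1]] by simp
  have fa: "filterlim a (at_right 0) sequentially"
    using a by (intro tendsto_imp_filterlim_at_right) auto
  have limG: "(\<lambda>n. G (Complex (a n) k)) \<longlonglongrightarrow> \<gamma> k" if "k > 0" for k
    using filterlim_compose[OF \<gamma>[OF that] fa] .
  have cP: "continuous_on {z. 0 \<le> Re z \<and> z \<noteq> 0} P"
    by (rule continuous_at_imp_continuous_on) (use P DERIV_isCont in blast)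
  have lima: "(\<lambda>n. Complex (a n) k) \<longlonglongrightarrow> Complex 0 k" for k
    using a(3) by (intro tendsto_Complex tendsto_const)
  have limc: "(\<lambda>n. h (Complex (a n) k)) \<longlonglongrightarrow> h (Complex 0 k)"
    if "continuous_on {z. 0 \<le> Re z \<and> z \<noteq> 0} h" "k > 0" for h :: "complex \<Rightarrow> complex" and k
    by (rule continuous_on_tendsto_compose[OF that(1) lima])
       (use a(1) that(2) in \<open>auto simp: complex_eq_iff less_imp_le\<close>)
  \<comment> \<open>As a n <= 1 and k >= \<delta>, all the approaching segments lie in this box,
    which avoids 0; hence \<open>P'\<close> is bounded on them independently of n.\<close>
  define K where "K = cbox (Complex 0 \<delta>) (Complex 1 R)"
  have "compact (P' ` K)"
    unfolding K_def using \<delta> by (intro compact_continuous_image continuous_on_subset[OF cP'] compact_cbox)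
      (auto simp: in_cbox_complex_iff)
  then obtain M where M: "\<And>z. z \<in> K \<Longrightarrow> cmod (P' z) \<le> M"
    by (metis bounded_iff compact_imp_bounded imageI)
  have contc: "continuous_on {\<delta>..R} (\<lambda>k. h (Complex (a n) k))"
    if "continuous_on {z. 0 < Re z} h" for h :: "complex \<Rightarrow> complex" and n
    by (rule continuous_on_compose2[OF that]) (use a(1) in \<open>auto intro!: continuous_intros\<close>)
  have cG: "continuous_on {z. 0 < Re z} G"
    by (rule continuous_at_imp_continuous_on) (use G DERIV_isCont in blast)
  have sub: "continuous_on {z. 0 < Re z} P" "continuous_on {z. 0 < Re z} P'"
    by (rule continuous_on_subset[OF cP], force) (rule continuous_on_subset[OF cP'], force)
  have c0: "continuous_on {\<delta>..R} (\<lambda>k. h (Complex 0 k))"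
    if "continuous_on {z. 0 \<le> Re z \<and> z \<noteq> 0} h" for h :: "complex \<Rightarrow> complex"
    by (rule continuous_on_compose2[OF that]) (use \<delta> in \<open>auto intro!: continuous_intros simp: complex_eq_iff\<close>)
  have parts: "integral {\<delta>..R} (\<lambda>k. P (Complex (a n) k) * F (Complex (a n) k)) =
     - \<i> * (P (Complex (a n) R) * G (Complex (a n) R) - P (Complex (a n) \<delta>) * G (Complex (a n) \<delta>))
     - integral {\<delta>..R} (\<lambda>k. P' (Complex (a n) k) * G (Complex (a n) k))" for n
  proof -
    have "((\<lambda>k. \<i> * (P' (Complex (a n) k) * G (Complex (a n) k) + P (Complex (a n) k) * F (Complex (a n) k)))
       has_integral P (Complex (a n) R) * G (Complex (a n) R) - P (Complex (a n) \<delta>) * G (Complex (a n) \<delta>)) {\<delta>..R}"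
    proof (rule fundamental_theorem_of_calculus)
      fix k assume "k \<in> {\<delta>..R}"
      have "((\<lambda>z. P z * G z) has_field_derivative
          (P' (Complex (a n) k) * G (Complex (a n) k) + P (Complex (a n) k) * F (Complex (a n) k))) (at (Complex (a n) k))"
        using a(1)[of n] by (auto intro!: derivative_eq_intros P G simp: complex_eq_iff less_imp_le)
      then show "((\<lambda>k. P (Complex (a n) k) * G (Complex (a n) k)) has_vector_derivative
        \<i> * (P' (Complex (a n) k) * G (Complex (a n) k) + P (Complex (a n) k) * F (Complex (a n) k))) (at k within {\<delta>..R})"
        by (rule has_vector_derivative_vertical)
    qed (use \<delta> in simp)
    from has_integral_mult_right[OF this, of "- \<i>"]
    have 1: "((\<lambda>k. P' (Complex (a n) k) * G (Complex (a n) k) + P (Complex (a n) k) * F (Complex (a n) k))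
       has_integral - \<i> * (P (Complex (a n) R) * G (Complex (a n) R) - P (Complex (a n) \<delta>) * G (Complex (a n) \<delta>))) {\<delta>..R}"
      by (simp add: mult.assoc[symmetric])
    have 2: "(\<lambda>k. P' (Complex (a n) k) * G (Complex (a n) k)) integrable_on {\<delta>..R}"
      by (intro integrable_continuous_real continuous_on_mult contc sub cG)
    from has_integral_diff[OF 1 integrable_integral[OF 2]] show ?thesis
      by (intro integral_unique) simp
  qed
  have i1: "(\<lambda>k. P' (Complex (a n) k) * G (Complex (a n) k)) integrable_on {\<delta>..R}" for n
    by (intro integrable_continuous_real continuous_on_mult contc sub cG)
  have i2: "(\<lambda>k. M * (C / \<delta>)) integrable_on {\<delta>..R}" by (intro integrable_continuous_real continuous_on_const)
  have b: "cmod (P' (Complex (a n) k) * G (Complex (a n) k)) \<le> M * (C / \<delta>)" if "k \<in> {\<delta>..R}" for n k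
  proof -
    have K: "Complex (a n) k \<in> K" using that a(1,2)[of n] by (auto simp: K_def in_cbox_complex_iff less_imp_le)
    have "cmod (G (Complex (a n) k)) \<le> C / cmod (Complex (a n) k)" using bG[of "Complex (a n) k"] a(1)[of n] by simp
    also have "\<dots> \<le> C / \<delta>"
    proof (rule divide_left_mono[OF _ C0])
      show le: "\<delta> \<le> cmod (Complex (a n) k)" using that abs_Im_le_cmod[of "Complex (a n) k"] by simp linarith
      show "0 < cmod (Complex (a n) k) * \<delta>" using less_le_trans[OF \<delta>(1) le] \<delta>(1) by (rule mult_pos_pos)
    qed
    finally show ?thesis
      unfolding norm_mult using M[OF K] order_trans[OF norm_ge_zero M[OF K]] by (intro mult_mono) auto
  qed
  have l: "(\<lambda>n. P' (Complex (a n) k) * G (Complex (a n) k)) \<longlonglongrightarrow> P' (Complex 0 k) * \<gamma> k" if "k \<in> {\<delta>..R}" for k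
    using that \<delta> by (intro tendsto_mult limc[OF cP'] limG) auto
  note lim2 = dominated_convergence[where f="\<lambda>n k. P' (Complex (a n) k) * G (Complex (a n) k)", OF i1 i2 b l]
  \<comment> \<open>Undoing the integration by parts on the axis itself, now with
    \<open>\<gamma>\<close> in place of \<open>G\<close>, identifies the limit and yields the
    integrability of the boundary integrand.\<close>
  have FT: "((\<lambda>k. \<i> * (P' (Complex 0 k) * \<gamma> k) + P (Complex 0 k) * \<gamma>' k)
      has_integral P (Complex 0 R) * \<gamma> R - P (Complex 0 \<delta>) * \<gamma> \<delta>) {\<delta>..R}"
  proof (rule fundamental_theorem_of_calculus)
    fix k assume k: "k \<in> {\<delta>..R}"
    have "((\<lambda>k. P (Complex 0 k)) has_vector_derivative \<i> * P' (Complex 0 k)) (at k within {\<delta>..R})"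
      by (rule has_vector_derivative_vertical, rule P) (use k \<delta> in \<open>auto simp: complex_eq_iff\<close>)
    moreover have "(\<gamma> has_vector_derivative \<gamma>' k) (at k within {\<delta>..R})"
      using d\<gamma>[of k] k \<delta> by (auto intro: has_vector_derivative_at_within)
    ultimately have "((\<lambda>k. P (Complex 0 k) * \<gamma> k) has_vector_derivative
        P (Complex 0 k) * \<gamma>' k + \<i> * P' (Complex 0 k) * \<gamma> k) (at k within {\<delta>..R})"
      by (rule has_vector_derivative_mult)
    then show "((\<lambda>k. P (Complex 0 k) * \<gamma> k) has_vector_derivative
        \<i> * (P' (Complex 0 k) * \<gamma> k) + P (Complex 0 k) * \<gamma>' k) (at k within {\<delta>..R})"
      by (simp add: algebra_simps)
  qed (use \<delta> in simp)
  from has_integral_diff[OF FT has_integral_mult_right[OF integrable_integral[OF lim2(1)], of \<i>]]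
  have E: "((\<lambda>k. P (Complex 0 k) * \<gamma>' k) has_integral P (Complex 0 R) * \<gamma> R - P (Complex 0 \<delta>) * \<gamma> \<delta>
      - \<i> * integral {\<delta>..R} (\<lambda>k. P' (Complex 0 k) * \<gamma> k)) {\<delta>..R}"
    by simp
  then show "(\<lambda>k. P (Complex 0 k) * \<gamma>' k) integrable_on {\<delta>..R}" by (rule has_integral_integrable)
  have "- \<i> * integral {\<delta>..R} (\<lambda>k. P (Complex 0 k) * \<gamma>' k) =
     - \<i> * (P (Complex 0 R) * \<gamma> R - P (Complex 0 \<delta>) * \<gamma> \<delta>) - integral {\<delta>..R} (\<lambda>k. P' (Complex 0 k) * \<gamma> k)"
    unfolding integral_unique[OF E] by (simp add: algebra_simps)
  moreover have "(\<lambda>n. - \<i> * (P (Complex (a n) R) * G (Complex (a n) R) - P (Complex (a n) \<delta>) * G (Complex (a n) \<delta>))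
     - integral {\<delta>..R} (\<lambda>k. P' (Complex (a n) k) * G (Complex (a n) k))) \<longlonglongrightarrow>
     - \<i> * (P (Complex 0 R) * \<gamma> R - P (Complex 0 \<delta>) * \<gamma> \<delta>) - integral {\<delta>..R} (\<lambda>k. P' (Complex 0 k) * \<gamma> k)"
    using \<delta> by (intro tendsto_diff tendsto_mult tendsto_const limc[OF cP] limG lim2(2)) auto
  ultimately show "(\<lambda>n. integral {\<delta>..R} (\<lambda>k. P (Complex (a n) k) * F (Complex (a n) k)))
    \<longlonglongrightarrow> - \<i> * integral {\<delta>..R} (\<lambda>k. P (Complex 0 k) * \<gamma>' k)"
    unfolding parts by simp
qed

text \<open>The negative half-axis contributes the complex conjugate of the positive one, so
  conditions on k > 0 are enough.\<close>

lemma norm_integral_even_le: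
  fixes h :: "real \<Rightarrow> complex"
  assumes h: "integrable lborel h" and c: "\<And>k. h (- k) = cnj (h k)"
  shows "cmod (LBINT k. h k) \<le> 2 * cmod (LBINT k:{0<..}. h k)"
proof -
  have I: "integrable lborel (\<lambda>k. indicator A k *\<^sub>R h k)" if "A \<in> sets borel" for A
    using that by (intro integrable_mult_indicator h) simp
  have "(LBINT k. h k) = (LBINT k. indicator {0<..} k *\<^sub>R h k + indicator {..<0} k *\<^sub>R h k)"
  proof (rule integral_cong_AE)
    show "AE k in lborel. h k = indicator {0<..} k *\<^sub>R h k + indicator {..<0} k *\<^sub>R h k"
      using AE_lborel_singleton[of "0::real"] by eventually_elim (auto simp: indicator_def)
  qed (use h in \<open>auto intro!: borel_measurable_integrable Bochner_Integration.integrable_add I\<close>)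
  also have "\<dots> = (LBINT k. indicator {0<..} k *\<^sub>R h k) + (LBINT k. indicator {..<0} k *\<^sub>R h k)"
    by (intro Bochner_Integration.integral_add I) auto
  also have "(LBINT k. indicator {..<0} k *\<^sub>R h k) = (LBINT k. indicator {..<0} (0 + -1 * k) *\<^sub>R h (0 + -1 * k))"
    by (subst lborel_integral_real_affine[of "-1" _ 0]) auto
  also have "(\<lambda>k. indicator {..<0} (0 + -1 * k) *\<^sub>R h (0 + -1 * k)) = (\<lambda>k. cnj (indicator {0<..} k *\<^sub>R h k))"
    by (auto simp: c indicator_def)
  also have "(LBINT k. cnj (indicator {0<..} k *\<^sub>R h k)) = cnj (LBINT k. indicator {0<..} k *\<^sub>R h k)"
    by (rule Bochner_Integration.integral_cnj)
  finally have "cmod (LBINT k. h k) \<le> cmod (LBINT k. indicator {0<..} k *\<^sub>R h k) + cmod (cnj (LBINT k. indicator {0<..} k *\<^sub>R h k))"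
    using norm_triangle_ineq by metis
  then show ?thesis by (simp add: set_lebesgue_integral_def)
qed

text \<open>By continuity the gauge integral on a compact interval agrees with the Lebesgue
  integral, which lets the extended-valued bound act on ordinary integrals.\<close>

lemma integral_norm_le_of_nn_integral:
  assumes c: "continuous_on {0<..} (\<gamma>' :: real \<Rightarrow> complex)" and B: "B \<ge> 0"
    and nn: "(\<integral>\<^sup>+k\<in>{0<..}. ennreal (cmod (\<gamma>' k)) \<partial>lebesgue) \<le> ennreal B"
    and \<delta>: "0 < \<delta>"
  shows "integral {\<delta>..R} (\<lambda>k. cmod (\<gamma>' k)) \<le> B"
proof -
  have cont: "continuous_on {\<delta>..R} (\<lambda>k. cmod (\<gamma>' k))"
    by (intro continuous_intros continuous_on_subset[OF c]) (use \<delta> in auto)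
  have S: "set_integrable lborel {\<delta>..R} (\<lambda>k. cmod (\<gamma>' k))"
    by (rule borel_integrable_atLeastAtMost'[OF cont])
  have "ennreal (integral {\<delta>..R} (\<lambda>k. cmod (\<gamma>' k))) = (\<integral>\<^sup>+k. ennreal (indicator {\<delta>..R} k *\<^sub>R cmod (\<gamma>' k)) \<partial>lborel)"
    unfolding set_borel_integral_eq_integral(2)[OF S, symmetric] set_lebesgue_integral_def
    by (rule nn_integral_eq_integral[symmetric]) (use S in \<open>auto simp: set_integrable_def\<close>)
  also have "\<dots> = (\<integral>\<^sup>+k. ennreal (indicator {\<delta>..R} k *\<^sub>R cmod (\<gamma>' k)) \<partial>lebesgue)"
    by (rule nn_integral_completion[symmetric])
  also have "\<dots> \<le> (\<integral>\<^sup>+k\<in>{0<..}. ennreal (cmod (\<gamma>' k)) \<partial>lebesgue)"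
    using \<delta> by (intro nn_integral_mono) (auto simp: indicator_def)
  also note nn
  finally show ?thesis using B by simp
qed

text \<open>Three limits are taken in this order: the line tends to the axis for fixed \<epsilon>
  and fixed [\<delta>, R], then [\<delta>, R] exhausts the half-axis, then \<epsilon> tends to 0 on
  the original line. On the axis |P| <= 1, so the compact part is at most B; conjugation symmetry
  accounts for the factor 2.\<close>

lemma boundary_bound:
  assumes F: "F holomorphic_on {z. 0 < Re z}"
    and G: "\<And>z. Re z > 0 \<Longrightarrow> (G has_field_derivative F z) (at z)"
    and bF: "\<And>z. Re z > 0 \<Longrightarrow> cmod (F z) \<le> C / (cmod z)\<^sup>2"
    and bG: "\<And>z. Re z > 0 \<Longrightarrow> cmod (G z) \<le> C / cmod z"
    and cnjF: "\<And>z. Re z > 0 \<Longrightarrow> F (cnj z) = cnj (F z)"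
    and \<gamma>: "\<And>k. k > 0 \<Longrightarrow> ((\<lambda>a. G (Complex a k)) \<longlongrightarrow> \<gamma> k) (at_right 0)"
    and d\<gamma>: "\<And>k. k > 0 \<Longrightarrow> (\<gamma> has_vector_derivative \<gamma>' k) (at k)"
    and c\<gamma>: "continuous_on {0<..} \<gamma>'" and B: "B \<ge> 0"
    and nn: "(\<integral>\<^sup>+k\<in>{0<..}. ennreal (cmod (\<gamma>' k)) \<partial>lebesgue) \<le> ennreal B"
    and t: "t > 0" and a: "a > 0"
  shows "cmod (LBINT k. exp (Complex a k * of_real t) * F (Complex a k)) \<le> 2 * B"
proof -
  have C0: "C \<ge> 0" using order_trans[OF norm_ge_zero bG[of 1]] by simp
  have cF: "continuous_on {z. 0 < Re z} F" using F by (rule holomorphic_on_imp_continuous_on)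
  \<comment> \<open>As \<open>\<epsilon>\<close> tends to 0 this factor tends to 1, while for fixed \<open>\<epsilon>\<close> it cancels the possible
    singularity of order 2 of \<open>F\<close> at 0.\<close>
  define m where "m \<epsilon> z = (z / (z + of_real \<epsilon>))\<^sup>2" for \<epsilon> :: real and z :: complex
  define P where "P \<epsilon> z = exp (z * of_real t) * m \<epsilon> z" for \<epsilon> z
  define P' where "P' \<epsilon> z = of_real t * exp (z * of_real t) * m \<epsilon> z
     + exp (z * of_real t) * (2 * (z / (z + of_real \<epsilon>)) * (of_real \<epsilon> / (z + of_real \<epsilon>)\<^sup>2))" for \<epsilon> z
  have nz: "z + of_real \<epsilon> \<noteq> 0" if "\<epsilon> > 0" "Re z \<ge> 0" for \<epsilon> z
    using that by (auto simp: complex_eq_iff)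
  have nsq: "(cmod (z + of_real \<epsilon>))\<^sup>2 = (Re z + \<epsilon>)\<^sup>2 + (Im z)\<^sup>2" for z \<epsilon> by (simp add: cmod_power2)
  \<comment> \<open>On the closed right half-plane |z + \<epsilon>| exceeds |z|, giving |m| <= 1,
    and by \<open>ge2\<close> it also exceeds the distance from \<epsilon> to - i Im z, giving an
    integrable majorant down to the axis.\<close>
  have ge1: "(cmod z)\<^sup>2 \<le> (cmod (z + of_real \<epsilon>))\<^sup>2" if "\<epsilon> > 0" "Re z \<ge> 0" for \<epsilon> z
    unfolding nsq using that by (auto simp: cmod_power2 intro!: power_mono)
  have ge2: "\<epsilon>\<^sup>2 + (Im z)\<^sup>2 \<le> (cmod (z + of_real \<epsilon>))\<^sup>2" if "\<epsilon> > 0" "Re z \<ge> 0" for \<epsilon> z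
    unfolding nsq using that by (auto intro!: power_mono)
  have mn: "cmod (m \<epsilon> z) = (cmod z)\<^sup>2 / (cmod (z + of_real \<epsilon>))\<^sup>2" for \<epsilon> z
    by (simp add: m_def norm_power norm_divide power_divide)
  have m1: "cmod (m \<epsilon> z) \<le> 1" if "\<epsilon> > 0" "Re z \<ge> 0" for \<epsilon> z
    unfolding mn using ge1[OF that] nz[OF that] by (simp add: divide_le_eq)
  have Pn: "cmod (P \<epsilon> z) = exp (Re z * t) * cmod (m \<epsilon> z)" for \<epsilon> z
    by (simp add: P_def norm_mult)
  have dP: "(P \<epsilon> has_field_derivative P' \<epsilon> z) (at z)" if "\<epsilon> > 0" "Re z \<ge> 0" for \<epsilon> z
  proof -
    have "((\<lambda>z. z / (z + of_real \<epsilon>)) has_field_derivative of_real \<epsilon> / (z + of_real \<epsilon>)\<^sup>2) (at z)"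
      using nz[OF that] by (auto intro!: derivative_eq_intros simp: power2_eq_square)
    from DERIV_power[OF this, of 2]
    have "(m \<epsilon> has_field_derivative 2 * (z / (z + of_real \<epsilon>)) * (of_real \<epsilon> / (z + of_real \<epsilon>)\<^sup>2)) (at z)"
      unfolding m_def[abs_def] by (simp add: mult_ac)
    then show ?thesis
      unfolding P_def[abs_def] P'_def by (auto intro!: derivative_eq_intros)
  qed
  have cP': "continuous_on {z. 0 \<le> Re z \<and> z \<noteq> 0} (P' \<epsilon>)" if "\<epsilon> > 0" for \<epsilon>
    unfolding P'_def[abs_def] m_def using nz[OF that] by (auto intro!: continuous_intros)
  have hol: "(\<lambda>z. P \<epsilon> z * F z) holomorphic_on {z. 0 < Re z}" if "\<epsilon> > 0" for \<epsilon>
  proof (intro holomorphic_on_mult F)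
    show "P \<epsilon> holomorphic_on {z. 0 < Re z}"
      by (rule holomorphic_onI) (use has_field_derivative_at_within[OF dP[OF that]] less_imp_le in \<open>unfold field_differentiable_def, blast\<close>)
  qed
  have b2: "cmod (P \<epsilon> z * F z) \<le> exp (Re z * t) * C / (cmod z)\<^sup>2" if "\<epsilon> > 0" "Re z > 0" for \<epsilon> z
  proof -
    have "cmod (P \<epsilon> z * F z) \<le> exp (Re z * t) * 1 * (C / (cmod z)\<^sup>2)"
      unfolding norm_mult Pn using m1[of \<epsilon> z] bF[of z] that by (intro mult_mono) auto
    then show ?thesis by simp
  qed
  have I1: "integrable lborel (\<lambda>k. P \<epsilon> (Complex x k) * F (Complex x k))" if "\<epsilon> > 0" "x > 0" for \<epsilon> x
  proof (rule vertical_line_integral(1)[where f="\<lambda>z. P \<epsilon> z * F z" and C="exp (x * t) * C"])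
    show "continuous_on {z. 0 < Re z} (\<lambda>z. P \<epsilon> z * F z)" using hol[OF that(1)] by (rule holomorphic_on_imp_continuous_on)
    show "cmod (P \<epsilon> (Complex x k) * F (Complex x k)) \<le> exp (x * t) * C / (x\<^sup>2 + k\<^sup>2)" for k
      using b2[OF that(1), of "Complex x k"] that by (simp add: cmod_Complex_sq)
  qed (use that in simp)
  have shift: "(LBINT k. P \<epsilon> (Complex x k) * F (Complex x k)) = (LBINT k. P \<epsilon> (Complex y k) * F (Complex y k))"
    if "\<epsilon> > 0" "x > 0" "x \<le> y" for \<epsilon> x y
  proof (rule vertical_shift[OF hol[OF that(1)] that(2,3)])
    fix z assume z: "x \<le> Re z" "Re z \<le> y"
    have "cmod (P \<epsilon> z * F z) \<le> exp (Re z * t) * C / (cmod z)\<^sup>2" using b2[OF that(1), of z] z that by simp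
    also have "\<dots> \<le> exp (y * t) * C / (cmod z)\<^sup>2"
      using z t C0 by (intro divide_right_mono mult_right_mono) auto
    finally show "cmod (P \<epsilon> z * F z) \<le> exp (y * t) * C / (cmod z)\<^sup>2" .
  qed
  have main: "cmod (LBINT k. P \<epsilon> (Complex a k) * F (Complex a k)) \<le> 2 * B" if e: "\<epsilon> > 0" for \<epsilon>
  proof -
    \<comment> \<open>A common majorant for all lines Re z = s n <= 1: the factor |z|^2 in |m|
      cancels that in the bound for F, and exp t bounds the exponential.\<close>
    define D where "D k = exp t * C * (1 / (\<epsilon>\<^sup>2 + k\<^sup>2))" for k
    have ID: "integrable lborel D"
      unfolding D_def[abs_def] using has_bochner_integral_mult_right[OF has_bochner_integral_inverse_square_sum[OF e], of "exp t * C"]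
      by (simp only: has_bochner_integral_iff)
    have D0: "D k \<ge> 0" for k using C0 by (simp add: D_def)
    define s where "s n = 1 / real (Suc n)" for n
    have s: "0 < s n" "s n \<le> 1" for n by (auto simp: s_def)
    have s0: "s \<longlonglongrightarrow> 0" unfolding s_def by real_asymp
    define h where "h n k = P \<epsilon> (Complex (s n) k) * F (Complex (s n) k)" for n k
    have Ih: "integrable lborel (h n)" for n unfolding h_def[abs_def] by (rule I1[OF e s(1)])
    have hD: "cmod (h n k) \<le> D k" for n k
    proof -
      let ?z = "Complex (s n) k"
      have z: "Re ?z > 0" "Re ?z \<le> 1" using s[of n] by auto
      then have zn: "cmod ?z > 0" by (auto simp: complex_eq_iff)
      have "cmod (h n k) \<le> exp t * ((cmod ?z)\<^sup>2 / (cmod (?z + of_real \<epsilon>))\<^sup>2) * (C / (cmod ?z)\<^sup>2)"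
        unfolding h_def norm_mult Pn mn using bF[OF z(1)] z t s[of n] by (intro mult_mono) auto
      also have "\<dots> = exp t * C * (1 / (cmod (?z + of_real \<epsilon>))\<^sup>2)" using zn by simp
      also have "\<dots> \<le> D k"
        unfolding D_def
      proof (intro mult_left_mono frac_le)
        show "0 < \<epsilon>\<^sup>2 + k\<^sup>2" using e by (simp add: add_pos_nonneg)
      qed (use ge2[OF e, of ?z] z C0 in auto)
      finally show ?thesis .
    qed
    have IA: "integrable lborel (\<lambda>k. indicator A k *\<^sub>R h n k)" "integrable lborel (\<lambda>k. indicator A k *\<^sub>R D k)"
      if "A \<in> sets borel" for A n
      using that integrable_mult_indicator[OF _ Ih] integrable_mult_indicator[OF _ ID] by simp_all
    have eq1: "(LBINT k. P \<epsilon> (Complex a k) * F (Complex a k)) = (LBINT k. h n k)" for n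
      unfolding h_def using shift[OF e s(1)[of n], of a, symmetric] shift[OF e a, of "s n"] by (rule linorder_le_cases[of "s n" a])
    have even: "h n (- k) = cnj (h n k)" for n k
    proof -
      let ?z = "Complex (s n) k"
      have "Complex (s n) (- k) = cnj ?z" by (simp add: complex_eq_iff)
      moreover have "P \<epsilon> (cnj ?z) = cnj (P \<epsilon> ?z)" by (simp add: P_def m_def exp_cnj)
      ultimately show ?thesis using cnjF[of ?z] s(1)[of n] by (simp add: h_def)
    qed
    define \<delta> where "\<delta> N = 1 / real (Suc N)" for N
    define R where "R N = real (Suc N)" for N
    have "\<delta> N \<le> 1" "1 \<le> R N" "0 < \<delta> N" for N by (auto simp: \<delta>_def R_def)
    then have \<delta>: "0 < \<delta> N" "\<delta> N \<le> R N" for N using order_trans by blast+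
    \<comment> \<open>The contribution of neighbourhoods of 0 and of infinity, bounded independently
      of the line.\<close>
    define E where "E N = (LBINT k:{0<..} - {\<delta> N..R N}. D k)" for N
    have split: "cmod (LBINT k:{0<..}. h n k) \<le> cmod (integral {\<delta> N..R N} (h n)) + E N" for n N
    proof -
      have S: "set_integrable lborel {\<delta> N..R N} (h n)" unfolding set_integrable_def by (intro IA) simp
      have "(LBINT k:{0<..}. h n k) = (LBINT k. indicator {\<delta> N..R N} k *\<^sub>R h n k + indicator ({0<..} - {\<delta> N..R N}) k *\<^sub>R h n k)"
        unfolding set_lebesgue_integral_def using \<delta>(1)[of N]
        by (intro Bochner_Integration.integral_cong) (auto simp: indicator_def)
      also have "\<dots> = (LBINT k. indicator {\<delta> N..R N} k *\<^sub>R h n k) + (LBINT k. indicator ({0<..} - {\<delta> N..R N}) k *\<^sub>R h n k)"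
        by (intro Bochner_Integration.integral_add IA) auto
      finally have "cmod (LBINT k:{0<..}. h n k) \<le> cmod (LBINT k. indicator {\<delta> N..R N} k *\<^sub>R h n k)
          + cmod (LBINT k. indicator ({0<..} - {\<delta> N..R N}) k *\<^sub>R h n k)"
        using norm_triangle_ineq by metis
      moreover have "(LBINT k. indicator {\<delta> N..R N} k *\<^sub>R h n k) = integral {\<delta> N..R N} (h n)"
        using set_borel_integral_eq_integral(2)[OF S] by (simp add: set_lebesgue_integral_def)
      moreover have "cmod (LBINT k. indicator ({0<..} - {\<delta> N..R N}) k *\<^sub>R h n k) \<le> E N"
      proof -
        have "cmod (LBINT k. indicator ({0<..} - {\<delta> N..R N}) k *\<^sub>R h n k) \<le> (LBINT k. norm (indicator ({0<..} - {\<delta> N..R N}) k *\<^sub>R h n k))"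
          by (rule integral_norm_bound)
        also have "\<dots> \<le> E N"
          unfolding E_def set_lebesgue_integral_def
          by (rule integral_mono'[OF IA(2)]) (use hD D0 in \<open>auto simp: indicator_def\<close>)
        finally show ?thesis .
      qed
      ultimately show ?thesis by simp
    qed
    have "cmod (LBINT k. P \<epsilon> (Complex a k) * F (Complex a k)) \<le> 2 * (B + E N)" for N
    proof -
      have lim: "(\<lambda>n. integral {\<delta> N..R N} (h n)) \<longlonglongrightarrow> - \<i> * integral {\<delta> N..R N} (\<lambda>k. P \<epsilon> (Complex 0 k) * \<gamma>' k)"
        and int: "(\<lambda>k. P \<epsilon> (Complex 0 k) * \<gamma>' k) integrable_on {\<delta> N..R N}"
        unfolding h_def
        using boundary_integral_limit[OF \<delta> G cF dP[OF e] cP'[OF e] bG \<gamma> d\<gamma> s s0] by auto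
      have "cmod (integral {\<delta> N..R N} (\<lambda>k. P \<epsilon> (Complex 0 k) * \<gamma>' k)) \<le> integral {\<delta> N..R N} (\<lambda>k. cmod (\<gamma>' k))"
      proof (rule integral_norm_bound_integral[OF int])
        show "(\<lambda>k. cmod (\<gamma>' k)) integrable_on {\<delta> N..R N}"
          by (intro integrable_continuous_real continuous_on_norm continuous_on_subset[OF c\<gamma>]) (use \<delta>(1)[of N] in auto)
        show "cmod (P \<epsilon> (Complex 0 k) * \<gamma>' k) \<le> cmod (\<gamma>' k)" for k
          unfolding norm_mult Pn using m1[OF e, of "Complex 0 k"] by (simp add: mult_left_le_one_le)
      qed
      also have "\<dots> \<le> B" by (rule integral_norm_le_of_nn_integral[OF c\<gamma> B nn \<delta>(1)])
      finally have LB: "cmod (- \<i> * integral {\<delta> N..R N} (\<lambda>k. P \<epsilon> (Complex 0 k) * \<gamma>' k)) \<le> B"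
        by (simp add: norm_mult)
      have le: "cmod (LBINT k. P \<epsilon> (Complex a k) * F (Complex a k)) \<le> 2 * (cmod (integral {\<delta> N..R N} (h n)) + E N)" for n
        unfolding eq1[of n] using norm_integral_even_le[OF Ih even, of n] split[of n N] by simp
      have "(\<lambda>n. 2 * (cmod (integral {\<delta> N..R N} (h n)) + E N)) \<longlonglongrightarrow>
          2 * (cmod (- \<i> * integral {\<delta> N..R N} (\<lambda>k. P \<epsilon> (Complex 0 k) * \<gamma>' k)) + E N)"
        by (intro tendsto_intros lim)
      then have "cmod (LBINT k. P \<epsilon> (Complex a k) * F (Complex a k))
          \<le> 2 * (cmod (- \<i> * integral {\<delta> N..R N} (\<lambda>k. P \<epsilon> (Complex 0 k) * \<gamma>' k)) + E N)"
        by (rule LIMSEQ_le_const) (use le in auto)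
      then show ?thesis using LB by simp
    qed
    moreover have "(\<lambda>N. 2 * (B + E N)) \<longlonglongrightarrow> 2 * (B + 0)"
    proof (intro tendsto_intros)
      have "E \<longlonglongrightarrow> (LBINT k::real. 0)"
        unfolding E_def[abs_def] set_lebesgue_integral_def
      proof (rule integral_dominated_convergence[where w=D])
        have [measurable]: "D \<in> borel_measurable lborel" using ID by (rule borel_measurable_integrable)
        show "(\<lambda>k. indicator ({0<..} - {\<delta> N..R N}) k *\<^sub>R D k) \<in> borel_measurable lborel" for N
          by measurable
        show "AE k in lborel. (\<lambda>N. indicator ({0<..} - {\<delta> N..R N}) k *\<^sub>R D k) \<longlonglongrightarrow> 0"
        proof (intro AE_I2 tendsto_eventually)
          fix k :: real
          show "\<forall>\<^sub>F N in sequentially. indicator ({0<..} - {\<delta> N..R N}) k *\<^sub>R D k = 0"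
          proof (cases "k > 0")
            case True
            obtain N where N: "max k (1 / k) \<le> real N" using real_arch_simple by blast
            have "\<delta> n \<le> k \<and> k \<le> R n" if "n \<ge> N" for n
            proof -
              have "k \<le> R n" "1 / k \<le> R n" using N that by (auto simp: R_def)
              then show ?thesis using True by (auto simp: \<delta>_def R_def field_simps)
            qed
            then show ?thesis by (intro eventually_sequentiallyI[of N]) auto
          qed simp
        qed
        show "AE k in lborel. norm (indicator ({0<..} - {\<delta> N..R N}) k *\<^sub>R D k) \<le> D k" for N
          using D0 by (intro AE_I2) (auto simp: indicator_def)
      qed (use ID in auto)
      then show "E \<longlonglongrightarrow> 0" by simp
    qed
    ultimately show ?thesis by (intro LIMSEQ_le_const[of _ "2 * B"]) auto
  qed
  \<comment> \<open>The regularization is removed on the fixed line Re z = a, where the original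
    integrand is itself absolutely integrable.\<close>
  define e where "e n = 1 / real (Suc n)" for n
  have e: "e n > 0" for n by (simp add: e_def)
  have e0: "e \<longlonglongrightarrow> 0" unfolding e_def by real_asymp
  have "(\<lambda>n. LBINT k. P (e n) (Complex a k) * F (Complex a k)) \<longlonglongrightarrow> (LBINT k. exp (Complex a k * of_real t) * F (Complex a k))"
  proof (rule integral_dominated_convergence[where w="\<lambda>k. exp (a * t) * C * (1 / (a\<^sup>2 + k\<^sup>2))"])
    show "integrable lborel (\<lambda>k. exp (a * t) * C * (1 / (a\<^sup>2 + k\<^sup>2)))"
      using has_bochner_integral_mult_right[OF has_bochner_integral_inverse_square_sum[OF a], of "exp (a * t) * C"]
      by (simp only: has_bochner_integral_iff)
    show "(\<lambda>k. P (e n) (Complex a k) * F (Complex a k)) \<in> borel_measurable lborel" for n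
      using I1[OF e a] by (rule borel_measurable_integrable)
    have "continuous_on UNIV (\<lambda>k. exp (Complex a k * of_real t) * F (Complex a k))"
      by (intro continuous_intros continuous_on_compose2[OF cF]) (use a in auto)
    then show "(\<lambda>k. exp (Complex a k * of_real t) * F (Complex a k)) \<in> borel_measurable lborel"
      by (simp add: borel_measurable_continuous_onI)
    show "AE k in lborel. (\<lambda>n. P (e n) (Complex a k) * F (Complex a k)) \<longlonglongrightarrow> exp (Complex a k * of_real t) * F (Complex a k)"
    proof (intro AE_I2)
      fix k
      have z: "Complex a k \<noteq> 0" using a by (auto simp: complex_eq_iff)
      have "(\<lambda>n. P (e n) (Complex a k) * F (Complex a k)) \<longlonglongrightarrow>
        exp (Complex a k * of_real t) * (Complex a k / (Complex a k + of_real 0))\<^sup>2 * F (Complex a k)"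
        unfolding P_def m_def using z by (intro tendsto_intros e0) auto
      then show "(\<lambda>n. P (e n) (Complex a k) * F (Complex a k)) \<longlonglongrightarrow> exp (Complex a k * of_real t) * F (Complex a k)"
        using z by simp
    qed
    show "AE k in lborel. norm (P (e n) (Complex a k) * F (Complex a k)) \<le> exp (a * t) * C * (1 / (a\<^sup>2 + k\<^sup>2))" for n
      using b2[OF e, of "Complex a k" for k] a by (intro AE_I2) (simp add: cmod_Complex_sq)
  qed
  then have "(\<lambda>n. cmod (LBINT k. P (e n) (Complex a k) * F (Complex a k))) \<longlonglongrightarrow> cmod (LBINT k. exp (Complex a k * of_real t) * F (Complex a k))"
    by (rule tendsto_norm)
  then show ?thesis by (rule LIMSEQ_le_const2) (use main[OF e] in auto)
qed

section \<open>Estimates for the symbol\<close>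

text \<open>The squared modulus is used because |\<phi>| need not be differentiable at zeros; the
  hypothesis makes exp (2 L s) |\<phi> s|^2 nondecreasing. The bound runs from y back to x, the
  direction needed when approaching the imaginary axis from the right.\<close>

lemma gronwall_backward:
  fixes \<phi> :: "real \<Rightarrow> complex"
  assumes xy: "x \<le> y" and d: "\<And>s. x \<le> s \<Longrightarrow> s \<le> y \<Longrightarrow> (\<phi> has_vector_derivative \<phi>' s) (at s)"
    and L: "\<And>s. x \<le> s \<Longrightarrow> s \<le> y \<Longrightarrow> cmod (\<phi>' s) \<le> L * cmod (\<phi> s)"
  shows "cmod (\<phi> x) \<le> exp (L * (y - x)) * cmod (\<phi> y)"
proof -
  define N where "N s = (Re (\<phi> s))\<^sup>2 + (Im (\<phi> s))\<^sup>2" for s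
  have N: "N s = (cmod (\<phi> s))\<^sup>2" for s by (simp add: N_def cmod_power2)
  have "exp (2 * L * x) * N x \<le> exp (2 * L * y) * N y"
  proof (rule DERIV_nonneg_imp_nondecreasing[OF xy, where f="\<lambda>s. exp (2 * L * s) * N s"])
    fix s assume s: "x \<le> s" "s \<le> y"
    let ?D = "2 * Re (\<phi> s) * Re (\<phi>' s) + 2 * Im (\<phi> s) * Im (\<phi>' s)"
    have "((\<lambda>s. Re (\<phi> s)) has_real_derivative Re (\<phi>' s)) (at s)" "((\<lambda>s. Im (\<phi> s)) has_real_derivative Im (\<phi>' s)) (at s)"
      using d[OF s] by (simp_all add: has_vector_derivative_complex_iff)
    moreover have "((\<lambda>s. exp (2 * L * s) * ((p s)\<^sup>2 + (q s)\<^sup>2)) has_real_derivative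
        exp (2 * L * s) * (2 * L * ((p s)\<^sup>2 + (q s)\<^sup>2) + (2 * p s * p' + 2 * q s * q'))) (at s)"
      if "(p has_real_derivative p') (at s)" "(q has_real_derivative q') (at s)" for p q p' q'
      using that by (auto intro!: derivative_eq_intros simp: algebra_simps power2_eq_square)
    ultimately have "((\<lambda>s. exp (2 * L * s) * N s) has_real_derivative exp (2 * L * s) * (2 * L * N s + ?D)) (at s)"
      unfolding N_def by blast
    moreover have "0 \<le> 2 * L * N s + ?D"
    proof -
      have "?D = 2 * Re (\<phi> s * cnj (\<phi>' s))" by simp
      then have "- ?D \<le> 2 * cmod (\<phi> s * cnj (\<phi>' s))" using abs_Re_le_cmod[of "\<phi> s * cnj (\<phi>' s)"] by linarith
      also have "\<dots> = 2 * (cmod (\<phi> s) * cmod (\<phi>' s))" by (simp add: norm_mult)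
      also have "\<dots> \<le> 2 * (cmod (\<phi> s) * (L * cmod (\<phi> s)))" using L[OF s] by (intro mult_left_mono) auto
      finally show ?thesis by (simp add: N power2_eq_square algebra_simps)
    qed
    ultimately show "\<exists>D. ((\<lambda>s. exp (2 * L * s) * N s) has_real_derivative D) (at s) \<and> 0 \<le> D"
      by (intro exI[of _ "exp (2 * L * s) * (2 * L * N s + ?D)"]) simp
  qed
  then have "N x \<le> exp (- (2 * L * x)) * (exp (2 * L * y) * N y)" by (simp add: exp_minus field_simps)
  also have "\<dots> = exp (L * (y - x)) * exp (L * (y - x)) * N y"
    unfolding mult.assoc[symmetric] exp_add[symmetric] by (simp add: algebra_simps)
  also have "\<dots> = (exp (L * (y - x)) * cmod (\<phi> y))\<^sup>2" by (simp add: N power2_eq_square)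
  finally show ?thesis unfolding N by (rule power2_le_imp_le) simp
qed

text \<open>\<open>K\<close> is a 2-regularity constant and \<open>s\<close> the sine of a sector
  angle. Regularity is phrased through the transforms of t b and t^2 b, which are the first two
  derivatives up to sign, so that iterated \<open>deriv\<close> need not be handled below.\<close>

locale sectorial_kernel =
  fixes b :: "real \<Rightarrow> real" and K s :: real
  assumes la: "laplace_abs b 0" and K: "1 \<le> K" and s: "0 \<le> s" "s < 1"
    and reg1: "\<And>z. Re z > 0 \<Longrightarrow> cmod z * cmod (laplace (\<lambda>t. t * b t) z) \<le> K * cmod (laplace b z)"
    and reg2: "\<And>z. Re z > 0 \<Longrightarrow> (cmod z)\<^sup>2 * cmod (laplace (\<lambda>t. t * (t * b t)) z) \<le> K * cmod (laplace b z)"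
    and Re_nonneg: "\<And>z. Re z > 0 \<Longrightarrow> 0 \<le> Re (laplace b z)"
    and Im_le: "\<And>z. Re z > 0 \<Longrightarrow> \<bar>Im (laplace b z)\<bar> \<le> s * cmod (laplace b z)"
begin

abbreviation "b0 \<equiv> laplace b"
definition "b1 z = - laplace (\<lambda>t. t * b t) z"
definition "b2 z = laplace (\<lambda>t. t * (t * b t)) z"

lemma b0_deriv: "Re z > 0 \<Longrightarrow> (b0 has_field_derivative b1 z) (at z)"
  unfolding b1_def by (rule laplace_has_field_derivative[OF la])

lemma b1_deriv: "Re z > 0 \<Longrightarrow> (b1 has_field_derivative b2 z) (at z)"
  unfolding b1_def[abs_def] b2_def
  using DERIV_minus[OF laplace_has_field_derivative[OF laplace_abs_times[OF la]]] by force

lemma cnj_b: "b0 (cnj z) = cnj (b0 z)" "b1 (cnj z) = cnj (b1 z)" "b2 (cnj z) = cnj (b2 z)"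
  by (simp_all add: b1_def b2_def laplace_cnj)

lemma b1_le: "Re z > 0 \<Longrightarrow> cmod z * cmod (b1 z) \<le> K * cmod (b0 z)"
  using reg1 by (simp add: b1_def)

lemma b2_le: "Re z > 0 \<Longrightarrow> (cmod z)\<^sup>2 * cmod (b2 z) \<le> K * cmod (b0 z)"
  using reg2 by (simp add: b2_def)

section \<open>Bounds for the symbol in the open half-plane, uniform in \<mu>\<close>

definition "\<kappa> = sqrt ((1 - s) / 2)"

lemma \<kappa>: "0 < \<kappa>" "\<kappa> \<le> 1" using s by (auto simp: \<kappa>_def)

lemma \<kappa>_le: "0 \<le> Re z \<Longrightarrow> 0 \<le> Re w \<Longrightarrow> \<bar>Im w\<bar> \<le> s * cmod w \<Longrightarrow> 0 < \<mu> \<Longrightarrow>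
    \<kappa> * (cmod z + \<mu> * cmod w) \<le> cmod (z + of_real \<mu> * w)"
  using sector_norm_add_ge[of z "of_real \<mu> * w" s] s
  by (simp add: \<kappa>_def norm_mult abs_mult mult.left_commute)

definition "L = K / \<kappa>"

lemma L: "1 \<le> L" using K \<kappa> by (simp add: L_def le_divide_eq)

lemma L_powers: "1 \<le> L" "1 \<le> L\<^sup>2" "1 \<le> L ^ 3" "L \<le> L ^ 3" "L\<^sup>2 \<le> L ^ 3"
  using L power_increasing[of 1 3 L] power_increasing[of 2 3 L] by (auto simp: one_le_power)

text \<open>\<open>H \<mu>\<close> is the Laplace transform of the scalar resolvent and \<open>d \<mu>\<close> its denominator; digits count
  formal derivatives.\<close>

definition "d \<mu> z = z + of_real \<mu> * b0 z"
definition "d1 \<mu> z = 1 + of_real \<mu> * b1 z"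
definition "d2 \<mu> z = of_real \<mu> * b2 z"

text \<open>Since z and \<mu> b^ cannot cancel, |z| + \<mu> |b^| is at most |d| / \<kappa>. By
  2-regularity the scaled derivatives of d are bounded by K times the same sum, so one constant
  \<open>L\<close> without \<mu> serves for all of them.\<close>

lemma d_bounds:
  assumes z: "Re z > 0" and \<mu>: "\<mu> > 0"
  shows "d \<mu> z \<noteq> 0" "cmod z \<le> L * cmod (d \<mu> z)"
    "cmod z * cmod (d1 \<mu> z) \<le> L * cmod (d \<mu> z)" "(cmod z)\<^sup>2 * cmod (d2 \<mu> z) \<le> L * cmod (d \<mu> z)"
proof -
  have z0: "cmod z > 0" using z by (auto simp: complex_eq_iff)
  have "\<kappa> * (cmod z + \<mu> * cmod (b0 z)) \<le> cmod (d \<mu> z)"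
    unfolding d_def using z \<mu> Re_nonneg[OF z] Im_le[OF z] by (intro \<kappa>_le) auto
  then have "cmod z + \<mu> * cmod (b0 z) \<le> cmod (d \<mu> z) / \<kappa>" using \<kappa> by (simp add: field_simps)
  then have "K * (cmod z + \<mu> * cmod (b0 z)) \<le> K * (cmod (d \<mu> z) / \<kappa>)" using K by (intro mult_left_mono) auto
  then have k: "K * cmod z + \<mu> * (K * cmod (b0 z)) \<le> L * cmod (d \<mu> z)" by (simp add: L_def algebra_simps)
  have nn: "0 \<le> \<mu> * (K * cmod (b0 z))" "0 \<le> K * cmod z" using \<mu> K by auto
  have zK: "cmod z \<le> K * cmod z" using K mult_right_mono[of 1 K "cmod z"] by simp
  then show 2: "cmod z \<le> L * cmod (d \<mu> z)" using k nn by linarith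
  then show "d \<mu> z \<noteq> 0" using z0 by auto
  have "cmod (d1 \<mu> z) \<le> 1 + \<mu> * cmod (b1 z)"
    unfolding d1_def using norm_triangle_ineq[of 1 "of_real \<mu> * b1 z"] \<mu> by (simp add: norm_mult)
  then have "cmod z * cmod (d1 \<mu> z) \<le> cmod z * (1 + \<mu> * cmod (b1 z))" by (rule mult_left_mono) simp
  also have "\<dots> = cmod z + \<mu> * (cmod z * cmod (b1 z))" by (simp add: algebra_simps)
  also have "\<dots> \<le> cmod z + \<mu> * (K * cmod (b0 z))" using b1_le[OF z] \<mu> by (intro add_left_mono mult_left_mono) auto
  finally show "cmod z * cmod (d1 \<mu> z) \<le> L * cmod (d \<mu> z)" using k zK by linarith
  have "(cmod z)\<^sup>2 * cmod (d2 \<mu> z) = \<mu> * ((cmod z)\<^sup>2 * cmod (b2 z))" using \<mu> by (simp add: d2_def norm_mult)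
  also have "\<dots> \<le> \<mu> * (K * cmod (b0 z))" using b2_le[OF z] \<mu> by (intro mult_left_mono) auto
  finally show "(cmod z)\<^sup>2 * cmod (d2 \<mu> z) \<le> L * cmod (d \<mu> z)" using k nn by linarith
qed

definition "H \<mu> z = inverse (d \<mu> z)"
definition "H1 \<mu> z = - d1 \<mu> z / (d \<mu> z)\<^sup>2"
definition "H2 \<mu> z = - d2 \<mu> z / (d \<mu> z)\<^sup>2 + 2 * (d1 \<mu> z)\<^sup>2 / (d \<mu> z) ^ 3"

lemma H_derivs:
  assumes z: "Re z > 0" and \<mu>: "\<mu> > 0"
  shows "(H \<mu> has_field_derivative H1 \<mu> z) (at z)" "(H1 \<mu> has_field_derivative H2 \<mu> z) (at z)"
proof -
  note nz = d_bounds(1)[OF z \<mu>]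
  have D: "(d \<mu> has_field_derivative d1 \<mu> z) (at z)"
    unfolding d_def[abs_def] d1_def by (auto intro!: derivative_eq_intros b0_deriv z)
  have D1: "(d1 \<mu> has_field_derivative d2 \<mu> z) (at z)"
    unfolding d1_def[abs_def] d2_def by (auto intro!: derivative_eq_intros b1_deriv z)
  show "(H \<mu> has_field_derivative H1 \<mu> z) (at z)"
    unfolding H_def[abs_def] H1_def using D nz
    by (auto intro!: derivative_eq_intros simp: divide_inverse power2_eq_square)
  have D2: "((\<lambda>z. (d \<mu> z)\<^sup>2) has_field_derivative 2 * d \<mu> z * d1 \<mu> z) (at z)"
    using DERIV_power[OF D, of 2] by (simp add: mult_ac)
  have "(H1 \<mu> has_field_derivative ((- d2 \<mu> z) * (d \<mu> z)\<^sup>2 - (- d1 \<mu> z) * (2 * d \<mu> z * d1 \<mu> z)) / ((d \<mu> z)\<^sup>2 * (d \<mu> z)\<^sup>2)) (at z)"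
    unfolding H1_def[abs_def] by (rule DERIV_divide[OF DERIV_minus[OF D1] D2]) (use nz in simp)
  also have "((- d2 \<mu> z) * (d \<mu> z)\<^sup>2 - (- d1 \<mu> z) * (2 * d \<mu> z * d1 \<mu> z)) / ((d \<mu> z)\<^sup>2 * (d \<mu> z)\<^sup>2) = H2 \<mu> z"
    unfolding H2_def using nz by (simp add: divide_simps power2_eq_square power3_eq_cube) (simp add: algebra_simps)
  finally show "(H1 \<mu> has_field_derivative H2 \<mu> z) (at z)" .
qed

text \<open>By \<open>d_bounds\<close> the quotients d1 / d and d2 / d are of order 1 / |z| and 1 /
  |z|^2, so \<mu> drops out of every term.\<close>

lemma H_bounds:
  assumes z: "Re z > 0" and \<mu>: "\<mu> > 0"
  shows "cmod (H \<mu> z) \<le> L / cmod z" "cmod (H1 \<mu> z) \<le> L\<^sup>2 / (cmod z)\<^sup>2" "cmod (H2 \<mu> z) \<le> 3 * L ^ 3 / cmod z ^ 3"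
proof -
  note db = d_bounds[OF z \<mu>]
  define r where "r = cmod z" define D where "D = cmod (d \<mu> z)"
  have r: "r > 0" using z by (auto simp: r_def complex_eq_iff)
  have D: "D > 0" using db(1) by (simp add: D_def)
  have L0: "L > 0" using L by simp
  have iD: "1 / D \<le> L / r" using db(2) r D by (simp add: r_def[symmetric] D_def[symmetric] field_simps)
  have e1: "cmod (d1 \<mu> z) \<le> L * D / r" using db(3) r by (simp add: r_def[symmetric] D_def[symmetric] field_simps)
  have e2: "cmod (d2 \<mu> z) \<le> L * D / r\<^sup>2" using db(4) r by (simp add: r_def[symmetric] D_def[symmetric] field_simps)
  show "cmod (H \<mu> z) \<le> L / cmod z" using iD by (simp add: H_def norm_inverse r_def D_def divide_inverse)
  have "cmod (H1 \<mu> z) = cmod (d1 \<mu> z) / D\<^sup>2" by (simp add: H1_def norm_divide norm_power D_def)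
  also have "\<dots> \<le> (L * D / r) / D\<^sup>2" using e1 by (intro divide_right_mono) auto
  also have "\<dots> = L / r * (1 / D)" using D by (simp add: power2_eq_square)
  also have "\<dots> \<le> L / r * (L / r)" using iD L0 r by (intro mult_left_mono) auto
  finally show "cmod (H1 \<mu> z) \<le> L\<^sup>2 / (cmod z)\<^sup>2" by (simp add: r_def power2_eq_square)
  have "cmod (H2 \<mu> z) \<le> cmod (d2 \<mu> z) / D\<^sup>2 + 2 * (cmod (d1 \<mu> z))\<^sup>2 / D ^ 3"
    unfolding H2_def using norm_triangle_ineq[of "- d2 \<mu> z / (d \<mu> z)\<^sup>2" "2 * (d1 \<mu> z)\<^sup>2 / (d \<mu> z) ^ 3"]
    by (simp add: norm_divide norm_power norm_mult D_def)
  also have "\<dots> \<le> (L * D / r\<^sup>2) / D\<^sup>2 + 2 * (L * D / r)\<^sup>2 / D ^ 3"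
    using e1 e2 D by (intro add_mono divide_right_mono mult_left_mono power_mono) auto
  also have "\<dots> = (L + 2 * L\<^sup>2) / r\<^sup>2 * (1 / D)"
    using D r by (simp add: power2_eq_square power3_eq_cube field_simps)
  also have "\<dots> \<le> (L + 2 * L\<^sup>2) / r\<^sup>2 * (L / r)" using iD L0 r by (intro mult_left_mono) auto
  also have "\<dots> = (L\<^sup>2 + 2 * L ^ 3) / r ^ 3"
    by (simp only: times_divide_times_eq) (simp add: power2_eq_square power3_eq_cube algebra_simps)
  also have "\<dots> \<le> 3 * L ^ 3 / r ^ 3" using L_powers r by (intro divide_right_mono) auto
  finally show "cmod (H2 \<mu> z) \<le> 3 * L ^ 3 / cmod z ^ 3" by (simp add: r_def)
qed

lemma H_cnj: "H \<mu> (cnj z) = cnj (H \<mu> z)" "H1 \<mu> (cnj z) = cnj (H1 \<mu> z)" "H2 \<mu> (cnj z) = cnj (H2 \<mu> z)"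
  by (simp_all add: H_def H1_def H2_def d_def d1_def d2_def cnj_b)

text \<open>The transform of u' is z H - 1, and its constant disappears on differentiation. Two
  derivatives are taken because z H is only bounded and its first derivative is only of order 1 /
  |z|.\<close>

definition "zH1 \<mu> z = H \<mu> z + z * H1 \<mu> z"
definition "zH2 \<mu> z = 2 * H1 \<mu> z + z * H2 \<mu> z"

lemma zH_derivs:
  assumes z: "Re z > 0" and \<mu>: "\<mu> > 0"
  shows "((\<lambda>z. z * H \<mu> z) has_field_derivative zH1 \<mu> z) (at z)" "(zH1 \<mu> has_field_derivative zH2 \<mu> z) (at z)"
  unfolding zH1_def[abs_def] zH2_def
  by (auto intro!: derivative_eq_intros H_derivs[OF z \<mu>])

lemma zH_bounds:
  assumes z: "Re z > 0" and \<mu>: "\<mu> > 0"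
  shows "cmod (zH1 \<mu> z) \<le> 5 * L ^ 3 / cmod z" "cmod (zH2 \<mu> z) \<le> 5 * L ^ 3 / (cmod z)\<^sup>2"
proof -
  note hb = H_bounds[OF z \<mu>]
  have r: "cmod z > 0" using z by (auto simp: complex_eq_iff)
  have "cmod (zH1 \<mu> z) \<le> cmod (H \<mu> z) + cmod z * cmod (H1 \<mu> z)"
    unfolding zH1_def using norm_triangle_ineq[of "H \<mu> z" "z * H1 \<mu> z"] by (simp add: norm_mult)
  also have "\<dots> \<le> L / cmod z + cmod z * (L\<^sup>2 / (cmod z)\<^sup>2)"
    using hb by (intro add_mono mult_left_mono) auto
  also have "\<dots> = (L + L\<^sup>2) / cmod z" using r by (simp add: power2_eq_square add_divide_distrib)
  also have "\<dots> \<le> 5 * L ^ 3 / cmod z" using L_powers r by (intro divide_right_mono) auto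
  finally show "cmod (zH1 \<mu> z) \<le> 5 * L ^ 3 / cmod z" .
  have "cmod (zH2 \<mu> z) \<le> 2 * cmod (H1 \<mu> z) + cmod z * cmod (H2 \<mu> z)"
    unfolding zH2_def using norm_triangle_ineq[of "2 * H1 \<mu> z" "z * H2 \<mu> z"] by (simp add: norm_mult)
  also have "\<dots> \<le> 2 * (L\<^sup>2 / (cmod z)\<^sup>2) + cmod z * (3 * L ^ 3 / cmod z ^ 3)"
    using hb by (intro add_mono mult_left_mono) auto
  also have "\<dots> = (2 * L\<^sup>2 + 3 * L ^ 3) / (cmod z)\<^sup>2"
    using r by (simp add: power2_eq_square power3_eq_cube add_divide_distrib)
  also have "\<dots> \<le> 5 * L ^ 3 / (cmod z)\<^sup>2" using L_powers r by (intro divide_right_mono) auto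
  finally show "cmod (zH2 \<mu> z) \<le> 5 * L ^ 3 / (cmod z)\<^sup>2" .
qed

text \<open>At height at least k, regularity reads |b1| <= (K / k) |b0|. This is a Gronwall
  inequality in the real part and carries the bound on the line Re z = 1 up to the axis.\<close>

lemma b0_locally_bounded:
  assumes k: "k > 0"
  obtains M where "\<And>a y. 0 < a \<Longrightarrow> a \<le> 1 \<Longrightarrow> k \<le> y \<Longrightarrow> y \<le> k' \<Longrightarrow> cmod (b0 (Complex a y)) \<le> M"
proof -
  have "continuous_on {k..k'} (\<lambda>y. cmod (b0 (Complex 1 y)))"
  proof (intro continuous_on_norm continuous_at_imp_continuous_on ballI)
    fix y
    show "isCont (\<lambda>y. b0 (Complex 1 y)) y"
      by (rule has_vector_derivative_continuous[OF has_vector_derivative_vertical[OF b0_deriv]]) simp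
  qed
  then have "bounded ((\<lambda>y. cmod (b0 (Complex 1 y))) ` {k..k'})"
    by (intro compact_imp_bounded compact_continuous_image) auto
  then obtain M where M: "\<And>y. k \<le> y \<Longrightarrow> y \<le> k' \<Longrightarrow> cmod (b0 (Complex 1 y)) \<le> M"
    unfolding bounded_iff by (metis abs_norm_cancel atLeastAtMost_iff imageI real_norm_def)
  show ?thesis
  proof (rule that[of "exp (K / k) * M"])
    fix a y :: real assume a: "0 < a" "a \<le> 1" and y: "k \<le> y" "y \<le> k'"
    have "cmod (b0 (Complex a y)) \<le> exp (K / k * (1 - a)) * cmod (b0 (Complex 1 y))"
    proof (rule gronwall_backward[OF a(2), of "\<lambda>a. b0 (Complex a y)" "\<lambda>a. b1 (Complex a y)"])
      fix x assume x: "a \<le> x" "x \<le> 1"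
      have z: "Re (Complex x y) > 0" using a x by simp
      have "((\<lambda>x. Complex x y) has_vector_derivative 1) (at x)"
        unfolding Complex_eq by (auto intro!: derivative_eq_intros has_vector_derivative_of_real)
      from field_vector_diff_chain_within[OF this, of b0 "b1 (Complex x y)"] b0_deriv[OF z]
      show "((\<lambda>a. b0 (Complex a y)) has_vector_derivative b1 (Complex x y)) (at x)"
        by (simp add: o_def has_field_derivative_at_within)
      have "k \<le> cmod (Complex x y)" using abs_Im_le_cmod[of "Complex x y"] y k by simp
      then have "k * cmod (b1 (Complex x y)) \<le> cmod (Complex x y) * cmod (b1 (Complex x y))"
        by (rule mult_right_mono) simp
      also have "\<dots> \<le> K * cmod (b0 (Complex x y))" by (rule b1_le[OF z])
      finally show "cmod (b1 (Complex x y)) \<le> K / k * cmod (b0 (Complex x y))" using k by (simp add: field_simps)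
    qed
    also have "\<dots> \<le> exp (K / k) * M"
    proof (intro mult_mono)
      show "exp (K / k * (1 - a)) \<le> exp (K / k)"
        unfolding exp_le_cancel_iff using K k a by (intro mult_left_le) auto
    qed (use M[OF y] in auto)
    finally show "cmod (b0 (Complex a y)) \<le> exp (K / k) * M" .
  qed
qed

text \<open>The vertical difference quotient of \<open>b0\<close> with step h approximates
  \<open>b1\<close> up to N h, uniformly in the distance a to the axis, because \<open>b2\<close> is
  bounded near the point. For fixed h the quotient tends to that of g as a tends to 0. The factor -
  i converts the k-derivative into the complex one.\<close>

lemma b1_boundary:
  assumes g: "boundary_function b g" and k: "k > 0" and g1: "(g has_vector_derivative g1) (at k)"
  shows "((\<lambda>a. b1 (Complex a k)) \<longlongrightarrow> - \<i> * g1) (at_right 0)"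
proof -
  have k2: "k / 2 > 0" using k by simp
  obtain M where M: "\<And>a y. 0 < a \<Longrightarrow> a \<le> 1 \<Longrightarrow> k / 2 \<le> y \<Longrightarrow> y \<le> 2 * k \<Longrightarrow> cmod (b0 (Complex a y)) \<le> M"
    using b0_locally_bounded[OF k2] by blast
  define N where "N = K * M / (k / 2)\<^sup>2"
  have M0: "M \<ge> 0" using order_trans[OF norm_ge_zero M[of 1 k]] k by simp
  have N0: "N \<ge> 0" using K M0 by (simp add: N_def)
  have N: "cmod (b2 (Complex a y)) \<le> N" if "0 < a" "a \<le> 1" "k / 2 \<le> y" "y \<le> 2 * k" for a y
  proof -
    have "k / 2 \<le> cmod (Complex a y)" using abs_Im_le_cmod[of "Complex a y"] that k by simp
    then have "(k / 2)\<^sup>2 \<le> (cmod (Complex a y))\<^sup>2" using k by (intro power_mono) auto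
    then have "(k / 2)\<^sup>2 * cmod (b2 (Complex a y)) \<le> (cmod (Complex a y))\<^sup>2 * cmod (b2 (Complex a y))"
      by (rule mult_right_mono) simp
    also have "\<dots> \<le> K * cmod (b0 (Complex a y))" using that by (intro b2_le) simp
    also have "\<dots> \<le> K * M" using M[OF that] K by (intro mult_left_mono) auto
    finally show ?thesis using k by (simp add: N_def field_simps)
  qed
  have T: "cmod ((b0 (Complex a (k + h)) - b0 (Complex a k)) / (\<i> * of_real h) - b1 (Complex a k)) \<le> N * h"
    if a: "0 < a" "a \<le> 1" and h: "0 < h" "h \<le> k" for a h
  proof -
    define S where "S = {z. Re z = a \<and> k / 2 \<le> Im z \<and> Im z \<le> 2 * k}"
    define f where "f i = (if i = 0 then b0 else if i = 1 then b1 else b2)" for i :: nat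
    have "S = {z. Re z \<le> a} \<inter> {z. Re z \<ge> a} \<inter> {z. Im z \<le> 2 * k} \<inter> {z. Im z \<ge> k / 2}" by (auto simp: S_def)
    then have cS: "convex S" by (simp only: convex_Int convex_halfspace_Re_ge convex_halfspace_Re_le convex_halfspace_Im_ge convex_halfspace_Im_le)
    have "norm (f 0 (Complex a (k + h)) - (\<Sum>i\<le>1. f i (Complex a k) * (Complex a (k + h) - Complex a k) ^ i / fact i))
        \<le> N * norm (Complex a (k + h) - Complex a k) ^ Suc 1 / fact 1"
    proof (rule complex_Taylor[OF cS])
      fix i x assume "x \<in> S" "i \<le> (1::nat)"
      then have "Re x > 0" "i = 0 \<or> i = 1" using a by (auto simp: S_def)
      then show "(f i has_field_derivative f (Suc i) x) (at x within S)"
        by (auto simp: f_def intro!: has_field_derivative_at_within b0_deriv b1_deriv)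
    next
      fix x assume "x \<in> S"
      then show "cmod (f (Suc 1) x) \<le> N"
        using N[of a "Im x"] a by (cases x) (auto simp: f_def S_def)
    qed (use h k in \<open>auto simp: S_def\<close>)
    moreover have "Complex a (k + h) - Complex a k = \<i> * of_real h" by (simp add: complex_eq_iff)
    ultimately have "cmod (b0 (Complex a (k + h)) - (b0 (Complex a k) + b1 (Complex a k) * (\<i> * of_real h))) \<le> N * h\<^sup>2"
      using h by (simp add: f_def norm_mult power2_eq_square)
    moreover have "(b0 (Complex a (k + h)) - b0 (Complex a k)) / (\<i> * of_real h) - b1 (Complex a k)
      = (b0 (Complex a (k + h)) - (b0 (Complex a k) + b1 (Complex a k) * (\<i> * of_real h))) / (\<i> * of_real h)"
      using h by (simp add: divide_simps)
    ultimately show ?thesis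
      using h by (simp add: norm_divide norm_mult divide_le_eq power2_eq_square mult.assoc)
  qed
  show ?thesis
  proof (rule tendstoI)
    fix e :: real assume e: "e > 0"
    have "((\<lambda>h. norm (g (k + h) - g k - h *\<^sub>R g1) / norm h) \<longlongrightarrow> 0) (at 0)"
      using g1 unfolding has_vector_derivative_def has_derivative_at by blast
    then have "((\<lambda>h. norm (g (k + h) - g k - h *\<^sub>R g1) / norm h) \<longlongrightarrow> 0) (at_right 0)"
      by (rule tendsto_within_subset) simp
    moreover have "norm (g (k + h) - g k - h *\<^sub>R g1) / norm h = dist ((g (k + h) - g k) /\<^sub>R h) g1" if "h > 0" for h
    proof -
      have "(g (k + h) - g k) /\<^sub>R h - g1 = (g (k + h) - g k - h *\<^sub>R g1) /\<^sub>R h"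
        using that by (simp add: scaleR_diff_right)
      then show ?thesis using that by (simp add: dist_norm divide_inverse_commute)
    qed
    ultimately have "\<forall>\<^sub>F h in at_right 0. dist ((g (k + h) - g k) /\<^sub>R h) g1 < e / 3"
      using order_tendstoD(2)[of _ 0 "at_right 0" "e / 3"] e
      by (smt (verit, ccfv_SIG) eventually_at_right_less eventually_elim2 zero_less_divide_iff)
    moreover have "\<forall>\<^sub>F h in at_right 0. 0 < h \<and> h < min k (e / (3 * (N + 1)))"
      using k e N0 by (intro eventually_at_rightI[of 0 "min k (e / (3 * (N + 1)))"]) auto
    ultimately have "\<forall>\<^sub>F h in at_right 0. dist ((g (k + h) - g k) /\<^sub>R h) g1 < e / 3 \<and> 0 < h \<and> h < min k (e / (3 * (N + 1)))"
      by eventually_elim simp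
    \<comment> \<open>A single step h, fixed before a tends to 0: it makes the Taylor error and the
      error of the quotient of g both smaller than e / 3. The last third is left for the limit in
      a.\<close>
    then obtain h where h: "dist ((g (k + h) - g k) /\<^sub>R h) g1 < e / 3" "0 < h" "h < k" "h < e / (3 * (N + 1))"
      by (metis (no_types, lifting) eventually_happens' min_less_iff_conj trivial_limit_at_right_real)
    have Nh: "N * h < e / 3"
    proof -
      have "N * h \<le> (N + 1) * h" using h by simp
      also have "\<dots> < (N + 1) * (e / (3 * (N + 1)))" using h N0 by (intro mult_strict_left_mono) auto
      also have "(N + 1) * (e / (3 * (N + 1))) = e / 3"
      proof -
        have "x * (e / (3 * x)) = e / 3" if "x \<noteq> 0" for x using that by simp
        from this[of "N + 1"] show ?thesis using N0 by linarith
      qed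
      finally show ?thesis .
    qed
    have "((\<lambda>a. (b0 (Complex a (k + h)) - b0 (Complex a k)) / (\<i> * of_real h)) \<longlongrightarrow> (g (k + h) - g k) / (\<i> * of_real h)) (at_right 0)"
      using g k h unfolding boundary_function_def by (intro tendsto_intros) auto
    from tendstoD[OF this, of "e / 3"] e
    have "\<forall>\<^sub>F a in at_right 0. dist ((b0 (Complex a (k + h)) - b0 (Complex a k)) / (\<i> * of_real h)) ((g (k + h) - g k) / (\<i> * of_real h)) < e / 3"
      by simp
    moreover have "\<forall>\<^sub>F a in at_right 0. 0 < a \<and> a \<le> (1::real)"
      by (intro eventually_at_rightI[of 0 1]) auto
    ultimately show "\<forall>\<^sub>F a in at_right 0. dist (b1 (Complex a k)) (- \<i> * g1) < e"
    proof eventually_elim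
      case (elim a)
      let ?q = "(b0 (Complex a (k + h)) - b0 (Complex a k)) / (\<i> * of_real h)"
      let ?r = "(g (k + h) - g k) / (\<i> * of_real h)"
      have "dist ?q (b1 (Complex a k)) < e / 3" using T[of a h] elim h Nh by (simp add: dist_norm)
      moreover have "dist ?r (- \<i> * g1) = dist ((g (k + h) - g k) /\<^sub>R h) g1"
      proof -
        have "?r - (- \<i> * g1) = - \<i> * ((g (k + h) - g k) /\<^sub>R h - g1)"
          using h by (simp add: scaleR_conv_of_real field_simps)
        then show ?thesis by (simp add: dist_norm norm_mult)
      qed
      ultimately show ?case
        using elim h(1) dist_triangle3[of "b1 (Complex a k)" "- \<i> * g1" ?q] dist_triangle[of ?q "- \<i> * g1" ?r]
        by (simp add: dist_commute)
    qed
  qed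
qed

end

section \<open>Bounds for the scalar resolvent\<close>

text \<open>\<open>F\<close> continues the transform of f from Re z > w to the whole half-plane. The
  same integral over Re z = 1/t is then estimated twice: absolutely, giving e C pi t, and through
  the boundary, giving 2 B. Division by 2 pi yields the two bounds, neither of which contains M or
  w.\<close>

lemma inversion_bounds:
  assumes cf: "continuous_on {0<..} f" and fb: "\<And>t. t > 0 \<Longrightarrow> \<bar>f t\<bar> \<le> M * exp (w * t)" and w: "w > 0"
    and LF: "\<And>z. Re z > w \<Longrightarrow> laplace f z = F z"
    and F: "F holomorphic_on {z. 0 < Re z}"
    and G: "\<And>z. Re z > 0 \<Longrightarrow> (G has_field_derivative F z) (at z)"
    and bF: "\<And>z. Re z > 0 \<Longrightarrow> cmod (F z) \<le> C / (cmod z)\<^sup>2"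
    and bG: "\<And>z. Re z > 0 \<Longrightarrow> cmod (G z) \<le> C / cmod z"
    and cnjF: "\<And>z. Re z > 0 \<Longrightarrow> F (cnj z) = cnj (F z)"
    and \<gamma>: "\<And>k. k > 0 \<Longrightarrow> ((\<lambda>a. G (Complex a k)) \<longlongrightarrow> \<gamma> k) (at_right 0)"
    and d\<gamma>: "\<And>k. k > 0 \<Longrightarrow> (\<gamma> has_vector_derivative \<gamma>' k) (at k)"
    and c\<gamma>: "continuous_on {0<..} \<gamma>'" and B: "B \<ge> 0"
    and nn: "(\<integral>\<^sup>+k\<in>{0<..}. ennreal (cmod (\<gamma>' k)) \<partial>lebesgue) \<le> ennreal B"
    and t: "t > 0"
  shows "\<bar>f t\<bar> \<le> exp 1 * C / 2 * t" "\<bar>f t\<bar> \<le> B / pi"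
proof -
  have C0: "C \<ge> 0" using order_trans[OF norm_ge_zero bG[of 1]] by simp
  have cF: "continuous_on {z. 0 < Re z} F" using F by (rule holomorphic_on_imp_continuous_on)
  define E where "E z = exp (z * of_real t) * F z" for z
  have E: "E holomorphic_on {z. 0 < Re z}" unfolding E_def[abs_def] by (intro holomorphic_intros F)
  have cE: "continuous_on {z. 0 < Re z} E" using E by (rule holomorphic_on_imp_continuous_on)
  have bE: "cmod (E z) \<le> exp (Re z * t) * C / (cmod z)\<^sup>2" if "Re z > 0" for z
    using mult_left_mono[OF bF[OF that], of "exp (Re z * t)"] by (simp add: E_def norm_mult)
  \<comment> \<open>This line lies to the right of w, where inversion is valid, and to the right of
    1/t, to which the integral is then shifted.\<close>
  define a where "a = w + 1 / t"
  have a: "a > 0" "a > w" "1 / t \<le> a" "1 / t > 0" using w t by (auto simp: a_def add_pos_pos)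
  have LFa: "laplace f (Complex a k) = F (Complex a k)" for k using LF[of "Complex a k"] a by simp
  have "integrable lborel (\<lambda>k. F (Complex a k))"
    by (rule vertical_line_integral(1)[OF cF a(1), of C]) (use bF[of "Complex a k" for k] a in \<open>simp add: cmod_Complex_sq\<close>)
  then have "(LBINT k. E (Complex a k)) = 2 * pi * of_real (f t)"
    using laplace_inversion[OF cf fb a(2) _ t] by (simp add: LFa E_def)
  moreover have "(LBINT k. E (Complex (1 / t) k)) = (LBINT k. E (Complex a k))"
  proof (rule vertical_shift[OF E a(4,3)])
    fix z assume z: "1 / t \<le> Re z" "Re z \<le> a"
    then have "Re z > 0" using a by linarith
    then have "cmod (E z) \<le> exp (Re z * t) * C / (cmod z)\<^sup>2" by (rule bE)
    also have "\<dots> \<le> exp (a * t) * C / (cmod z)\<^sup>2"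
      using z t C0 by (intro divide_right_mono mult_right_mono) auto
    finally show "cmod (E z) \<le> exp (a * t) * C / (cmod z)\<^sup>2" .
  qed
  ultimately have eq: "(LBINT k. E (Complex (1 / t) k)) = 2 * pi * of_real (f t)" by simp
  then have "cmod (LBINT k. E (Complex (1 / t) k)) = cmod (of_real (2 * pi * f t))" by simp
  then have eq': "cmod (LBINT k. E (Complex (1 / t) k)) = 2 * pi * \<bar>f t\<bar>"
    unfolding norm_of_real by (simp add: abs_mult)
  have "cmod (LBINT k. E (Complex (1 / t) k)) \<le> exp 1 * C * pi / (1 / t)"
  proof (rule vertical_line_integral(2)[OF cE a(4)])
    show "cmod (E (Complex (1 / t) k)) \<le> exp 1 * C / ((1 / t)\<^sup>2 + k\<^sup>2)" for k
      using bE[of "Complex (1 / t) k"] a(4) t by (simp only: cmod_Complex_sq complex.sel) simp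
  qed
  then show "\<bar>f t\<bar> \<le> exp 1 * C / 2 * t" unfolding eq' by (simp add: field_simps)
  have "cmod (LBINT k. E (Complex (1 / t) k)) \<le> 2 * B"
    unfolding E_def by (rule boundary_bound[OF F G bF bG cnjF \<gamma> d\<gamma> c\<gamma> B nn t a(4)])
  then show "\<bar>f t\<bar> \<le> B / pi" unfolding eq' by (simp add: field_simps)
qed

section \<open>The symbol on the imaginary axis\<close>

locale boundary_kernel = sectorial_kernel +
  fixes g g1 g2 g3 :: "real \<Rightarrow> complex"
  assumes bg: "boundary_function b g" and tg: "three_derivs g g1 g2 g3"
begin

lemma g_limit: "k > 0 \<Longrightarrow> ((\<lambda>a. b0 (Complex a k)) \<longlongrightarrow> g k) (at_right 0)"
  using bg by (simp add: boundary_function_def)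

lemma g_derivs:
  assumes "k > 0"
  shows "(g has_vector_derivative g1 k) (at k)" "(g1 has_vector_derivative g2 k) (at k)"
  using tg assms by (auto simp: three_derivs_def)

lemma g1_limit: "k > 0 \<Longrightarrow> ((\<lambda>a. b1 (Complex a k)) \<longlongrightarrow> - \<i> * g1 k) (at_right 0)"
  by (rule b1_boundary[OF bg _ g_derivs(1)])

lemma ev_pos: "\<forall>\<^sub>F a in at_right 0. Re (Complex a k) > 0"
  by (intro eventually_at_rightI[of 0 1]) auto

lemma Complex_limit: "((\<lambda>a. Complex a k) \<longlongrightarrow> Complex 0 k) (at_right 0)"
  by (intro tendsto_Complex tendsto_intros)

text \<open>Non-strict inequalities survive the limit to the axis, so g inherits the sector and the
  first-order regularity of b^.\<close>

lemma g_sector: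
  assumes k: "k > 0"
  shows "0 \<le> Re (g k)" "\<bar>Im (g k)\<bar> \<le> s * cmod (g k)" "k * cmod (g1 k) \<le> K * cmod (g k)"
proof -
  show "0 \<le> Re (g k)"
    by (rule tendsto_lowerbound[OF tendsto_Re[OF g_limit[OF k]]])
       (use ev_pos[of k] in \<open>auto elim!: eventually_mono intro: Re_nonneg\<close>)
  show "\<bar>Im (g k)\<bar> \<le> s * cmod (g k)"
    by (rule tendsto_le[OF _ tendsto_mult[OF tendsto_const tendsto_norm[OF g_limit[OF k]]] tendsto_rabs[OF tendsto_Im[OF g_limit[OF k]]]])
       (use ev_pos[of k] in \<open>auto elim!: eventually_mono intro: Im_le\<close>)
  have "cmod (Complex 0 k) * cmod (- \<i> * g1 k) \<le> K * cmod (g k)"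
    by (rule tendsto_le[OF _ tendsto_mult[OF tendsto_const tendsto_norm[OF g_limit[OF k]]]
          tendsto_mult[OF tendsto_norm[OF Complex_limit] tendsto_norm[OF g1_limit[OF k]]]])
       (use ev_pos[of k] in \<open>auto elim!: eventually_mono intro: b1_le\<close>)
  moreover have "cmod (Complex 0 k) = k" using k by (simp add: cmod_def)
  ultimately show "k * cmod (g1 k) \<le> K * cmod (g k)" by (simp add: norm_mult)
qed

text \<open>g and g1 are differentiable, and g2 is an indefinite integral of a locally integrable
  function. Continuity of g2 makes the boundary derivative \<open>\<gamma>2'\<close> continuous, as
  \<open>boundary_bound\<close> requires.\<close>

lemma g_continuous:
  "continuous_on {0<..} g" "continuous_on {0<..} g1" "continuous_on {0<..} g2"
proof -
  show "continuous_on {0<..} g" "continuous_on {0<..} g1"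
    by (rule continuous_at_imp_continuous_on; use g_derivs has_vector_derivative_continuous in \<open>fastforce simp: continuous_at_imp_continuous_on\<close>)+
  show "continuous_on {0<..} g2"
  proof (rule continuous_at_imp_continuous_on, rule ballI)
    fix k :: real assume "k \<in> {0<..}"
    then have k: "k > 0" by simp
    have I: "set_integrable lebesgue {k / 2..2 * k} g3"
      and eq: "\<And>y. k / 2 \<le> y \<Longrightarrow> g2 y - g2 (k / 2) = (LINT x:{k / 2..y}|lebesgue. g3 x)"
      using tg k by (auto simp: three_derivs_def)
    have int: "g3 integrable_on {k / 2..2 * k}" by (rule set_lebesgue_integral_eq_integral(1)[OF I])
    have "g2 y = g2 (k / 2) + integral {k / 2..y} g3" if "y \<in> {k / 2..2 * k}" for y
    proof -
      have "set_integrable lebesgue {k / 2..y} g3" by (rule set_integrable_subset[OF I]) (use that in auto)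
      from set_lebesgue_integral_eq_integral(2)[OF this] eq[of y] that show ?thesis by (simp add: algebra_simps)
    qed
    moreover have "continuous_on {k / 2..2 * k} (\<lambda>y. g2 (k / 2) + integral {k / 2..y} g3)"
      by (intro continuous_intros indefinite_integral_continuous_1 int)
    ultimately have "continuous_on {k / 2..2 * k} g2" by (metis (no_types, lifting) continuous_on_eq)
    then show "isCont g2 k" using k by (auto intro: continuous_on_interior)
  qed
qed

text \<open>\<open>D \<mu>\<close> is the boundary function of \<open>d \<mu>\<close>, with derivatives in the real variable \<open>k\<close>, and \<open>W \<mu>\<close> is the
  integrand of the second integral condition on the kernel without its third-order term.\<close>

definition "D \<mu> k = \<i> * of_real k + of_real \<mu> * g k"
definition "D1 \<mu> k = \<i> + of_real \<mu> * g1 k"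
definition "D2 \<mu> k = of_real \<mu> * g2 k"
definition "W \<mu> k = (cmod (of_real k * g2 k) + cmod (g1 k) + 1 / \<mu>) / (k + \<mu> * cmod (g k))\<^sup>2"
text \<open>The numerators of the boundary derivatives cost the factor 2 (1 + K) / \<kappa>, and
  replacing |D|^2 in the denominator by (k + \<mu> |g|)^2 costs 1 / \<kappa>^2.\<close>

definition "A = 2 * (1 + K) / \<kappa> ^ 3"

lemma A_pos: "A > 0" using K \<kappa> by (simp add: A_def)

lemma D_ge: "k > 0 \<Longrightarrow> \<mu> > 0 \<Longrightarrow> \<kappa> * (k + \<mu> * cmod (g k)) \<le> cmod (D \<mu> k)"
  using \<kappa>_le[of "\<i> * of_real k" "g k" \<mu>] g_sector[of k] by (simp add: D_def norm_mult)

lemma D_pos: "k > 0 \<Longrightarrow> \<mu> > 0 \<Longrightarrow> k + \<mu> * cmod (g k) > 0" "k > 0 \<Longrightarrow> \<mu> > 0 \<Longrightarrow> D \<mu> k \<noteq> 0"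
proof -
  show 1: "k + \<mu> * cmod (g k) > 0" if "k > 0" "\<mu> > 0" using that by (simp add: add_pos_nonneg)
  show "D \<mu> k \<noteq> 0" if "k > 0" "\<mu> > 0"
    using D_ge[OF that] mult_pos_pos[OF \<kappa>(1) 1[OF that]] by auto
qed

lemma D_derivs:
  assumes "k > 0"
  shows "(D \<mu> has_vector_derivative D1 \<mu> k) (at k)" "(D1 \<mu> has_vector_derivative D2 \<mu> k) (at k)"
proof -
  have i: "((\<lambda>k. \<i> * of_real k) has_vector_derivative \<i> * 1) (at k)"
    by (intro derivative_eq_intros has_vector_derivative_of_real) auto
  show "(D \<mu> has_vector_derivative D1 \<mu> k) (at k)"
    unfolding D_def[abs_def] D1_def
    using has_vector_derivative_add[OF i has_vector_derivative_mult_right[OF g_derivs(1)[OF assms]]] by simp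
  show "(D1 \<mu> has_vector_derivative D2 \<mu> k) (at k)"
    unfolding D1_def[abs_def] D2_def
    using has_vector_derivative_add[OF has_vector_derivative_const has_vector_derivative_mult_right[OF g_derivs(2)[OF assms]]]
    by simp
qed

lemma D_continuous: "continuous_on {0<..} (D \<mu>)" "continuous_on {0<..} (D1 \<mu>)" "continuous_on {0<..} (D2 \<mu>)"
  unfolding D_def[abs_def] D1_def[abs_def] D2_def[abs_def] by (intro continuous_intros g_continuous)+

lemma D1_le: "\<mu> > 0 \<Longrightarrow> cmod (D1 \<mu> k) \<le> \<mu> * (cmod (g1 k) + 1 / \<mu>)"
  unfolding D1_def using norm_triangle_ineq[of \<i> "of_real \<mu> * g1 k"] by (simp add: norm_mult algebra_simps)

lemma W_bound:
  assumes "k > 0" "\<mu> > 0" and "cmod x \<le> \<mu> * (2 * (1 + K) / \<kappa>) * (cmod (of_real k * g2 k) + cmod (g1 k) + 1 / \<mu>)"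
  shows "cmod (x / (D \<mu> k)\<^sup>2) \<le> A * \<mu> * W \<mu> k"
proof -
  define n where "n = cmod (of_real k * g2 k) + cmod (g1 k) + 1 / \<mu>"
  define e where "e = k + \<mu> * cmod (g k)"
  have e: "e > 0" and D: "\<kappa> * e \<le> cmod (D \<mu> k)" using D_pos(1) D_ge assms by (auto simp: e_def)
  have n: "n \<ge> 0" using assms by (simp add: n_def)
  have x: "cmod x \<le> \<mu> * (2 * (1 + K) / \<kappa>) * n" using assms(3) by (simp add: n_def)
  have sq: "(\<kappa> * e)\<^sup>2 \<le> (cmod (D \<mu> k))\<^sup>2" using D e \<kappa> by (intro power_mono) auto
  have "cmod (x / (D \<mu> k)\<^sup>2) = cmod x / (cmod (D \<mu> k))\<^sup>2" by (simp add: norm_divide norm_power)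
  also have "\<dots> \<le> (\<mu> * (2 * (1 + K) / \<kappa>) * n) / (\<kappa> * e)\<^sup>2"
    using x sq e \<kappa> K n assms(2) by (intro frac_le) auto
  also have "\<dots> = A * \<mu> * (n / e\<^sup>2)" using \<kappa> e by (simp add: A_def power2_eq_square power3_eq_cube mult_ac)
  finally show ?thesis by (simp add: W_def n_def e_def)
qed

text \<open>On the axis z = i k and the complex derivative is - i times the k-derivative, so z d/dz
  becomes k d/dk and the factors i cancel in the limit of \<open>zH1\<close>.\<close>

lemma D_limits:
  assumes k: "k > 0" and \<mu>: "\<mu> > 0"
  shows "((\<lambda>a. - H \<mu> (Complex a k)) \<longlongrightarrow> - inverse (D \<mu> k)) (at_right 0)"
    "((\<lambda>a. zH1 \<mu> (Complex a k)) \<longlongrightarrow> (D \<mu> k - of_real k * D1 \<mu> k) / (D \<mu> k)\<^sup>2) (at_right 0)"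
proof -
  note nz = D_pos(2)[OF k \<mu>]
  have ik: "Complex 0 k = \<i> * of_real k" by (simp add: complex_eq_iff)
  have d: "((\<lambda>a. d \<mu> (Complex a k)) \<longlongrightarrow> D \<mu> k) (at_right 0)"
    unfolding d_def D_def ik[symmetric] by (intro tendsto_intros Complex_limit g_limit k)
  have "((\<lambda>a. d1 \<mu> (Complex a k)) \<longlongrightarrow> 1 + of_real \<mu> * (- \<i> * g1 k)) (at_right 0)"
    unfolding d1_def by (intro tendsto_add tendsto_mult tendsto_const g1_limit k)
  also have "1 + of_real \<mu> * (- \<i> * g1 k) = - \<i> * D1 \<mu> k" by (simp add: D1_def algebra_simps)
  finally have d1: "((\<lambda>a. d1 \<mu> (Complex a k)) \<longlongrightarrow> - \<i> * D1 \<mu> k) (at_right 0)" .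
  show "((\<lambda>a. - H \<mu> (Complex a k)) \<longlongrightarrow> - inverse (D \<mu> k)) (at_right 0)"
    unfolding H_def by (intro tendsto_minus tendsto_inverse d nz)
  have "((\<lambda>a. zH1 \<mu> (Complex a k)) \<longlongrightarrow> inverse (D \<mu> k) + Complex 0 k * (- (- \<i> * D1 \<mu> k) / (D \<mu> k)\<^sup>2)) (at_right 0)"
    unfolding zH1_def H_def H1_def
    by (intro tendsto_add tendsto_mult tendsto_divide tendsto_minus tendsto_inverse tendsto_power d d1 Complex_limit) (use nz in auto)
  also have "inverse (D \<mu> k) + Complex 0 k * (- (- \<i> * D1 \<mu> k) / (D \<mu> k)\<^sup>2) = (D \<mu> k - of_real k * D1 \<mu> k) / (D \<mu> k)\<^sup>2"
    unfolding ik using nz by (simp add: divide_simps power2_eq_square) (simp add: algebra_simps)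
  finally show "((\<lambda>a. zH1 \<mu> (Complex a k)) \<longlongrightarrow> (D \<mu> k - of_real k * D1 \<mu> k) / (D \<mu> k)\<^sup>2) (at_right 0)" .
qed

text \<open>The k-derivative of (D - k D1) / D^2, arranged so that the quotient (D - k D1) / D,
  which is bounded uniformly in \<mu>, stands apart.\<close>

definition "\<gamma>2' \<mu> k = (- (of_real k * D2 \<mu> k) - 2 * (D \<mu> k - of_real k * D1 \<mu> k) * D1 \<mu> k / D \<mu> k) / (D \<mu> k)\<^sup>2"

lemma \<gamma>_derivs:
  assumes k: "k > 0" and \<mu>: "\<mu> > 0"
  shows "((\<lambda>k. - inverse (D \<mu> k)) has_vector_derivative D1 \<mu> k / (D \<mu> k)\<^sup>2) (at k)"
    "((\<lambda>k. (D \<mu> k - of_real k * D1 \<mu> k) / (D \<mu> k)\<^sup>2) has_vector_derivative \<gamma>2' \<mu> k) (at k)"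
proof -
  note nz = D_pos(2)[OF k \<mu>]
  note D = D_derivs(1)[OF k, of \<mu>] and DD = D_derivs(2)[OF k, of \<mu>]
  have inv: "((\<lambda>k. inverse (D \<mu> k)) has_vector_derivative - D1 \<mu> k / (D \<mu> k)\<^sup>2) (at k)"
  proof -
    have "(inverse has_field_derivative - (inverse (D \<mu> k) ^ Suc (Suc 0))) (at (D \<mu> k))" by (rule DERIV_inverse[OF nz])
    from field_vector_diff_chain_at[OF D this] show ?thesis
      by (simp add: o_def power2_eq_square divide_inverse)
  qed
  from has_vector_derivative_minus[OF inv]
  show "((\<lambda>k. - inverse (D \<mu> k)) has_vector_derivative D1 \<mu> k / (D \<mu> k)\<^sup>2) (at k)" by simp
  have id: "((\<lambda>k. complex_of_real k) has_vector_derivative 1) (at k)"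
    by (auto intro!: derivative_eq_intros has_vector_derivative_of_real)
  have n: "((\<lambda>k. D \<mu> k - of_real k * D1 \<mu> k) has_vector_derivative - (of_real k * D2 \<mu> k)) (at k)"
    using has_vector_derivative_diff[OF D has_vector_derivative_mult[OF id DD]] by simp
  have sq: "((\<lambda>k. inverse (D \<mu> k) * inverse (D \<mu> k)) has_vector_derivative
      inverse (D \<mu> k) * (- D1 \<mu> k / (D \<mu> k)\<^sup>2) + (- D1 \<mu> k / (D \<mu> k)\<^sup>2) * inverse (D \<mu> k)) (at k)"
    by (rule has_vector_derivative_mult[OF inv inv])
  have eq: "(\<lambda>k. (D \<mu> k - of_real k * D1 \<mu> k) / (D \<mu> k)\<^sup>2)
      = (\<lambda>k. (D \<mu> k - of_real k * D1 \<mu> k) * (inverse (D \<mu> k) * inverse (D \<mu> k)))"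
    by (simp add: divide_inverse power2_eq_square)
  have "(D \<mu> k - of_real k * D1 \<mu> k) * (inverse (D \<mu> k) * (- D1 \<mu> k / (D \<mu> k)\<^sup>2) + (- D1 \<mu> k / (D \<mu> k)\<^sup>2) * inverse (D \<mu> k))
      + - (of_real k * D2 \<mu> k) * (inverse (D \<mu> k) * inverse (D \<mu> k)) = \<gamma>2' \<mu> k"
  proof -
    have "n * (inverse x * (- y / x\<^sup>2) + (- y / x\<^sup>2) * inverse x) + - e * (inverse x * inverse x) = (- e - 2 * n * y / x) / x\<^sup>2"
      for n x y e :: complex
      by (simp add: divide_inverse power2_eq_square algebra_simps)
    then show ?thesis unfolding \<gamma>2'_def by blast
  qed
  with has_vector_derivative_mult[OF n sq]
  show "((\<lambda>k. (D \<mu> k - of_real k * D1 \<mu> k) / (D \<mu> k)\<^sup>2) has_vector_derivative \<gamma>2' \<mu> k) (at k)"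
    unfolding eq by simp
qed

lemma \<gamma>_continuous:
  assumes \<mu>: "\<mu> > 0"
  shows "continuous_on {0<..} (\<lambda>k. D1 \<mu> k / (D \<mu> k)\<^sup>2)" "continuous_on {0<..} (\<gamma>2' \<mu>)"
  unfolding \<gamma>2'_def[abs_def]
  by (intro continuous_intros D_continuous; use D_pos(2)[OF _ \<mu>] in auto)+

text \<open>In D - k D1 the terms i k cancel and \<mu> (g - k g1) remains. First-order regularity
  and \<open>D_ge\<close> bound it by a multiple of |D|, which reduces both derivatives to terms of
  the weight \<open>W\<close>.\<close>

lemma \<gamma>_bounds:
  assumes k: "k > 0" and \<mu>: "\<mu> > 0"
  shows "cmod (D1 \<mu> k / (D \<mu> k)\<^sup>2) \<le> A * \<mu> * W \<mu> k" "cmod (\<gamma>2' \<mu> k) \<le> A * \<mu> * W \<mu> k"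
proof -
  define c where "c = 2 * (1 + K) / \<kappa>"
  have c: "c \<ge> 1" using K \<kappa> by (simp add: c_def le_divide_eq)
  define n where "n = cmod (g1 k) + 1 / \<mu>"
  have n0: "n \<ge> 0" using \<mu> by (simp add: n_def)
  have D1: "cmod (D1 \<mu> k) \<le> \<mu> * n" using D1_le[OF \<mu>] by (simp add: n_def)
  have q0: "0 \<le> cmod (of_real k * g2 k)" by simp
  have le: "\<mu> * (cmod (of_real k * g2 k) + c * n) \<le> \<mu> * c * (cmod (of_real k * g2 k) + cmod (g1 k) + 1 / \<mu>)"
  proof -
    have "cmod (of_real k * g2 k) \<le> c * cmod (of_real k * g2 k)" using c q0 mult_right_mono[of 1 c] by fastforce
    then have "\<mu> * (cmod (of_real k * g2 k) + c * n) \<le> \<mu> * (c * cmod (of_real k * g2 k) + c * n)"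
      using \<mu> by (intro mult_left_mono) auto
    then show ?thesis by (simp add: n_def algebra_simps)
  qed
  have "n \<le> cmod (of_real k * g2 k) + c * n" using c n0 mult_right_mono[of 1 c n] q0 by linarith
  then have "cmod (D1 \<mu> k) \<le> \<mu> * (cmod (of_real k * g2 k) + c * n)"
    using D1 \<mu> by (meson less_imp_le mult_left_mono order_trans)
  then show "cmod (D1 \<mu> k / (D \<mu> k)\<^sup>2) \<le> A * \<mu> * W \<mu> k"
    using le by (intro W_bound[OF k \<mu>]) (simp add: c_def)
  have nz: "cmod (D \<mu> k) > 0" using D_pos(2)[OF k \<mu>] by simp
  have "cmod (D \<mu> k - of_real k * D1 \<mu> k) = \<mu> * cmod (g k - of_real k * g1 k)"
  proof -
    have "D \<mu> k - of_real k * D1 \<mu> k = of_real \<mu> * (g k - of_real k * g1 k)" by (simp add: D_def D1_def algebra_simps)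
    then show ?thesis using \<mu> by (simp add: norm_mult)
  qed
  also have "\<dots> \<le> \<mu> * ((1 + K) * cmod (g k))"
  proof (intro mult_left_mono)
    have "cmod (g k - of_real k * g1 k) \<le> cmod (g k) + k * cmod (g1 k)"
      using norm_triangle_ineq4[of "g k" "of_real k * g1 k"] k by (simp add: norm_mult)
    then show "cmod (g k - of_real k * g1 k) \<le> (1 + K) * cmod (g k)"
      using g_sector(3)[OF k] by (simp add: algebra_simps)
  qed (use \<mu> in simp)
  also have "\<dots> = (1 + K) * (\<mu> * cmod (g k))" by simp
  also have "\<dots> \<le> (1 + K) * (cmod (D \<mu> k) / \<kappa>)"
  proof (intro mult_left_mono)
    have "\<kappa> * (\<mu> * cmod (g k)) \<le> \<kappa> * (k + \<mu> * cmod (g k))" using \<kappa> k by simp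
    then show "\<mu> * cmod (g k) \<le> cmod (D \<mu> k) / \<kappa>" using D_ge[OF k \<mu>] \<kappa> by (simp add: field_simps)
  qed (use K in simp)
  finally have E: "2 * cmod (D \<mu> k - of_real k * D1 \<mu> k) / cmod (D \<mu> k) \<le> c"
    using nz \<kappa> by (simp add: c_def field_simps)
  have "cmod (- (of_real k * D2 \<mu> k) - 2 * (D \<mu> k - of_real k * D1 \<mu> k) * D1 \<mu> k / D \<mu> k)
      \<le> cmod (of_real k * D2 \<mu> k) + 2 * cmod (D \<mu> k - of_real k * D1 \<mu> k) / cmod (D \<mu> k) * cmod (D1 \<mu> k)"
  proof -
    have "cmod (- e - 2 * n * y / x) \<le> cmod e + 2 * cmod n / cmod x * cmod y" for e n y x
      using norm_triangle_ineq4[of "- e" "2 * n * y / x"] by (simp add: norm_mult norm_divide)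
    then show ?thesis by blast
  qed
  also have "\<dots> \<le> \<mu> * cmod (of_real k * g2 k) + c * (\<mu> * n)"
  proof (intro add_mono mult_mono E D1)
    show "cmod (of_real k * D2 \<mu> k) \<le> \<mu> * cmod (of_real k * g2 k)" using \<mu> by (simp add: D2_def norm_mult)
  qed (use c in auto)
  also have "\<dots> = \<mu> * (cmod (of_real k * g2 k) + c * n)" by (simp add: algebra_simps)
  also note le
  finally show "cmod (\<gamma>2' \<mu> k) \<le> A * \<mu> * W \<mu> k"
    unfolding \<gamma>2'_def by (intro W_bound[OF k \<mu>]) (simp add: c_def)
qed

text \<open>The factor \<mu> in front of \<open>W\<close> lowers the exponent 1 + 1/\<rho> of the
  kernel condition to 1/\<rho>.\<close>

lemma nn_integral_W_le:
  assumes \<mu>: "\<mu> > 0" and C: "C > 0"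
    and nn: "(\<integral>\<^sup>+k\<in>{0<..}. ennreal ((cmod (of_real (k\<^sup>2) * g3 k) + cmod (of_real k * g2 k) + cmod (g1 k) + 1 / \<mu>)
        / (\<bar>k\<bar> + \<mu> * cmod (g k))\<^sup>2) \<partial>lebesgue) \<le> ennreal (C / \<mu> powr (1 + 1 / \<rho>))"
    and f: "\<And>k. k > 0 \<Longrightarrow> cmod (f k) \<le> A * \<mu> * W \<mu> k"
  shows "(\<integral>\<^sup>+k\<in>{0<..}. ennreal (cmod (f k)) \<partial>lebesgue) \<le> ennreal (A * C / \<mu> powr (1 / \<rho>))"
proof -
  have "continuous_on {0<..} (W \<mu>)"
    unfolding W_def[abs_def] by (intro continuous_intros g_continuous) (use D_pos(1)[OF _ \<mu>] in fastforce)
  then have "(\<lambda>k. indicator {0<..} k *\<^sub>R W \<mu> k) \<in> borel_measurable borel"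
    by (intro borel_measurable_continuous_on_indicator) auto
  then have "(\<lambda>k. ennreal (indicator {0<..} k *\<^sub>R W \<mu> k)) \<in> borel_measurable borel"
    by (rule measurable_compose[OF _ measurable_ennreal])
  then have m: "(\<lambda>k. ennreal (indicator {0<..} k *\<^sub>R W \<mu> k)) \<in> borel_measurable lebesgue"
    by (intro measurable_completion) simp
  have "(\<integral>\<^sup>+k\<in>{0<..}. ennreal (cmod (f k)) \<partial>lebesgue) \<le> (\<integral>\<^sup>+k. ennreal (A * \<mu>) * ennreal (indicator {0<..} k *\<^sub>R W \<mu> k) \<partial>lebesgue)"
  proof (rule nn_integral_mono)
    fix k :: real
    show "ennreal (cmod (f k)) * indicator {0<..} k \<le> ennreal (A * \<mu>) * ennreal (indicator {0<..} k *\<^sub>R W \<mu> k)"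
      using f[of k] A_pos \<mu> by (cases "k > 0") (auto simp: ennreal_mult'[symmetric] intro!: ennreal_leI)
  qed
  also have "\<dots> = ennreal (A * \<mu>) * (\<integral>\<^sup>+k. ennreal (indicator {0<..} k *\<^sub>R W \<mu> k) \<partial>lebesgue)"
    by (rule nn_integral_cmult[OF m])
  also have "\<dots> \<le> ennreal (A * \<mu>) * ennreal (C / \<mu> powr (1 + 1 / \<rho>))"
  proof (rule mult_left_mono[OF order_trans[OF nn_integral_mono nn]])
    fix k :: real
    show "ennreal (indicator {0<..} k *\<^sub>R W \<mu> k) \<le> ennreal ((cmod (of_real (k\<^sup>2) * g3 k) + cmod (of_real k * g2 k) + cmod (g1 k) + 1 / \<mu>)
        / (\<bar>k\<bar> + \<mu> * cmod (g k))\<^sup>2) * indicator {0<..} k"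
      unfolding W_def by (cases "k > 0") (auto intro!: ennreal_leI divide_right_mono)
  qed simp
  also have "\<dots> = ennreal (A * C / \<mu> powr (1 / \<rho>))"
    using \<mu> A_pos C by (simp add: ennreal_mult[symmetric] powr_add)
  finally show ?thesis .
qed

text \<open>The constant of the first bound in \<open>inversion_bounds\<close> for C = 5 L^3, a
  value large enough for both H' and (z H)''.\<close>

definition "C0 = exp 1 * (5 * L ^ 3) / 2"

lemma C0_pos: "C0 > 0" using L by (simp add: C0_def)

lemma scalar_bounds:
  assumes \<mu>: "\<mu> > 0" and C: "C > 0" and loc: "locally_L1 b"
    and nn: "(\<integral>\<^sup>+k\<in>{0<..}. ennreal ((cmod (of_real (k\<^sup>2) * g3 k) + cmod (of_real k * g2 k) + cmod (g1 k) + 1 / \<mu>)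
        / (\<bar>k\<bar> + \<mu> * cmod (g k))\<^sup>2) \<partial>lebesgue) \<le> ennreal (C / \<mu> powr (1 + 1 / \<rho>))"
    and u: "scalar_resolvent b \<mu> u" and t: "t > 0"
  shows "\<bar>u t\<bar> \<le> C0" "t * \<bar>u t\<bar> \<le> A * C / \<mu> powr (1 / \<rho>)"
    "(u has_real_derivative - \<mu> * conv b u t) (at t)"
    "t * \<bar>- \<mu> * conv b u t\<bar> \<le> C0" "t\<^sup>2 * \<bar>- \<mu> * conv b u t\<bar> \<le> A * C / \<mu> powr (1 / \<rho>)"
    "\<bar>- \<mu> * conv b u t\<bar> \<le> C0 * \<mu> * L1_norm_upto b t"
proof -
  obtain w M where w: "w > 0" and M: "M > 0"
    and du: "\<And>t. t > 0 \<Longrightarrow> (u has_real_derivative - \<mu> * conv b u t) (at t)"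
    and cu: "continuous_on {0<..} u" and cv: "continuous_on {0<..} (\<lambda>t. - \<mu> * conv b u t)"
    and ub: "\<And>t. t > 0 \<Longrightarrow> \<bar>u t\<bar> \<le> M * exp (w * t)"
    and vb: "\<And>t. t > 0 \<Longrightarrow> \<bar>- \<mu> * conv b u t\<bar> \<le> M * exp (w * t)"
    and Lu: "\<And>z. Re z > w \<Longrightarrow> laplace u z * (z + \<mu> * laplace b z) = 1"
    and Lv: "\<And>z. Re z > w \<Longrightarrow> laplace (\<lambda>t. - \<mu> * conv b u t) z = z * laplace u z - 1"
    using scalar_resolvent_transform[OF la u \<mu>] by blast
  define v where "v t = - \<mu> * conv b u t" for t
  note du = du[folded v_def] and cv = cv[folded v_def] and vb = vb[folded v_def] and Lv = Lv[folded v_def]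
  have mes: "f \<in> borel_measurable (restrict_space lebesgue {0<..})" if "continuous_on {0<..} f" for f :: "real \<Rightarrow> real"
    by (rule continuous_imp_measurable_on_sets_lebesgue[OF that]) simp
  have La: "laplace_abs u w" "laplace_abs v w"
    using laplace_abs_of_bound[OF mes[OF cu] ub] laplace_abs_of_bound[OF mes[OF cv] vb] by auto
  have op: "open {z. w < Re z}" by (rule open_halfspace_Re_gt)
  \<comment> \<open>Transforms agreeing on the open half-plane Re z > w have equal derivatives
    there, and each factor t is one derivative with a minus sign.\<close>
  have uniq: "laplace (\<lambda>t. t * f t) z = - F' z"
    if "laplace_abs f w" "\<And>z. Re z > w \<Longrightarrow> laplace f z = F z" "\<And>z. Re z > w \<Longrightarrow> (F has_field_derivative F' z) (at z)" "Re z > w"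
    for f F F' z
  proof -
    have "(laplace f has_field_derivative F' z) (at z)"
      by (rule has_field_derivative_transform_within_open[OF that(3)[OF that(4)] op]) (use that in auto)
    from DERIV_unique[OF this laplace_has_field_derivative[OF that(1,4)]] show ?thesis by simp
  qed
  have LuH: "laplace u z = H \<mu> z" if z: "Re z > w" for z
    using Lu[OF z] d_bounds(1)[of z \<mu>] z w \<mu> by (simp add: H_def d_def field_simps)
  have LvH: "laplace v z = z * H \<mu> z - 1" if z: "Re z > w" for z
    using Lv[OF z] LuH[OF z] by simp
  have Re0: "Re z > 0" if "Re z > w" for z using that w by simp
  have L1: "laplace (\<lambda>t. t * u t) z = - H1 \<mu> z" if "Re z > w" for z
    by (rule uniq[OF La(1) LuH H_derivs(1)[OF Re0 \<mu>] that])
  have dz: "((\<lambda>z. z * H \<mu> z - 1) has_field_derivative zH1 \<mu> z) (at z)" if "Re z > w" for z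
    using DERIV_diff[OF zH_derivs(1)[OF Re0[OF that] \<mu>] DERIV_const] by simp
  have Lv1: "laplace (\<lambda>t. t * v t) z = - zH1 \<mu> z" if "Re z > w" for z
    by (rule uniq[OF La(2) LvH dz that])
  have L2: "laplace (\<lambda>t. t * (t * v t)) z = zH2 \<mu> z" if "Re z > w" for z
    using uniq[OF laplace_abs_times[OF La(2)] Lv1 DERIV_minus[OF zH_derivs(2)[OF Re0 \<mu>]] that] by simp
  \<comment> \<open>A factor t raises the admissible growth rate by one. This does no harm, as the
    rate is absent from the conclusions of \<open>inversion_bounds\<close>.\<close>
  have texp: "t * (M * exp (w' * t)) \<le> M * exp ((w' + 1) * t)" if "t > 0" for t w'
  proof -
    have "t \<le> exp t" using exp_ge_add_one_self[of t] by linarith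
    then have "t * (M * exp (w' * t)) \<le> exp t * (M * exp (w' * t))" using M by (intro mult_right_mono) auto
    then show ?thesis by (simp add: exp_add algebra_simps)
  qed
  have hb: "cmod (H \<mu> z) \<le> 5 * L ^ 3 / cmod z" "cmod (H1 \<mu> z) \<le> 5 * L ^ 3 / (cmod z)\<^sup>2" if "Re z > 0" for z
  proof -
    have z: "cmod z > 0" using that by (auto simp: complex_eq_iff)
    have "L \<le> 5 * L ^ 3" using L_powers(3,4) by linarith
    moreover have "L\<^sup>2 \<le> 5 * L ^ 3" using L_powers(3,5) by linarith
    ultimately have le: "L / cmod z \<le> 5 * L ^ 3 / cmod z" "L\<^sup>2 / (cmod z)\<^sup>2 \<le> 5 * L ^ 3 / (cmod z)\<^sup>2"
      by (auto intro!: divide_right_mono)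
    show "cmod (H \<mu> z) \<le> 5 * L ^ 3 / cmod z" by (rule order_trans[OF H_bounds(1)[OF that \<mu>] le(1)])
    show "cmod (H1 \<mu> z) \<le> 5 * L ^ 3 / (cmod z)\<^sup>2" by (rule order_trans[OF H_bounds(2)[OF that \<mu>] le(2)])
  qed
  have B: "0 \<le> A * C / \<mu> powr (1 / \<rho>)" using A_pos C by simp
  have Bpi: "A * C / \<mu> powr (1 / \<rho>) / pi \<le> A * C / \<mu> powr (1 / \<rho>)"
  proof -
    have "x / pi \<le> x" if "0 \<le> x" for x using mult_left_mono[of 1 pi x] that pi_gt3 by (simp add: divide_le_eq)
    from this[OF B] show ?thesis .
  qed
  have hol: "(\<lambda>z. - H1 \<mu> z) holomorphic_on {z. 0 < Re z}" "zH2 \<mu> holomorphic_on {z. 0 < Re z}"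
  proof -
    have "H1 \<mu> holomorphic_on {z. 0 < Re z}"
      by (rule derivative_is_holomorphic[OF open_halfspace_Re_gt H_derivs(1)[OF _ \<mu>]]) simp
    then show "(\<lambda>z. - H1 \<mu> z) holomorphic_on {z. 0 < Re z}" by (rule holomorphic_on_minus)
    show "zH2 \<mu> holomorphic_on {z. 0 < Re z}"
      by (rule derivative_is_holomorphic[OF open_halfspace_Re_gt zH_derivs(2)[OF _ \<mu>]]) simp
  qed
  have w1: "w + 1 > 0" "w + 1 + 1 > 0" using w by auto
  have r1: "\<bar>t * u t\<bar> \<le> exp 1 * (5 * L ^ 3) / 2 * t" "\<bar>t * u t\<bar> \<le> A * C / \<mu> powr (1 / \<rho>) / pi" if t: "t > 0" for t
  proof (atomize (full), rule conjI)
    have fb: "\<bar>t * u t\<bar> \<le> M * exp ((w + 1) * t)" if "t > 0" for t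
    proof -
      have "\<bar>t * u t\<bar> = t * \<bar>u t\<bar>" using that by (simp add: abs_mult)
      also have "\<dots> \<le> t * (M * exp (w * t))" using that ub[OF that] by (intro mult_left_mono) auto
      also have "\<dots> \<le> M * exp ((w + 1) * t)" by (rule texp[OF that])
      finally show ?thesis .
    qed
    have LF: "laplace (\<lambda>t. t * u t) z = - H1 \<mu> z" if "Re z > w + 1" for z using L1 that by simp
    have cf: "continuous_on {0<..} (\<lambda>t. t * u t)" by (intro continuous_intros cu)
    have G: "((\<lambda>z. - H \<mu> z) has_field_derivative - H1 \<mu> z) (at z)" if "Re z > 0" for z
      by (rule DERIV_minus[OF H_derivs(1)[OF that \<mu>]])
    have bF: "cmod (- H1 \<mu> z) \<le> 5 * L ^ 3 / (cmod z)\<^sup>2" and bG: "cmod (- H \<mu> z) \<le> 5 * L ^ 3 / cmod z" if "Re z > 0" for z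
      using hb[OF that] by auto
    have c: "- H1 \<mu> (cnj z) = cnj (- H1 \<mu> z)" for z by (simp add: H_cnj)
    \<comment> \<open>Here F = - H' has the primitive - H with boundary values - 1 / D; for t^2 u'
      the pair is (z H)'' and (z H)'.\<close>
    note r = inversion_bounds[OF cf fb w1(1) LF hol(1) G bF bG c D_limits(1)[OF _ \<mu>] \<gamma>_derivs(1)[OF _ \<mu>]
        \<gamma>_continuous(1)[OF \<mu>] B nn_integral_W_le[OF \<mu> C nn \<gamma>_bounds(1)[OF _ \<mu>]] t]
    show "\<bar>t * u t\<bar> \<le> exp 1 * (5 * L ^ 3) / 2 * t" by (rule r(1))
    show "\<bar>t * u t\<bar> \<le> A * C / \<mu> powr (1 / \<rho>) / pi" by (rule r(2))
  qed
  have r2: "\<bar>t * (t * v t)\<bar> \<le> exp 1 * (5 * L ^ 3) / 2 * t" "\<bar>t * (t * v t)\<bar> \<le> A * C / \<mu> powr (1 / \<rho>) / pi" if t: "t > 0" for t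
  proof (atomize (full), rule conjI)
    have fb: "\<bar>t * (t * v t)\<bar> \<le> M * exp ((w + 1 + 1) * t)" if "t > 0" for t
    proof -
      have "\<bar>t * (t * v t)\<bar> = t * (t * \<bar>v t\<bar>)" using that by (simp add: abs_mult)
      also have "\<dots> \<le> t * (t * (M * exp (w * t)))" using that vb[OF that] by (intro mult_left_mono) auto
      also have "\<dots> \<le> t * (M * exp ((w + 1) * t))" using that texp[OF that, of w] by (intro mult_left_mono) auto
      also have "\<dots> \<le> M * exp ((w + 1 + 1) * t)" by (rule texp[OF that])
      finally show ?thesis .
    qed
    have LF: "laplace (\<lambda>t. t * (t * v t)) z = zH2 \<mu> z" if "Re z > w + 1 + 1" for z using L2 that by simp
    have cf: "continuous_on {0<..} (\<lambda>t. t * (t * v t))" by (intro continuous_intros cv[folded v_def])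
    have c: "zH2 \<mu> (cnj z) = cnj (zH2 \<mu> z)" for z by (simp add: H_cnj zH2_def)
    note r = inversion_bounds[OF cf fb w1(2) LF hol(2) zH_derivs(2)[OF _ \<mu>] zH_bounds(2,1)[OF _ \<mu>] c D_limits(2)[OF _ \<mu>]
        \<gamma>_derivs(2)[OF _ \<mu>] \<gamma>_continuous(2)[OF \<mu>] B nn_integral_W_le[OF \<mu> C nn \<gamma>_bounds(2)[OF _ \<mu>]] t]
    show "\<bar>t * (t * v t)\<bar> \<le> exp 1 * (5 * L ^ 3) / 2 * t" by (rule r(1))
    show "\<bar>t * (t * v t)\<bar> \<le> A * C / \<mu> powr (1 / \<rho>) / pi" by (rule r(2))
  qed
  have ubound: "\<bar>u t\<bar> \<le> C0" if "t > 0" for t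
    using r1(1)[OF that] that by (simp add: abs_mult C0_def)
  then show "\<bar>u t\<bar> \<le> C0" using t .
  show "t * \<bar>u t\<bar> \<le> A * C / \<mu> powr (1 / \<rho>)"
    using r1(2)[OF t] Bpi t by (simp only: abs_mult abs_of_pos)
  show "(u has_real_derivative - \<mu> * conv b u t) (at t)" using du[OF t] by (simp add: v_def)
  have "t * \<bar>v t\<bar> \<le> C0" using r2(1)[OF t] t by (simp add: abs_mult C0_def)
  then show "t * \<bar>- \<mu> * conv b u t\<bar> \<le> C0" by (simp add: v_def)
  have "t\<^sup>2 * \<bar>v t\<bar> \<le> A * C / \<mu> powr (1 / \<rho>)"
    using r2(2)[OF t] Bpi t by (simp only: abs_mult abs_of_pos power2_eq_square mult.assoc)
  then show "t\<^sup>2 * \<bar>- \<mu> * conv b u t\<bar> \<le> A * C / \<mu> powr (1 / \<rho>)" by (simp add: v_def)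
  have "\<bar>conv b u t\<bar> \<le> C0 * L1_norm_upto b t"
    by (rule conv_L1_bound[OF loc _ t]) (rule ubound)
  from mult_left_mono[OF this, of \<mu>] show "\<bar>- \<mu> * conv b u t\<bar> \<le> C0 * \<mu> * L1_norm_upto b t"
    using \<mu> by (simp add: abs_mult mult_ac)
qed

end

section \<open>Growth of positive real functions\<close>

text \<open>The Schwarz lemma, transported to the half-plane by Cayley transforms in the domain and the range.\<close>

lemma positive_real_growth:
  assumes f: "f holomorphic_on {z. 0 < Re z}" and pos: "\<And>z. 0 < Re z \<Longrightarrow> 0 \<le> Re (f z)"
    and real: "\<And>x. x > 0 \<Longrightarrow> f (of_real x) = of_real (\<phi> x)" and x: "0 < x" "x \<le> 1"
  shows "\<phi> x \<le> \<phi> 1 / x"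
proof (rule field_le_epsilon)
  fix \<epsilon> :: real assume \<epsilon>: "\<epsilon> > 0"
  \<comment> \<open>The shift makes the real part strictly positive, as the Cayley transform in the
    range needs. At the end it is divided by x, hence the factor x.\<close>
  define \<delta> where "\<delta> = \<epsilon> * x"
  have \<delta>: "\<delta> > 0" using \<epsilon> x by (simp add: \<delta>_def)
  define h where "h z = f z + of_real \<delta>" for z
  define c where "c = \<phi> 1 + \<delta>"
  define C where "C w = (1 + w) / (1 - w)" for w :: complex
  \<comment> \<open>Centring the second Cayley transform at c = h 1 gives \<psi> 0 = 0, since
    \<open>C\<close> maps 0 to 1.\<close>
  define \<psi> where "\<psi> w = (h (C w) - of_real c) / (h (C w) + of_real c)" for w
  have "0 \<le> Re (f 1)" by (rule pos) simp
  then have "\<phi> 1 \<ge> 0" using real[of 1] by simp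
  then have c: "c > 0" using \<delta> by (simp add: c_def)
  have hpos: "0 < Re (h z)" if "0 < Re z" for z using pos[OF that] \<delta> by (simp add: h_def)
  have C: "0 < Re (C w)" if w: "norm w < 1" for w
  proof -
    have ne: "1 - w \<noteq> 0" using w by auto
    have "Re (C w) = (1 - (cmod w)\<^sup>2) / (cmod (1 - w))\<^sup>2"
      unfolding C_def Re_divide' cmod_power2 by (simp add: power2_eq_square algebra_simps)
    moreover have "(cmod w)\<^sup>2 < 1" using w by (simp add: power_less_one_iff abs_square_less_1)
    ultimately show ?thesis using ne by simp
  qed
  have ne: "h (C w) + of_real c \<noteq> 0" if "norm w < 1" for w
  proof
    assume "h (C w) + of_real c = 0"
    then have "Re (h (C w)) + c = 0" by (metis Re_complex_of_real plus_complex.sel(1) zero_complex.sel(1))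
    with hpos[OF C[OF that]] c show False by simp
  qed
  have hC: "(\<lambda>w. h (C w)) holomorphic_on ball 0 1"
  proof -
    have "C holomorphic_on ball 0 1" unfolding C_def[abs_def] by (intro holomorphic_intros) auto
    moreover have "h holomorphic_on {z. 0 < Re z}" unfolding h_def[abs_def] by (intro holomorphic_intros f)
    moreover have "C ` ball 0 1 \<subseteq> {z. 0 < Re z}" using C by auto
    ultimately show ?thesis using holomorphic_on_compose_gen[of C "ball 0 1" h] by (simp add: o_def)
  qed
  have \<psi>: "\<psi> holomorphic_on ball 0 1"
    unfolding \<psi>_def[abs_def] by (intro holomorphic_intros hC) (use ne in auto)
  have \<psi>0: "\<psi> 0 = 0" using real[of 1] by (simp add: \<psi>_def C_def h_def c_def)
  have \<psi>1: "norm (\<psi> w) < 1" if "norm w < 1" for w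
  proof -
    have "(cmod (h (C w) - of_real c))\<^sup>2 < (cmod (h (C w) + of_real c))\<^sup>2"
      using mult_pos_pos[OF hpos[OF C[OF that]] c] unfolding cmod_power2 by (simp add: power2_eq_square algebra_simps)
    then have "cmod (h (C w) - of_real c) < cmod (h (C w) + of_real c)" by (rule power2_less_imp_less) simp
    then show ?thesis unfolding \<psi>_def norm_divide using ne[OF that] by simp
  qed
  define y where "y = \<phi> x + \<delta>"
  \<comment> \<open>The preimage of x under \<open>C\<close>, a point of modulus (1 - x) / (1 +
    x).\<close>
  define w0 where "w0 = (x - 1) / (x + 1)"
  have w0: "\<bar>w0\<bar> = (1 - x) / (1 + x)" using x by (simp add: w0_def abs_divide)
  have w01: "norm (complex_of_real w0) < 1" unfolding norm_of_real w0 using x by simp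
  have "1 - w0 = 2 / (x + 1)" "1 + w0 = 2 * x / (x + 1)" using x by (auto simp: w0_def field_simps)
  then have "(1 + w0) / (1 - w0) = x" using x by simp
  moreover have "C (of_real w0) = of_real ((1 + w0) / (1 - w0))" by (simp add: C_def)
  ultimately have C0: "C (of_real w0) = of_real x" by simp
  have "h (C (of_real w0)) = of_real y" unfolding C0 using real[OF x(1)] by (simp add: h_def y_def)
  then have "\<psi> (of_real w0) = of_real ((y - c) / (y + c))" by (simp add: \<psi>_def)
  moreover have "norm (\<psi> (of_real w0)) \<le> norm (complex_of_real w0)" by (rule Schwarz_Lemma(1)[OF \<psi> \<psi>0 \<psi>1 w01])
  ultimately have S: "\<bar>y - c\<bar> / \<bar>y + c\<bar> \<le> (1 - x) / (1 + x)"
    unfolding norm_of_real w0[symmetric] by (simp only: norm_of_real abs_divide)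
  have "0 < Re (h (of_real x))" by (rule hpos) (use x in simp)
  then have y: "y > 0" using real[OF x(1)] by (simp add: h_def y_def)
  \<comment> \<open>The increasing function (y - c) / (y + c) takes the value (1 - x) / (1 + x) at y
    = c / x, so the Schwarz bound amounts to y x <= c.\<close>
  have "(y - c) / (y + c) \<le> \<bar>y - c\<bar> / (y + c)" using y c by (intro divide_right_mono) auto
  then have "(y - c) / (y + c) \<le> (1 - x) / (1 + x)" using S y c by simp
  then have "(y - c) * (1 + x) \<le> (1 - x) * (y + c)" using y c x by (simp add: divide_le_eq le_divide_eq mult.commute)
  then have "y * x \<le> c" by (simp add: algebra_simps)
  then have "y \<le> c / x" using x by (simp add: field_simps)
  then have "\<phi> x + \<delta> \<le> \<phi> 1 / x + \<epsilon>" using x by (simp add: y_def c_def \<delta>_def add_divide_distrib)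
  then show "\<phi> x \<le> \<phi> 1 / x + \<epsilon>" using \<delta> by simp
qed

lemma laplace_of_real:
  "laplace b (of_real x) = of_real (LINT r:{0<..}|lebesgue. exp (- x * r) * b r)"
proof -
  have "indicator {0<..} r *\<^sub>R (exp (- of_real x * of_real r) * complex_of_real (b r))
      = complex_of_real (indicator {0<..} r *\<^sub>R (exp (- x * r) * b r))" for r
    by (cases "r > 0") (simp_all add: exp_of_real[symmetric])
  then show ?thesis
    unfolding laplace_def set_lebesgue_integral_def by (simp only: integral_complex_of_real)
qed

text \<open>On r < t the weight e exp (- r / t) is at least 1, and for a nonnegative kernel
  extending the integral beyond t only increases it.\<close>

lemma L1_norm_upto_le_laplace:
  assumes b: "laplace_abs b 0" and nonneg: "\<And>r. r > 0 \<Longrightarrow> 0 \<le> b r" and t: "t > 0"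
  shows "L1_norm_upto b t \<le> exp 1 * Re (laplace b (of_real (1 / t)))"
proof -
  have I: "integrable lebesgue (\<lambda>r. exp 1 * (indicator {0<..} r *\<^sub>R (exp (- (1 / t) * r) * b r)))"
    using laplace_absD[OF b, of "1 / t"] t unfolding set_integrable_def by (intro integrable_mult_right) auto
  have "L1_norm_upto b t \<le> (LINT r|lebesgue. exp 1 * (indicator {0<..} r *\<^sub>R (exp (- (1 / t) * r) * b r)))"
    unfolding L1_norm_upto_def set_lebesgue_integral_def
  proof (rule integral_mono'[OF I])
    fix r :: real
    show "indicator {0<..<t} r *\<^sub>R \<bar>b r\<bar> \<le> exp 1 * (indicator {0<..} r *\<^sub>R (exp (- (1 / t) * r) * b r))"
    proof (cases "0 < r \<and> r < t")
      case True
      have "exp 0 \<le> exp (1 + - (1 / t) * r)" unfolding exp_le_cancel_iff using True t by simp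
      then have "1 \<le> exp 1 * exp (- (1 / t) * r)" by (simp only: exp_add exp_zero)
      then have "1 * b r \<le> exp 1 * exp (- (1 / t) * r) * b r" using nonneg[of r] True by (intro mult_right_mono) auto
      then show ?thesis using True nonneg[of r] by (simp add: mult.assoc)
    qed (use nonneg[of r] in \<open>auto simp: indicator_def\<close>)
    show "0 \<le> exp 1 * (indicator {0<..} r *\<^sub>R (exp (- (1 / t) * r) * b r))"
      using nonneg[of r] by (simp add: indicator_def)
  qed
  also have "\<dots> = exp 1 * Re (laplace b (of_real (1 / t)))"
    unfolding laplace_of_real Re_complex_of_real set_lebesgue_integral_def by (rule integral_mult_right_zero)
  finally show ?thesis .
qed

section \<open>Growth of the kernel mass\<close>

context sectorial_kernel
begin

text \<open>Along a segment inside the half-plane, regularity bounds the derivative of b^ by a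
  multiple of b^ itself. By Gronwall a zero at one end would force a zero at the other.\<close>

lemma b0_nonzero:
  assumes z1: "Re z1 > 0" "b0 z1 \<noteq> 0" and z: "Re z > 0"
  shows "b0 z \<noteq> 0"
proof
  assume 0: "b0 z = 0"
  define \<zeta> where "\<zeta> x = z1 + of_real x * (z - z1)" for x :: real
  define r where "r = min (Re z1) (Re z)"
  have r: "r > 0" using z1 z by (simp add: r_def)
  have \<zeta>: "r \<le> Re (\<zeta> x)" if "0 \<le> x" "x \<le> 1" for x
  proof -
    have "(1 - x) * r + x * r \<le> (1 - x) * Re z1 + x * Re z"
      using that by (intro add_mono mult_left_mono) (auto simp: r_def)
    then show ?thesis by (simp add: \<zeta>_def algebra_simps)
  qed
  have "cmod (b0 (\<zeta> 0)) \<le> exp (cmod (z - z1) * (K / r) * (1 - 0)) * cmod (b0 (\<zeta> 1))"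
  proof (rule gronwall_backward[where \<phi>'="\<lambda>x. (z - z1) * b1 (\<zeta> x)"])
    fix x :: real assume x: "0 \<le> x" "x \<le> 1"
    have p: "Re (\<zeta> x) > 0" using \<zeta>[OF x] r by simp
    have "(\<zeta> has_vector_derivative (z - z1)) (at x)"
      unfolding \<zeta>_def[abs_def] by (auto intro!: derivative_eq_intros has_vector_derivative_of_real)
    from field_vector_diff_chain_at[OF this b0_deriv[OF p]]
    show "((\<lambda>x. b0 (\<zeta> x)) has_vector_derivative (z - z1) * b1 (\<zeta> x)) (at x)" by (simp add: o_def)
    have "r \<le> cmod (\<zeta> x)" using \<zeta>[OF x] complex_Re_le_cmod[of "\<zeta> x"] by simp
    then have "r * cmod (b1 (\<zeta> x)) \<le> cmod (\<zeta> x) * cmod (b1 (\<zeta> x))" by (rule mult_right_mono) simp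
    also have "\<dots> \<le> K * cmod (b0 (\<zeta> x))" by (rule b1_le[OF p])
    finally have "cmod (b1 (\<zeta> x)) \<le> K / r * cmod (b0 (\<zeta> x))" using r by (simp add: field_simps)
    then show "cmod ((z - z1) * b1 (\<zeta> x)) \<le> cmod (z - z1) * (K / r) * cmod (b0 (\<zeta> x))"
      unfolding norm_mult mult.assoc by (rule mult_left_mono) simp
  qed simp
  moreover have "\<zeta> 0 = z1" "\<zeta> 1 = z" by (auto simp: \<zeta>_def)
  ultimately show False using 0 z1 by simp
qed

lemma b0_growth:
  assumes \<rho>: "1 < \<rho>" and arg: "\<And>z. Re z > 0 \<Longrightarrow> \<bar>Arg (b0 z)\<bar> \<le> (\<rho> - 1) * (pi / 2)" and \<rho>2: "\<rho> < 2"
    and z1: "Re z1 > 0" "b0 z1 \<noteq> 0" and x: "0 < x" "x \<le> 1"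
  shows "Re (b0 (of_real x)) \<le> Re (b0 1) * x powr (1 - \<rho>)"
proof -
  \<comment> \<open>The power \<open>p\<close> opens the sector containing the values of \<open>b0\<close> to a half-plane.\<close>
  define p where "p = 1 / (\<rho> - 1)"
  have p: "p > 0" "p * (\<rho> - 1) = 1" using \<rho> by (auto simp: p_def)
  have nz: "b0 z \<noteq> 0" if "Re z > 0" for z by (rule b0_nonzero[OF z1 that])
  have Arg_lt: "\<bar>Arg (b0 z)\<bar> < pi / 2" if "Re z > 0" for z
  proof -
    have "(\<rho> - 1) * (pi / 2) < 1 * (pi / 2)" using \<rho>2 by (intro mult_strict_right_mono) auto
    then show ?thesis using arg[OF that] by linarith
  qed
  have Re_pos: "Re (b0 z) > 0" if "Re z > 0" for z
  proof -
    have "Re (b0 z) = cmod (b0 z) * cos (Arg (b0 z))"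
      using Arg_eq[OF nz[OF that]] by (metis Re_complex_of_real Re_rcis mult.commute rcis_def cis_conv_exp)
    moreover have "cos (Arg (b0 z)) > 0" using Arg_lt[OF that] by (auto simp: abs_less_iff intro!: cos_gt_zero_pi)
    ultimately show ?thesis using nz[OF that] by simp
  qed
  \<comment> \<open>The principal power is holomorphic off the closed negative real axis, which is
    avoided because \<rho> < 2 keeps the arguments below pi/2.\<close>
  have notneg: "b0 z \<notin> \<real>\<^sub>\<le>\<^sub>0" if "Re z > 0" for z using Re_pos[OF that] by (auto simp: complex_nonpos_Reals_iff)
  have hb: "b0 holomorphic_on {z. 0 < Re z}"
    by (rule holomorphic_onI) (use has_field_derivative_at_within[OF b0_deriv] in \<open>unfold field_differentiable_def, blast\<close>)
  define \<phi> where "\<phi> x = Re (b0 (of_real x)) powr p" for x :: real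
  have b0r: "b0 (of_real x) = of_real (Re (b0 (of_real x)))" for x :: real unfolding laplace_of_real by simp
  have "\<phi> x \<le> \<phi> 1 / x"
  proof (rule positive_real_growth[where f="\<lambda>z. b0 z powr of_real p"])
    show "(\<lambda>z. b0 z powr of_real p) holomorphic_on {z. 0 < Re z}"
      by (intro holomorphic_on_powr hb holomorphic_on_const) (use notneg in auto)
    show "0 \<le> Re (b0 z powr of_real p)" if "0 < Re z" for z
    proof -
      have "\<bar>p * Arg (b0 z)\<bar> \<le> p * ((\<rho> - 1) * (pi / 2))"
        unfolding abs_mult using p arg[OF that] by (simp add: mult_left_mono)
      also have "\<dots> = pi / 2" using p by (simp add: mult.assoc[symmetric])
      finally have "0 \<le> cos (p * Arg (b0 z))" by (auto simp: abs_le_iff intro!: cos_ge_zero)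
      moreover have "Re (b0 z powr of_real p) = cmod (b0 z) powr p * cos (p * Arg (b0 z))"
        using nz[OF that] by (simp add: powr_def Re_exp Arg_eq_Im_Ln powr_def)
      ultimately show ?thesis by simp
    qed
    show "b0 (of_real x) powr of_real p = of_real (\<phi> x)" if "x > 0" for x
      unfolding \<phi>_def using Re_pos[of "of_real x"] that by (subst b0r) (simp add: powr_of_real)
  qed (use x in auto)
  \<comment> \<open>Raising to \<rho> - 1 = 1/p undoes the opening of the sector and turns the
    factor 1/x of the Schwarz bound into x^(1 - \<rho>).\<close>
  then have "\<phi> x powr (\<rho> - 1) \<le> (\<phi> 1 / x) powr (\<rho> - 1)"
    using \<rho> by (intro powr_mono2) (auto simp: \<phi>_def)
  moreover have "\<phi> y powr (\<rho> - 1) = Re (b0 (of_real y))" if "y > 0" for y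
    using Re_pos[of "of_real y"] that p by (simp add: \<phi>_def powr_powr)
  moreover have "(\<phi> 1 / x) powr (\<rho> - 1) = \<phi> 1 powr (\<rho> - 1) * x powr (1 - \<rho>)"
    using x by (simp add: powr_divide \<phi>_def powr_minus_divide[of x "\<rho> - 1", simplified])
  ultimately show ?thesis using x(1) by fastforce
qed

text \<open>The half-line splits at t = 1: for smaller t the point 1/t is in the range of the
  comparability hypothesis, for larger t \<open>b0_growth\<close> applies. Comparability at the
  point 2 also provides the nonzero value from which \<open>b0_nonzero\<close> starts.\<close>

lemma L1_norm_growth:
  assumes \<rho>: "1 < \<rho>" "\<rho> < 2" and arg: "\<And>z. Re z > 0 \<Longrightarrow> \<bar>Arg (b0 z)\<bar> \<le> (\<rho> - 1) * (pi / 2)"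
    and nonneg: "\<And>r. r > 0 \<Longrightarrow> 0 \<le> b r" and comp: "laplace_comparable b (1 - \<rho>)"
  obtains C where "C > 0" "\<And>t. t > 0 \<Longrightarrow> L1_norm_upto b t \<le> C * t powr (\<rho> - 1)"
proof -
  obtain c C where c: "0 < c" "c \<le> C" and cC: "\<And>x. x > 1 \<Longrightarrow> c * x powr (1 - \<rho>) \<le> Re (b0 (of_real x))"
      "\<And>x. x > 1 \<Longrightarrow> Re (b0 (of_real x)) \<le> C * x powr (1 - \<rho>)"
    using comp unfolding laplace_comparable_def by blast
  have "0 < c * 2 powr (1 - \<rho>)" using c by simp
  also have "\<dots> \<le> Re (b0 (of_real 2))" by (rule cC(1)) simp
  finally have nz: "b0 2 \<noteq> 0" by auto
  define C' where "C' = max C (Re (b0 1))"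
  have C': "C' > 0" using c by (simp add: C'_def)
  show ?thesis
  proof (rule that[of "exp 1 * C'"])
    show "exp 1 * C' > 0" using C' by simp
    fix t :: real assume t: "t > 0"
    have "Re (b0 (of_real (1 / t))) \<le> C' * (1 / t) powr (1 - \<rho>)"
    proof (cases "1 / t > 1")
      case True
      from cC(2)[OF this] have "Re (b0 (of_real (1 / t))) \<le> C * (1 / t) powr (1 - \<rho>)" .
      also have "\<dots> \<le> C' * (1 / t) powr (1 - \<rho>)" by (rule mult_right_mono) (auto simp: C'_def)
      finally show ?thesis .
    next
      case False
      have "Re (b0 (of_real (1 / t))) \<le> Re (b0 1) * (1 / t) powr (1 - \<rho>)"
        by (rule b0_growth[OF \<rho>(1) arg \<rho>(2) _ nz]) (use t False in auto)
      also have "\<dots> \<le> C' * (1 / t) powr (1 - \<rho>)" by (rule mult_right_mono) (auto simp: C'_def)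
      finally show ?thesis .
    qed
    also have "(1 / t) powr (1 - \<rho>) = t powr (\<rho> - 1)"
      using t by (simp add: powr_divide powr_minus_divide[of t "\<rho> - 1", simplified])
    finally have "exp 1 * Re (b0 (of_real (1 / t))) \<le> exp 1 * (C' * t powr (\<rho> - 1))" by simp
    from order_trans[OF L1_norm_upto_le_laplace[OF la nonneg t] this]
    show "L1_norm_upto b t \<le> exp 1 * C' * t powr (\<rho> - 1)" by (simp only: mult.assoc)
  qed
qed

end

section \<open>Diagonal operators\<close>

locale orthonormal_sequence =
  fixes e :: "nat \<Rightarrow> 'h::{real_inner, complete_space}"
  assumes orth: "\<And>i j. inner (e i) (e j) = (if i = j then 1 else 0)"
begin

lemma norm_sum_sq: "finite F \<Longrightarrow> (norm (\<Sum>k\<in>F. a k *\<^sub>R e k))\<^sup>2 = (\<Sum>k\<in>F. (a k)\<^sup>2)"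
proof (induction F rule: finite_induct)
  case (insert x F)
  define y where "y = (\<Sum>k\<in>F. a k *\<^sub>R e k)"
  have "inner (e x) y = (\<Sum>k\<in>F. 0)"
    unfolding y_def inner_sum_right using insert.hyps by (intro sum.cong) (auto simp: orth)
  then have o: "inner (e x) y = 0" "inner y (e x) = 0" by (simp_all add: inner_commute)
  have "(norm (a x *\<^sub>R e x + y))\<^sup>2 = (a x)\<^sup>2 + (norm y)\<^sup>2"
    unfolding power2_norm_eq_inner by (simp add: inner_add_left inner_add_right o orth power2_eq_square)
  then show ?case using insert by (simp add: y_def)
qed simp

lemma bessel_finite: "finite F \<Longrightarrow> (\<Sum>k\<in>F. (inner v (e k))\<^sup>2) \<le> (norm v)\<^sup>2"
proof -
  assume F: "finite F"
  let ?p = "\<Sum>k\<in>F. inner v (e k) *\<^sub>R e k"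
  have "inner v ?p = (\<Sum>k\<in>F. (inner v (e k))\<^sup>2)" by (simp add: inner_sum_right power2_eq_square)
  moreover have "inner ?p ?p = (\<Sum>k\<in>F. (inner v (e k))\<^sup>2)"
    using norm_sum_sq[OF F, of "\<lambda>k. inner v (e k)"] by (simp add: power2_norm_eq_inner)
  moreover have "0 \<le> inner (v - ?p) (v - ?p)" by simp
  ultimately show ?thesis
    by (simp add: power2_norm_eq_inner inner_diff_left inner_diff_right inner_commute)
qed

lemma summable_coeff: "summable (\<lambda>k. (inner v (e k))\<^sup>2)"
  by (rule bounded_imp_summable[where B="(norm v)\<^sup>2"]) (auto intro: bessel_finite)

text \<open>The tail of the Bessel series of v: a rate of convergence shared by all diagonal
  operators whose coefficients obey the same bound.\<close>

definition "tail v n = (\<Sum>k. (inner v (e k))\<^sup>2) - (\<Sum>k<n. (inner v (e k))\<^sup>2)"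

lemma tail_tendsto: "tail v \<longlonglongrightarrow> 0"
proof -
  have "(\<lambda>n. (\<Sum>k. (inner v (e k))\<^sup>2) - (\<Sum>k<n. (inner v (e k))\<^sup>2)) \<longlonglongrightarrow> (\<Sum>k. (inner v (e k))\<^sup>2) - (\<Sum>k. (inner v (e k))\<^sup>2)"
    by (intro tendsto_intros summable_LIMSEQ summable_coeff)
  then show ?thesis by (simp add: tail_def[abs_def])
qed

lemma tail_nonneg: "0 \<le> tail v n"
  unfolding tail_def using sum_le_suminf[OF summable_coeff, of "{..<n}" v] by simp

lemma tail_0: "tail v 0 \<le> (norm v)\<^sup>2"
  unfolding tail_def by (auto intro: suminf_le_const[OF summable_coeff] bessel_finite)

lemma diag_block:
  assumes d: "\<And>k. \<bar>d k\<bar> \<le> M" and mn: "n \<le> m"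
  shows "norm (\<Sum>k\<in>{n..<m}. (d k * inner v (e k)) *\<^sub>R e k) \<le> M * sqrt (tail v n)"
proof -
  have M: "0 \<le> M" using d[of 0] by simp
  have "(norm (\<Sum>k\<in>{n..<m}. (d k * inner v (e k)) *\<^sub>R e k))\<^sup>2 = (\<Sum>k\<in>{n..<m}. (d k * inner v (e k))\<^sup>2)"
    by (rule norm_sum_sq) simp
  also have "\<dots> \<le> (\<Sum>k\<in>{n..<m}. M\<^sup>2 * (inner v (e k))\<^sup>2)"
  proof (rule sum_mono)
    fix k
    have "(d k)\<^sup>2 \<le> M\<^sup>2" using d[of k] M by (simp add: abs_le_square_iff[symmetric])
    then show "(d k * inner v (e k))\<^sup>2 \<le> M\<^sup>2 * (inner v (e k))\<^sup>2"
      unfolding power_mult_distrib by (rule mult_right_mono) simp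
  qed
  also have "\<dots> = M\<^sup>2 * (\<Sum>k\<in>{n..<m}. (inner v (e k))\<^sup>2)" by (simp add: sum_distrib_left)
  also have "\<dots> \<le> M\<^sup>2 * tail v n"
  proof (rule mult_left_mono)
    have "(\<Sum>k<n. (inner v (e k))\<^sup>2) + (\<Sum>k\<in>{n..<m}. (inner v (e k))\<^sup>2) = (\<Sum>k<m. (inner v (e k))\<^sup>2)"
      using sum.atLeastLessThan_concat[of 0 n m "\<lambda>k. (inner v (e k))\<^sup>2"] mn by (simp add: lessThan_atLeast0)
    moreover have "(\<Sum>k<m. (inner v (e k))\<^sup>2) \<le> (\<Sum>k. (inner v (e k))\<^sup>2)"
      by (rule sum_le_suminf[OF summable_coeff]) auto
    ultimately show "(\<Sum>k\<in>{n..<m}. (inner v (e k))\<^sup>2) \<le> tail v n" unfolding tail_def by linarith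
  qed simp
  also have "\<dots> = (M * sqrt (tail v n))\<^sup>2" using tail_nonneg by (simp add: power_mult_distrib)
  finally show ?thesis using M tail_nonneg by (auto intro: power2_le_imp_le)
qed

lemma diag_summable:
  assumes d: "\<And>k. \<bar>d k\<bar> \<le> M"
  shows "summable (\<lambda>k. (d k * inner v (e k)) *\<^sub>R e k)"
proof -
  let ?s = "\<lambda>n. \<Sum>k<n. (d k * inner v (e k)) *\<^sub>R e k"
  have "Cauchy ?s"
  proof (rule CauchyI')
    fix r :: real assume r: "r > 0"
    have "(\<lambda>n. M * sqrt (tail v n)) \<longlonglongrightarrow> M * sqrt 0" by (intro tendsto_intros tail_tendsto)
    then have "\<forall>\<^sub>F n in sequentially. M * sqrt (tail v n) < r" using r by (simp add: order_tendstoD(2))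
    then obtain N where N: "\<And>n. n \<ge> N \<Longrightarrow> M * sqrt (tail v n) < r" by (auto simp: eventually_sequentially)
    show "\<exists>N. \<forall>m\<ge>N. \<forall>n>m. dist (?s m) (?s n) < r"
    proof (intro exI[of _ N] allI impI)
      fix m n assume m: "m \<ge> N" and mn: "n > m"
      have "?s n - ?s m = (\<Sum>k\<in>{m..<n}. (d k * inner v (e k)) *\<^sub>R e k)"
        using sum.atLeastLessThan_concat[of 0 m n "\<lambda>k. (d k * inner v (e k)) *\<^sub>R e k"] mn
        by (simp add: lessThan_atLeast0 algebra_simps)
      moreover have "dist (?s m) (?s n) = norm (?s n - ?s m)" by (subst dist_commute) (rule dist_norm)
      ultimately have "dist (?s m) (?s n) \<le> M * sqrt (tail v m)"
        using diag_block[where d=d and M=M and n=m and m=n and v=v, OF d] mn by simp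
      also have "\<dots> < r" by (rule N[OF m])
      finally show "dist (?s m) (?s n) < r" .
    qed
  qed
  then have "convergent ?s" by (rule Cauchy_convergent)
  then show ?thesis by (simp only: summable_iff_convergent)
qed

lemma diag_tail:
  assumes d: "\<And>k. \<bar>d k\<bar> \<le> M"
  shows "norm ((\<Sum>k<n. (d k * inner v (e k)) *\<^sub>R e k) - (\<Sum>k. (d k * inner v (e k)) *\<^sub>R e k)) \<le> M * sqrt (tail v n)"
proof -
  let ?f = "\<lambda>k. (d k * inner v (e k)) *\<^sub>R e k"
  have "summable ?f" by (rule diag_summable[where d=d and M=M]) (rule d)
  then have "(\<lambda>m. \<Sum>k<m. ?f k) \<longlonglongrightarrow> (\<Sum>k. ?f k)" by (rule summable_LIMSEQ)
  then have "(\<lambda>m. norm ((\<Sum>k<m. ?f k) - (\<Sum>k<n. ?f k))) \<longlonglongrightarrow> norm ((\<Sum>k. ?f k) - (\<Sum>k<n. ?f k))"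
    by (intro tendsto_norm tendsto_diff tendsto_const)
  moreover have "\<forall>m\<ge>n. norm ((\<Sum>k<m. ?f k) - (\<Sum>k<n. ?f k)) \<le> M * sqrt (tail v n)"
  proof (intro allI impI)
    fix m assume "n \<le> m"
    moreover have "(\<Sum>k<m. ?f k) - (\<Sum>k<n. ?f k) = (\<Sum>k\<in>{n..<m}. ?f k)"
      using sum.atLeastLessThan_concat[of 0 n m ?f] \<open>n \<le> m\<close> by (simp add: lessThan_atLeast0 algebra_simps)
    ultimately show "norm ((\<Sum>k<m. ?f k) - (\<Sum>k<n. ?f k)) \<le> M * sqrt (tail v n)"
      using diag_block[where d=d and M=M and v=v, OF d] by simp
  qed
  ultimately have "norm ((\<Sum>k. ?f k) - (\<Sum>k<n. ?f k)) \<le> M * sqrt (tail v n)" by (intro LIMSEQ_le_const2) auto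
  then show ?thesis by (subst norm_minus_commute)
qed

lemma diag_norm:
  assumes d: "\<And>k. \<bar>d k\<bar> \<le> M"
  shows "norm (\<Sum>k. (d k * inner v (e k)) *\<^sub>R e k) \<le> M * norm v"
proof -
  have M: "0 \<le> M" using d[of 0] by simp
  have "sqrt (tail v 0) \<le> norm v" using tail_0 by (rule real_le_lsqrt[rotated]) simp_all
  then have "M * sqrt (tail v 0) \<le> M * norm v" using M by (rule mult_left_mono)
  then show ?thesis using diag_tail[where d=d and M=M and n=0 and v=v, OF d] by simp
qed

lemma diag_coeff:
  assumes d: "\<And>k. \<bar>d k\<bar> \<le> M"
  shows "inner (\<Sum>k. (d k * inner v (e k)) *\<^sub>R e k) (e j) = d j * inner v (e j)"
proof -
  have "inner (\<Sum>k. (d k * inner v (e k)) *\<^sub>R e k) (e j) = (\<Sum>k. inner ((d k * inner v (e k)) *\<^sub>R e k) (e j))"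
    by (rule sums_unique[OF bounded_linear.sums[OF bounded_linear_inner_left summable_sums[OF diag_summable[where d=d and M=M, OF d]]]])
  also have "(\<lambda>k. inner ((d k * inner v (e k)) *\<^sub>R e k) (e j)) = (\<lambda>k. if k = j then d k * inner v (e k) else 0)"
    by (auto simp: orth)
  also have "(\<Sum>k. if k = j then d k * inner v (e k) else 0) = d j * inner v (e j)"
    using sums_single[of j "\<lambda>k. d k * inner v (e k)"] by (simp add: sums_iff)
  finally show ?thesis .
qed

text \<open>The two bounds have different roles. \<open>M\<close> makes the series for T converge,
  so that its coefficients can be read off; \<open>c\<close> bounds the composed diagonal operator
  and is the only one in the conclusion.\<close>

lemma fpow_norm_le_diag:
  assumes T: "\<And>v. T v = (\<Sum>k. (d k * inner v (e k)) *\<^sub>R e k)"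
    and d: "\<And>k. \<bar>d k\<bar> \<le> M" and c: "\<And>k. lam k powr s * \<bar>d k\<bar> \<le> c"
  shows "fpow_norm_le e lam s T c"
proof -
  have c': "\<bar>lam k powr s * d k\<bar> \<le> c" for k using c[of k] by (simp add: abs_mult)
  have c0: "0 \<le> c" using c'[of 0] by simp
  have coeff: "(lam k powr s * inner (T v) (e k)) *\<^sub>R e k = (lam k powr s * d k * inner v (e k)) *\<^sub>R e k" for k v
    unfolding T diag_coeff[where d=d and M=M, OF d] by simp
  have F: "fpow e lam s (T v) = (\<Sum>k. (lam k powr s * d k * inner v (e k)) *\<^sub>R e k)" for v
    unfolding fpow_def coeff ..
  have sum: "summable (\<lambda>k. (lam k powr s * d k * inner v (e k)) *\<^sub>R e k)" for v by (rule diag_summable[where d="\<lambda>k. lam k powr s * d k" and M=c, OF c'])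
  have bl: "bounded_linear (\<lambda>v. fpow e lam s (T v))"
    unfolding F
  proof (rule bounded_linear_intro)
    show "(\<Sum>k. (lam k powr s * d k * inner (x + y) (e k)) *\<^sub>R e k) =
      (\<Sum>k. (lam k powr s * d k * inner x (e k)) *\<^sub>R e k) + (\<Sum>k. (lam k powr s * d k * inner y (e k)) *\<^sub>R e k)" for x y
      unfolding suminf_add[OF sum sum] by (simp add: inner_add_left distrib_left scaleR_add_left)
    show "(\<Sum>k. (lam k powr s * d k * inner (r *\<^sub>R x) (e k)) *\<^sub>R e k) =
      r *\<^sub>R (\<Sum>k. (lam k powr s * d k * inner x (e k)) *\<^sub>R e k)" for r x
    proof -
      have "(\<lambda>k. r *\<^sub>R ((lam k powr s * d k * inner x (e k)) *\<^sub>R e k)) sums (r *\<^sub>R (\<Sum>k. (lam k powr s * d k * inner x (e k)) *\<^sub>R e k))"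
        by (rule bounded_linear.sums[OF bounded_linear_scaleR_right summable_sums[OF sum]])
      from sums_unique[OF this] show ?thesis by (simp add: mult_ac)
    qed
    show "norm (\<Sum>k. (lam k powr s * d k * inner x (e k)) *\<^sub>R e k) \<le> norm x * c" for x
      using diag_norm[where d="\<lambda>k. lam k powr s * d k" and M=c and v=x, OF c'] by (simp add: mult.commute)
  qed
  moreover have "onorm (\<lambda>v. fpow e lam s (T v)) \<le> c"
    unfolding F by (rule onorm_bound[OF c0 diag_norm[where d="\<lambda>k. lam k powr s * d k" and M=c, OF c']])
  moreover have "range T \<subseteq> fpow_dom e lam s"
    unfolding fpow_dom_def using sum by (auto simp: coeff)
  ultimately show ?thesis by (simp add: fpow_norm_le_def)
qed

text \<open>The errors of the scalar difference quotients are bounded by 2 M uniformly in k and in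
  small h, so the tail of the error series is small uniformly in h, while each of the finitely many
  remaining terms tends to 0. Staying above t/2 gives |u'| <= 2 C / t.\<close>

lemma diag_has_vector_derivative:
  assumes S: "\<And>t v. t > 0 \<Longrightarrow> S t v = (\<Sum>k. (u k t * inner v (e k)) *\<^sub>R e k)"
    and du: "\<And>k t. t > 0 \<Longrightarrow> (u k has_real_derivative u' k t) (at t)"
    and bu: "\<And>k t. t > 0 \<Longrightarrow> \<bar>u k t\<bar> \<le> C" and bu': "\<And>k t. t > 0 \<Longrightarrow> t * \<bar>u' k t\<bar> \<le> C" and t: "t > 0"
  shows "((\<lambda>r. S r v) has_vector_derivative (\<Sum>k. (u' k t * inner v (e k)) *\<^sub>R e k)) (at t)"
proof -
  define M where "M = 2 * C / t"
  have bM: "\<bar>u' k x\<bar> \<le> M" if "x > t / 2" for k x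
  proof -
    have "t / 2 * \<bar>u' k x\<bar> \<le> x * \<bar>u' k x\<bar>" using that by (intro mult_right_mono) auto
    also have "\<dots> \<le> C" using that t by (intro bu') simp
    finally show ?thesis using t by (simp add: M_def field_simps)
  qed
  define q where "q h k = (u k (t + h) - u k t) / h - u' k t" for h k
  have q: "\<bar>q h k\<bar> \<le> 2 * M" if h: "h \<noteq> 0" "\<bar>h\<bar> < t / 2" for h k
  proof -
    have "norm (u k (t + h) - u k t) \<le> M * norm (t + h - t)"
    proof (rule field_differentiable_bound[where S="{t / 2<..}" and f'="u' k"])
      show "(u k has_field_derivative u' k x) (at x within {t / 2<..})" if "x \<in> {t / 2<..}" for x
        by (rule has_field_derivative_at_within[OF du]) (use that t in simp)
      show "norm (u' k x) \<le> M" if "x \<in> {t / 2<..}" for x using bM that by simp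
    qed (use h t in auto)
    then have "\<bar>(u k (t + h) - u k t) / h\<bar> \<le> M" using h by (simp add: abs_divide divide_le_eq)
    moreover have "\<bar>u' k t\<bar> \<le> M" using bM[of t] t by simp
    ultimately show ?thesis unfolding q_def by linarith
  qed
  have M: "M \<ge> 0" using bM[of t 0] t by simp
  have q0: "((\<lambda>h. q h k) \<longlongrightarrow> 0) (at 0)" for k
    using du[OF t, of k] unfolding DERIV_def q_def by (rule LIM_zero)
  define E where "E h = (\<Sum>k. (q h k * inner v (e k)) *\<^sub>R e k)" for h
  have ev: "\<forall>\<^sub>F h in at 0. h \<noteq> 0 \<and> \<bar>h\<bar> < t / 2"
    using t by (auto simp: eventually_at intro!: exI[of _ "t / 2"])
  have "(E \<longlongrightarrow> 0) (at 0)"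
  proof (rule tendstoI)
    fix r :: real assume r: "r > 0"
    have "(\<lambda>n. 2 * M * sqrt (tail v n)) \<longlonglongrightarrow> 2 * M * sqrt 0" by (intro tendsto_intros tail_tendsto)
    then have "\<forall>\<^sub>F n in sequentially. 2 * M * sqrt (tail v n) < r / 2"
      by (rule order_tendstoD(2)) (use r in simp)
    then obtain n where n: "2 * M * sqrt (tail v n) < r / 2" by (auto simp: eventually_sequentially)
    have "((\<lambda>h. \<Sum>k<n. (q h k * inner v (e k)) *\<^sub>R e k) \<longlongrightarrow> (\<Sum>k<n. (0 * inner v (e k)) *\<^sub>R e k)) (at 0)"
      by (intro tendsto_intros q0)
    then have "\<forall>\<^sub>F h in at 0. dist (\<Sum>k<n. (q h k * inner v (e k)) *\<^sub>R e k) 0 < r / 2"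
      using r by (intro tendstoD) auto
    then show "\<forall>\<^sub>F h in at 0. dist (E h) 0 < r"
      using ev
    proof eventually_elim
      case (elim h)
      have "norm ((\<Sum>k<n. (q h k * inner v (e k)) *\<^sub>R e k) - E h) \<le> 2 * M * sqrt (tail v n)"
        unfolding E_def by (rule diag_tail[where d="q h"], rule q) (use elim in auto)
      then show ?case
        using elim n norm_triangle_sub[of "E h" "\<Sum>k<n. (q h k * inner v (e k)) *\<^sub>R e k"]
        by (simp add: dist_norm norm_minus_commute)
    qed
  qed
  then have "((\<lambda>h. norm (E h)) \<longlongrightarrow> 0) (at 0)" by (rule tendsto_norm_zero)
  moreover have "\<forall>\<^sub>F h in at 0. norm (E h) = norm (S (t + h) v - S t v - h *\<^sub>R (\<Sum>k. (u' k t * inner v (e k)) *\<^sub>R e k)) / norm h"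
    using ev
  proof eventually_elim
    case (elim h)
    have th: "t + h > 0" using elim t by auto
    have "(\<lambda>k. (u k (t + h) * inner v (e k)) *\<^sub>R e k - (u k t * inner v (e k)) *\<^sub>R e k - h *\<^sub>R ((u' k t * inner v (e k)) *\<^sub>R e k))
      sums (S (t + h) v - S t v - h *\<^sub>R (\<Sum>k. (u' k t * inner v (e k)) *\<^sub>R e k))"
    proof -
      have "(\<lambda>k. (u k x * inner v (e k)) *\<^sub>R e k) sums S x v" if "x > 0" for x
        unfolding S[OF that] by (rule summable_sums[OF diag_summable[where d="\<lambda>k. u k x" and M=C, OF bu[OF that]]])
      moreover have "(\<lambda>k. (u' k t * inner v (e k)) *\<^sub>R e k) sums (\<Sum>k. (u' k t * inner v (e k)) *\<^sub>R e k)"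
        by (rule summable_sums[OF diag_summable[where d="\<lambda>k. u' k t" and M=M, OF bM]]) (use t in simp)
      ultimately show ?thesis
        using th t by (intro sums_diff bounded_linear.sums[OF bounded_linear_scaleR_right]) auto
    qed
    also have "(\<lambda>k. (u k (t + h) * inner v (e k)) *\<^sub>R e k - (u k t * inner v (e k)) *\<^sub>R e k - h *\<^sub>R ((u' k t * inner v (e k)) *\<^sub>R e k))
      = (\<lambda>k. h *\<^sub>R ((q h k * inner v (e k)) *\<^sub>R e k))"
    proof
      fix k
      have "u k (t + h) * c - u k t * c - h * (u' k t * c) = h * (q h k * c)" for c
        using elim by (simp add: q_def field_simps)
      then show "(u k (t + h) * inner v (e k)) *\<^sub>R e k - (u k t * inner v (e k)) *\<^sub>R e k - h *\<^sub>R ((u' k t * inner v (e k)) *\<^sub>R e k)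
        = h *\<^sub>R ((q h k * inner v (e k)) *\<^sub>R e k)"
        by (simp only: scaleR_scaleR scaleR_diff_left[symmetric])
    qed
    finally have "(\<lambda>k. h *\<^sub>R ((q h k * inner v (e k)) *\<^sub>R e k)) sums (S (t + h) v - S t v - h *\<^sub>R (\<Sum>k. (u' k t * inner v (e k)) *\<^sub>R e k))" .
    moreover have "(\<lambda>k. h *\<^sub>R ((q h k * inner v (e k)) *\<^sub>R e k)) sums (h *\<^sub>R E h)"
      unfolding E_def
      by (rule bounded_linear.sums[OF bounded_linear_scaleR_right summable_sums[OF diag_summable[where d="q h" and M="2 * M", OF q]]])
        (use elim in auto)
    ultimately have "S (t + h) v - S t v - h *\<^sub>R (\<Sum>k. (u' k t * inner v (e k)) *\<^sub>R e k) = h *\<^sub>R E h"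
      by (rule sums_unique2)
    then show ?case using elim by simp
  qed
  ultimately have "((\<lambda>h. norm (S (t + h) v - S t v - h *\<^sub>R (\<Sum>k. (u' k t * inner v (e k)) *\<^sub>R e k)) / norm h) \<longlongrightarrow> 0) (at 0)"
    by (simp cong: tendsto_cong)
  then show ?thesis
    unfolding has_vector_derivative_def has_derivative_at by (simp add: bounded_linear_scaleR_left)
qed

end


section \<open>Interpolation\<close>

lemma interpolation_powr:
  fixes x p q \<sigma> :: real
  assumes "0 \<le> x" "x \<le> p" "x \<le> q" "0 \<le> \<sigma>" "\<sigma> \<le> 1"
  shows "x \<le> p powr (1 - \<sigma>) * q powr \<sigma>"
proof (cases "x = 0")
  case False
  then have "x = x powr (1 - \<sigma>) * x powr \<sigma>" using assms by (simp add: powr_add[symmetric])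
  also have "\<dots> \<le> p powr (1 - \<sigma>) * q powr \<sigma>"
    using assms by (intro mult_mono powr_mono2) auto
  finally show ?thesis .
qed simp

text \<open>Passes from the iterated \<open>deriv\<close> of \<open>two_regular\<close> to explicit
  transforms. The equality of first derivatives on the open half-plane is what allows the second one
  to be computed.\<close>

lemma sectorial_kernel_of_admissible:
  assumes la: "laplace_abs b 0" and r: "two_regular b" and a: "sector_angle b < pi / 2"
  obtains K where "sectorial_kernel b K (sin (sector_angle b))"
proof -
  obtain C where C: "C > 0" and reg: "\<And>z j. Re z > 0 \<Longrightarrow> j \<le> 2 \<Longrightarrow> cmod z ^ j * cmod ((deriv ^^ j) (laplace b) z) \<le> C * cmod (laplace b z)"
    using r unfolding two_regular_def by blast
  have d1: "deriv (laplace b) z = - laplace (\<lambda>t. t * b t) z" if "Re z > 0" for z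
    by (rule DERIV_imp_deriv[OF laplace_has_field_derivative[OF la that]])
  have d2: "deriv (deriv (laplace b)) z = laplace (\<lambda>t. t * (t * b t)) z" if z: "Re z > 0" for z
  proof (rule DERIV_imp_deriv)
    have "((\<lambda>z. - laplace (\<lambda>t. t * b t) z) has_field_derivative laplace (\<lambda>t. t * (t * b t)) z) (at z)"
      using DERIV_minus[OF laplace_has_field_derivative[OF laplace_abs_times[OF la] z]] by simp
    then show "(deriv (laplace b) has_field_derivative laplace (\<lambda>t. t * (t * b t)) z) (at z)"
      by (rule has_field_derivative_transform_within_open[OF _ open_halfspace_Re_gt[of 0]]) (use z d1 in auto)
  qed
  have CK: "C * cmod (laplace b z) \<le> max 1 C * cmod (laplace b z)" for z by (rule mult_right_mono) auto
  show ?thesis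
  proof (rule that, unfold_locales)
    show "laplace_abs b 0" by (rule la)
    show "1 \<le> max 1 C" by simp
    show "0 \<le> sin (sector_angle b)" using a sector_angle_nonneg[of b] by (intro sin_ge_zero) auto
    show "sin (sector_angle b) < 1"
      using sin_monotone_2pi[of "sector_angle b" "pi / 2"] a sector_angle_nonneg[of b] by simp
    fix z assume z: "Re z > 0"
    show "cmod z * cmod (laplace (\<lambda>t. t * b t) z) \<le> max 1 C * cmod (laplace b z)"
      using reg[OF z, of 1] d1[OF z] CK[of z] by simp
    show "(cmod z)\<^sup>2 * cmod (laplace (\<lambda>t. t * (t * b t)) z) \<le> max 1 C * cmod (laplace b z)"
      using reg[OF z, of 2] d2[OF z] CK[of z] by (simp add: numeral_2_eq_2)
    show "0 \<le> Re (laplace b z)" "\<bar>Im (laplace b z)\<bar> \<le> sin (sector_angle b) * cmod (laplace b z)"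
      using sector_Re_Im[OF Arg_laplace_le_sector_angle[OF z] a] by auto
  qed
qed

theorem lemma4p4:
  fixes \<rho> :: real and b :: "real \<Rightarrow> real"
    and D :: "'h::{real_inner, complete_space} set"
    and A :: "'h \<Rightarrow> 'h" and e :: "nat \<Rightarrow> 'h" and lam :: "nat \<Rightarrow> real"
    and S :: "real \<Rightarrow> 'h \<Rightarrow> 'h"
  assumes "separable_space (euclidean :: 'h topology)"
    and "1 < \<rho>" "\<rho> < 2"
    and "admissible_kernel \<rho> b"
    and "admissible_operator D A"
    and "eigenpairs D A e lam"
    and "resolvent_family b e lam S"
  shows "(\<forall>t>0. \<forall>v. (\<lambda>r. S r v) differentiable at t) \<and>
    (\<exists>C>0. \<forall>t>0.
       (\<forall>s\<in>{0..1/\<rho>}. fpow_norm_le e lam s (S t) (C * t powr (- s * \<rho>))) \<and>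
       (\<forall>s\<in>{0..1/\<rho>}. fpow_norm_le e lam s (strong_deriv S t) (C * t powr (- s * \<rho> - 1))) \<and>
       (\<forall>s\<in>{0..1}. fpow_norm_le e lam (- s) (strong_deriv S t)
          (C * L1_norm_upto b t powr s * t powr (s - 1)))) \<and>
    (four_monotone b \<and> (b \<longlongrightarrow> 0) at_top \<and>
     Limsup (at_right 0) (\<lambda>t. ereal (moment_ratio b t)) < \<infinity> \<and>
     Limsup at_top (\<lambda>t. ereal (moment_ratio b t)) < \<infinity> \<and>
     \<rho> = 1 + 2 / pi * sector_angle b \<and>
     laplace_comparable b (1 - \<rho>)
     \<longrightarrow> (\<exists>C>0. \<forall>t>0. \<forall>s\<in>{0..1}.
           fpow_norm_le e lam (- s) (strong_deriv S t) (C * t powr (\<rho> * s - 1))))"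
proof -
  note \<rho> = assms(2,3)
  have loc: "locally_L1 b" and sub: "subexponential b" and reg: "two_regular b" and ang: "sector_angle b < pi / 2"
    using assms(4) by (auto simp: admissible_kernel_def)
  obtain g g1 g2 g3 C where bg: "boundary_function b g" and tg: "three_derivs g g1 g2 g3" and C: "C > 0"
    and nn: "\<And>\<mu>. \<mu> > 0 \<Longrightarrow> (\<integral>\<^sup>+k\<in>{0<..}. ennreal ((cmod (of_real (k\<^sup>2) * g3 k) + cmod (of_real k * g2 k) + cmod (g1 k) + 1 / \<mu>)
        / (\<bar>k\<bar> + \<mu> * cmod (g k))\<^sup>2) \<partial>lebesgue) \<le> ennreal (C / \<mu> powr (1 + 1 / \<rho>))"
    using assms(4) unfolding admissible_kernel_def by blast
  have la: "laplace_abs b 0" by (rule kernel_laplace_abs[OF loc sub])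
  obtain K where sk: "sectorial_kernel b K (sin (sector_angle b))" using sectorial_kernel_of_admissible[OF la reg ang] by blast
  interpret sectorial_kernel b K "sin (sector_angle b)" by (rule sk)
  interpret boundary_kernel b K "sin (sector_angle b)" g g1 g2 g3 by unfold_locales (rule bg, rule tg)
  have orth: "\<And>i j. inner (e i) (e j) = (if i = j then 1 else 0)" and lam0: "0 < lam 0" and inc: "incseq lam"
    using assms(6) by (auto simp: eigenpairs_def orthonormal_basis_def)
  interpret orthonormal_sequence e by unfold_locales (rule orth)
  have lam: "lam k > 0" for k using lam0 incseqD[OF inc, of 0 k] by simp
  obtain u where u: "\<And>k. scalar_resolvent b (lam k) (u k)"
    and S: "\<And>t v. t \<ge> 0 \<Longrightarrow> S t v = (\<Sum>k. (u k t * inner v (e k)) *\<^sub>R e k)"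
    using assms(7) by (auto simp: resolvent_family_def)
  define u' where "u' k t = - lam k * conv b (u k) t" for k t
  \<comment> \<open>One constant for both kinds of bounds, independent of k and t. The qualified
    name avoids a clash with the operator \<open>A\<close>.\<close>
  define Q where "Q = max C0 (boundary_kernel.A K (sin (sector_angle b)) * C)"
  have Q: "Q > 0" using C0_pos by (simp add: Q_def)
  note sb = scalar_bounds[OF lam C loc nn[OF lam] u, folded u'_def]
  have bu: "\<bar>u k t\<bar> \<le> Q" and bu': "t * \<bar>u' k t\<bar> \<le> Q" if "t > 0" for k t
    using sb(1,4)[OF that, of k] by (auto simp: Q_def)
  have du: "(u k has_real_derivative u' k t) (at t)" if "t > 0" for k t by (rule sb(3)[OF that])
  have dS: "((\<lambda>r. S r v) has_vector_derivative (\<Sum>k. (u' k t * inner v (e k)) *\<^sub>R e k)) (at t)" if "t > 0" for t v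
    by (rule diag_has_vector_derivative[where u=u, OF S du bu bu' that]) auto
  have sd: "strong_deriv S t v = (\<Sum>k. (u' k t * inner v (e k)) *\<^sub>R e k)" if "t > 0" for t v
    unfolding strong_deriv_def by (rule vector_derivative_at[OF dS[OF that]])
  have u'_bound: "\<bar>u' k t\<bar> \<le> Q / t" if "t > 0" for k t using bu'[OF that, of k] that by (simp add: field_simps)
  have Q2: "lam k powr (1 / \<rho>) * (t * \<bar>u k t\<bar>) \<le> Q" "lam k powr (1 / \<rho>) * (t\<^sup>2 * \<bar>u' k t\<bar>) \<le> Q" if "t > 0" for k t
  proof -
    have l: "lam k powr (1 / \<rho>) > 0" using lam[of k] by simp
    have "x \<le> a / l \<Longrightarrow> l * x \<le> a" if "l > 0" for x a l :: real using that by (simp add: field_simps)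
    from this[OF l sb(2)[OF that, of k]] this[OF l sb(5)[OF that, of k]]
    show "lam k powr (1 / \<rho>) * (t * \<bar>u k t\<bar>) \<le> Q" "lam k powr (1 / \<rho>) * (t\<^sup>2 * \<bar>u' k t\<bar>) \<le> Q"
      by (auto simp: Q_def)
  qed
  have pw: "Q powr (1 - \<sigma>) * Q powr \<sigma> = Q" for \<sigma> using Q by (simp add: powr_add[symmetric])
  have pm: "(Q * t powr x) powr y = Q powr y * t powr (x * y)" if "t > 0" for t x y
    using Q that by (simp add: powr_mult powr_powr)
  have pl: "(Q * (lam k powr x * t powr x')) powr y = Q powr y * (lam k powr (x * y) * t powr (x' * y))" if "t > 0" for k t x x' y
    using Q that lam[of k] by (simp add: powr_mult powr_powr)
  have pn: "(Q * (lam k * N)) powr y = Q powr y * (lam k powr y * N powr y)" if "0 \<le> N" for k N y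
    using Q that lam[of k] by (simp add: powr_mult)
  have e\<rho>: "- 1 / \<rho> * (s * \<rho>) = - s" for s using \<rho> by simp
  have R1: "fpow_norm_le e lam s (S t) (Q * t powr (- s * \<rho>))" if t: "t > 0" and s: "s \<in> {0..1/\<rho>}" for t s
  proof (rule fpow_norm_le_diag[OF S bu[OF t]])
    fix k
    \<comment> \<open>The interpolation parameter is s \<rho>, so that the endpoint factor
      lam^(-1/\<rho>) becomes lam^(-s) and cancels the fractional power.\<close>
    have \<sigma>: "0 \<le> s * \<rho>" "s * \<rho> \<le> 1" using s \<rho> by (auto simp: field_simps)
    have "\<bar>u k t\<bar> \<le> Q powr (1 - s * \<rho>) * (Q * (lam k powr (- 1 / \<rho>) * t powr - 1)) powr (s * \<rho>)"
    proof (rule interpolation_powr[OF _ bu[OF t] _ \<sigma>])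
      show "\<bar>u k t\<bar> \<le> Q * (lam k powr (- 1 / \<rho>) * t powr - 1)"
        using Q2(1)[OF t, of k] lam[of k] t by (simp add: powr_minus field_simps)
    qed simp
    also have "\<dots> = Q * (lam k powr (- s) * t powr (- s * \<rho>))"
    proof -
      have ex: "- 1 * (s * \<rho>) = - s * \<rho>" by simp
      show ?thesis unfolding pl[OF t] e\<rho> ex by (simp only: mult.assoc[symmetric] pw)
    qed
    finally have "lam k powr s * \<bar>u k t\<bar> \<le> lam k powr s * (Q * (lam k powr (- s) * t powr (- s * \<rho>)))"
      by (rule mult_left_mono) simp
    also have "\<dots> = Q * t powr (- s * \<rho>)" using lam[of k] by (simp add: powr_minus)
    finally show "lam k powr s * \<bar>u k t\<bar> \<le> Q * t powr (- s * \<rho>)" .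
  qed (use t in simp)
  have R2: "fpow_norm_le e lam s (strong_deriv S t) (Q * t powr (- s * \<rho> - 1))" if t: "t > 0" and s: "s \<in> {0..1/\<rho>}" for t s
  proof (rule fpow_norm_le_diag[OF sd[OF t] u'_bound[OF t]])
    fix k
    have \<sigma>: "0 \<le> s * \<rho>" "s * \<rho> \<le> 1" using s \<rho> by (auto simp: field_simps)
    \<comment> \<open>Between Q / t and Q lam^(-1/\<rho>) / t^2 the exponent of t is - (1 - s
      \<rho>) - 2 s \<rho> = - s \<rho> - 1.\<close>
    have "\<bar>u' k t\<bar> \<le> (Q * t powr - 1) powr (1 - s * \<rho>) * (Q * (lam k powr (- 1 / \<rho>) * t powr - 2)) powr (s * \<rho>)"
    proof (rule interpolation_powr[OF _ _ _ \<sigma>])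
      show "\<bar>u' k t\<bar> \<le> Q * t powr - 1" using u'_bound[OF t, of k] t by (simp add: powr_minus divide_inverse)
      show "\<bar>u' k t\<bar> \<le> Q * (lam k powr (- 1 / \<rho>) * t powr - 2)"
        using Q2(2)[OF t, of k] lam[of k] t by (simp add: powr_minus field_simps)
    qed simp
    also have "\<dots> = (Q powr (1 - s * \<rho>) * Q powr (s * \<rho>)) * lam k powr (- s) * (t powr (- 1 * (1 - s * \<rho>)) * t powr (- 2 * (s * \<rho>)))"
      unfolding pl[OF t] pm[OF t] e\<rho> by (simp only: mult_ac)
    also have "\<dots> = Q * (lam k powr (- s) * t powr (- s * \<rho> - 1))"
    proof -
      have ex: "- 1 * (1 - s * \<rho>) + - 2 * (s * \<rho>) = - s * \<rho> - 1" by (simp add: algebra_simps)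
      show ?thesis unfolding pw by (simp only: powr_add[symmetric] mult.assoc ex)
    qed
    finally have "lam k powr s * \<bar>u' k t\<bar> \<le> lam k powr s * (Q * (lam k powr (- s) * t powr (- s * \<rho> - 1)))"
      by (rule mult_left_mono) simp
    also have "\<dots> = Q * t powr (- s * \<rho> - 1)" using lam[of k] by (simp add: powr_minus)
    finally show "lam k powr s * \<bar>u' k t\<bar> \<le> Q * t powr (- s * \<rho> - 1)" .
  qed
  have N0: "0 \<le> L1_norm_upto b t" for t unfolding L1_norm_upto_def set_lebesgue_integral_def by (rule Bochner_Integration.integral_nonneg) simp
  have coeff3: "lam k powr (- s) * \<bar>u' k t\<bar> \<le> Q * L1_norm_upto b t powr s * t powr (s - 1)"
    if t: "t > 0" and s: "s \<in> {0..1}" for t s k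
  proof -
    define N where "N = L1_norm_upto b t"
    have N: "0 \<le> N" using N0 by (simp add: N_def)
    \<comment> \<open>If N = 0 then \<open>N powr s\<close> is 0 even for s = 0. The claim is then
      that u' vanishes at t, and the endpoint bound Q lam N does give this.\<close>
    have "\<bar>u' k t\<bar> \<le> (Q * t powr - 1) powr (1 - s) * (Q * (lam k * N)) powr s"
    proof (rule interpolation_powr)
      show "\<bar>u' k t\<bar> \<le> Q * t powr - 1" using u'_bound[OF t, of k] t by (simp add: powr_minus divide_inverse)
      have "C0 * (lam k * N) \<le> Q * (lam k * N)" using N lam[of k] by (intro mult_right_mono) (auto simp: Q_def)
      then show "\<bar>u' k t\<bar> \<le> Q * (lam k * N)" using sb(6)[OF t, of k] by (simp add: N_def mult.assoc)
    qed (use s in auto)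
    also have "\<dots> = (Q powr (1 - s) * Q powr s) * lam k powr s * N powr s * t powr (- 1 * (1 - s))"
      unfolding pm[OF t] pn[OF N] by (simp only: mult_ac)
    also have "\<dots> = lam k powr s * (Q * N powr s * t powr (s - 1))" unfolding pw by simp
    finally have "lam k powr (- s) * \<bar>u' k t\<bar> \<le> lam k powr (- s) * (lam k powr s * (Q * N powr s * t powr (s - 1)))"
      by (rule mult_left_mono) simp
    also have "\<dots> = Q * N powr s * t powr (s - 1)" using lam[of k] by (simp add: powr_minus)
    finally show ?thesis by (simp add: N_def)
  qed
  have R3: "fpow_norm_le e lam (- s) (strong_deriv S t) (Q * L1_norm_upto b t powr s * t powr (s - 1))"
    if t: "t > 0" and s: "s \<in> {0..1}" for t s
    by (rule fpow_norm_le_diag[OF sd[OF t] u'_bound[OF t] coeff3[OF t s]])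
  have R4: "\<exists>C>0. \<forall>t>0. \<forall>s\<in>{0..1}. fpow_norm_le e lam (- s) (strong_deriv S t) (C * t powr (\<rho> * s - 1))"
    if m: "four_monotone b" and eq: "\<rho> = 1 + 2 / pi * sector_angle b" and comp: "laplace_comparable b (1 - \<rho>)"
  proof -
    have nonneg: "0 \<le> b r" if "r > 0" for r
    proof -
      \<comment> \<open>The case n = 0 of the sign conditions is the nonnegativity of the
        kernel.\<close>
      have "(-1) ^ 0 * (deriv ^^ 0) b r \<ge> 0" using m that unfolding four_monotone_def by blast
      then show ?thesis by simp
    qed
    have "(\<rho> - 1) * (pi / 2) = sector_angle b" using eq by (simp add: field_simps)
    then have arg: "\<bar>Arg (laplace b z)\<bar> \<le> (\<rho> - 1) * (pi / 2)" if "Re z > 0" for z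
      using Arg_laplace_le_sector_angle[OF that, of b] by simp
    obtain C' where C': "C' > 0" and N: "\<And>t. t > 0 \<Longrightarrow> L1_norm_upto b t \<le> C' * t powr (\<rho> - 1)"
      using L1_norm_growth[OF \<rho> arg nonneg comp] by blast
    show ?thesis
    \<comment> \<open>For 0 <= s <= 1 the power C'^s is at most max 1 C', which keeps the constant
      independent of s.\<close>
    proof (intro exI[of _ "Q * max 1 C'"] conjI allI impI ballI)
      show "0 < Q * max 1 C'" using Q by simp
      fix t s :: real assume t: "t > 0" and s: "s \<in> {0..1}"
      show "fpow_norm_le e lam (- s) (strong_deriv S t) (Q * max 1 C' * t powr (\<rho> * s - 1))"
      proof (rule fpow_norm_le_diag[OF sd[OF t] u'_bound[OF t]])
        fix k
        have "L1_norm_upto b t powr s \<le> (C' * t powr (\<rho> - 1)) powr s"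
          using s by (intro powr_mono2 N t N0) auto
        also have "\<dots> = C' powr s * t powr ((\<rho> - 1) * s)" using C' by (simp add: powr_mult powr_powr)
        also have "\<dots> \<le> max 1 C' * t powr ((\<rho> - 1) * s)"
        proof (rule mult_right_mono)
          have "C' powr s \<le> max 1 C' powr s" using s C' by (intro powr_mono2) auto
          also have "\<dots> \<le> max 1 C' powr 1" using s by (intro powr_mono) auto
          finally show "C' powr s \<le> max 1 C'" by simp
        qed simp
        finally have "Q * L1_norm_upto b t powr s * t powr (s - 1) \<le> Q * (max 1 C' * t powr ((\<rho> - 1) * s)) * t powr (s - 1)"
          using Q by (intro mult_right_mono mult_left_mono) auto
        also have "\<dots> = Q * max 1 C' * (t powr ((\<rho> - 1) * s) * t powr (s - 1))" by simp
        also have "\<dots> = Q * max 1 C' * t powr (\<rho> * s - 1)" unfolding powr_add[symmetric] by (simp add: algebra_simps)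
        finally show "lam k powr (- s) * \<bar>u' k t\<bar> \<le> Q * max 1 C' * t powr (\<rho> * s - 1)"
          using coeff3[OF t s, of k] by (rule order_trans[rotated])
      qed
    qed
  qed
  show ?thesis
  proof (intro conjI)
    \<comment> \<open>As \<open>vector_derivative\<close> is total, this conjunct is what makes
      \<open>strong_deriv\<close> a genuine derivative.\<close>
    show "\<forall>t>0. \<forall>v. (\<lambda>r. S r v) differentiable at t"
      using differentiableI_vector[OF dS] by blast
    show "\<exists>C>0. \<forall>t>0.
       (\<forall>s\<in>{0..1/\<rho>}. fpow_norm_le e lam s (S t) (C * t powr (- s * \<rho>))) \<and>
       (\<forall>s\<in>{0..1/\<rho>}. fpow_norm_le e lam s (strong_deriv S t) (C * t powr (- s * \<rho> - 1))) \<and>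
       (\<forall>s\<in>{0..1}. fpow_norm_le e lam (- s) (strong_deriv S t) (C * L1_norm_upto b t powr s * t powr (s - 1)))"
      using Q R1 R2 R3 by (intro exI[of _ Q]) blast
  qed (use R4 in blast)
qed

end
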